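(* Let $(X_k)_{k\in\mathbb{Z}}$ be a stationary reversible real-valued Markov chain whose marginal distribution has a density $f$. For $k\ge1$ let $$\alpha_k=\sup_{A,B\in\mathcal{B}}\big|\mathbb{P}(X_0\in A,X_k\in B)-\mathbb{P}(X_0\in A)\mathbb{P}(X_k\in B)\big|,$$ where $\mathcal{B}$ is the Borel sigma-algebra on $\mathbb{R}$, and assume that $$\sum_{k\ge1}k\,\alpha_k<\infty.$$ Let $(b_n)$ be a sequence of positive bandwidths with $b_n\to0$ and $nb_n^4\to\infty$. Let $K:\mathbb{R}\to[0,\infty)$ be a kernel (a probability density) satisfying: (C1) $K$ is symmetric, decreasing on $(0,\infty)$, and $\int K(u)\,du=1$; (C2) $x^2K(x)\to0$ as $x\to\infty$; (C3) $K$ is differentiable with $K'$ bounded. Let $$\hat f_n(x)=\frac{1}{nb_n}\sum_{k=1}^nK\Big(\frac{x-X_k}{b_n}\Big).$$ Let $x_1,\dots,x_m$ be distinct real points such that, for each $j$, $f$ is continuous at $x_j$ and $f(x_j)\ne0$. Assume that $(X_0,X_2)$ has a joint density $f_2$ which is locally bounded around each pair $(x_i,x_j)$, $1\le i,j\le m$: for each such pair there exist constants $M>0$ and $C_M$ (depending on $(x_i,x_j)$) such that $$\sup_{|a|<M,\ |b|<M}|f_2(x_i+a,x_j+b)|<C_M.$$ Then, as $n\to\infty$, $$\sqrt{nb_n}\left(\frac{\hat f_n(x_j)-\mathbb{E}\hat f_n(x_j)}{\big(\hat f_n(x_j)\int K^2(u)\,du\big)^{1/2}},\ 1\le j\le m\right)\Rightarrow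 N(0,I_m),$$ where $\Rightarrow$ denotes convergence in distribution and $I_m$ is the $m\times m$ identity matrix.
   Context: A stationary (strictly stationary) Markov chain $(X_k)_{k\in\mathbb{Z}}$ is reversible if $(X_0,X_1)$ and $(X_1,X_0)$ have the same distribution. On the event $\{\hat f_n(x_j)=0\}$ the corresponding ratio may be assigned an arbitrary value (e.g. $0$). *)

theory Defs
  imports "HOL-Probability.Probability"
begin

definition strictly_stationary :: "'w measure \<Rightarrow> (int \<Rightarrow> 'w \<Rightarrow> real) \<Rightarrow> bool" where
  "strictly_stationary M X \<longleftrightarrow>
     (\<forall>k. X k \<in> borel_measurable M) \<and>
     (\<forall>J h. finite J \<longrightarrow>
        distr M (\<Pi>\<^sub>M i\<in>J. borel) (\<lambda>\<omega>. \<lambda>i\<in>J. X (i + h) \<omega>) =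
        distr M (\<Pi>\<^sub>M i\<in>J. borel) (\<lambda>\<omega>. \<lambda>i\<in>J. X i \<omega>))"

definition past_algebra :: "'w measure \<Rightarrow> (int \<Rightarrow> 'w \<Rightarrow> real) \<Rightarrow> int \<Rightarrow> 'w measure" where
  "past_algebra M X k =
     vimage_algebra (space M) (\<lambda>\<omega>. \<lambda>i\<in>{..k}. X i \<omega>) (\<Pi>\<^sub>M i\<in>{..k}. borel)"

definition markov_chain :: "'w measure \<Rightarrow> (int \<Rightarrow> 'w \<Rightarrow> real) \<Rightarrow> bool" where
  "markov_chain M X \<longleftrightarrow>
     (\<forall>k. X k \<in> borel_measurable M) \<and>
     (\<forall>k. \<forall>A\<in>sets borel. AE \<omega> in M.
        real_cond_exp M (past_algebra M X k) (\<lambda>\<omega>. indicator A (X (k + 1) \<omega>)) \<omega> =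
        real_cond_exp M (vimage_algebra (space M) (X k) borel)
          (\<lambda>\<omega>. indicator A (X (k + 1) \<omega>)) \<omega>)"

definition reversible :: "'w measure \<Rightarrow> (int \<Rightarrow> 'w \<Rightarrow> real) \<Rightarrow> bool" where
  "reversible M X \<longleftrightarrow>
     distr M (borel \<Otimes>\<^sub>M borel) (\<lambda>\<omega>. (X 0 \<omega>, X 1 \<omega>)) =
     distr M (borel \<Otimes>\<^sub>M borel) (\<lambda>\<omega>. (X 1 \<omega>, X 0 \<omega>))"

definition alpha_mixing :: "'w measure \<Rightarrow> (int \<Rightarrow> 'w \<Rightarrow> real) \<Rightarrow> nat \<Rightarrow> real" where
  "alpha_mixing M X k =
     (SUP (A, B) \<in> sets borel \<times> sets borel.
        \<bar>\<P>(\<omega> in M. X 0 \<omega> \<in> A \<and> X (int k) \<omega> \<in> B) -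
         \<P>(\<omega> in M. X 0 \<omega> \<in> A) * \<P>(\<omega> in M. X (int k) \<omega> \<in> B)\<bar>)"

definition kde ::
  "(real \<Rightarrow> real) \<Rightarrow> (nat \<Rightarrow> real) \<Rightarrow> (int \<Rightarrow> 'w \<Rightarrow> real) \<Rightarrow> nat \<Rightarrow> real \<Rightarrow> 'w \<Rightarrow> real" where
  "kde K b X n x \<omega> =
     1 / (real n * b n) * (\<Sum>k=1..n. K ((x - X (int k) \<omega>) / b n))"

text \<open>The argument \<open>c\<close> is the value given to the ratio where the estimator vanishes.\<close>

definition kde_ratio ::
  "'w measure \<Rightarrow> (real \<Rightarrow> real) \<Rightarrow> (nat \<Rightarrow> real) \<Rightarrow> (int \<Rightarrow> 'w \<Rightarrow> real) \<Rightarrow>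
   real \<Rightarrow> nat \<Rightarrow> real \<Rightarrow> 'w \<Rightarrow> real" where
  "kde_ratio M K b X c n x \<omega> =
     (if kde K b X n x \<omega> = 0 then c
      else (kde K b X n x \<omega> - (LINT \<omega>'|M. kde K b X n x \<omega>')) /
           sqrt (kde K b X n x \<omega> * (LINT u|lborel. (K u)\<^sup>2)))"

text \<open>The density formula is meaningful only for a positive definite covariance matrix.\<close>

definition multivariate_normal ::
  "real ^ 'm \<Rightarrow> real ^ 'm ^ 'm \<Rightarrow> (real ^ 'm) measure" where
  "multivariate_normal \<mu> \<Sigma> = density lborel
     (\<lambda>z. ennreal (exp (- ((z - \<mu>) \<bullet> (matrix_inv \<Sigma> *v (z - \<mu>))) / 2) /
                   sqrt ((2 * pi) ^ CARD('m) * det \<Sigma>)))"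

text \<open>\<open>HOL-Probability\<close>'s \<open>weak_conv\<close> compares distribution functions and so covers only
  laws on the real line.  Measurability is required because the integral of a non-measurable
  function is 0 by convention.\<close>

definition converges_in_distribution ::
  "'w measure \<Rightarrow> (nat \<Rightarrow> 'w \<Rightarrow> 'a::topological_space) \<Rightarrow> 'a measure \<Rightarrow> bool" where
  "converges_in_distribution M T N \<longleftrightarrow>
     (\<forall>n. T n \<in> borel_measurable M) \<and>
     (\<forall>g::'a \<Rightarrow> real. continuous_on UNIV g \<and> bounded (range g) \<longrightarrow>
        (\<lambda>n. LINT \<omega>|M. g (T n \<omega>)) \<longlonglongrightarrow> (LINT z|N. g z))"

end

theory Submission
  imports Defs "HOL-Real_Asymp.Real_Asymp"
begin

text \<open>Reversibility makes the transition operator a self-adjoint contraction, so every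
  autocovariance of lag at least 2 is bounded by the one of lag 2, which is \<open>O(b\<^sub>n\<^sup>2)\<close> by local
  boundedness of the joint density of \<open>(X\<^sub>0, X\<^sub>2)\<close>; lag 1 is handled by Cauchy--Schwarz and costs only
  \<open>O(b\<^sub>n powr (3/2))\<close>.  Using this bound for lags up to \<open>\<epsilon> / b\<^sub>n\<close> and the mixing bound beyond, the
  summed autocovariances are \<open>o(b\<^sub>n)\<close>, hence the variance of a sum is asymptotically that of independent
  variables.  Bernstein's blocks, whose characteristic functions factorise up to mixing coefficients by
  the Markov property, then give the central limit theorem for every linear combination of the
  centred estimators.  Finally the law of large numbers for the estimator itself replaces
  the deterministic normalisation \<open>f(x\<^sub>j)\<close> by the random one.\<close>

section \<open>Conditional expectations and the transition operator\<close>

text \<open>Mixing alone cannot make the summed autocovariances o(b): its bound for a single lag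
  does not shrink with the bandwidth \<open>b\<close>. The weight k in the summability of k *
  alpha_k supplies the missing factor, because beyond lag 1/b it leaves a tail that is o(1) times b.
  The same summability, with alpha monotone up to a factor 4, gives alpha_m = O(m^-2), which is what
  the blocks consume. A block length p and a gap d must satisfy d << p, n / (p d^2) -> 0 and p <<
  sqrt (n b); since n b^4 >= 1 gives sqrt (n b) >= n^(3/8), exponents close to 1/3 are possible. A
  further obstacle is that \<open>alpha_mixing\<close> compares two single coordinates, whereas
  blocks involve many: projecting each side onto its coordinate nearest to the gap reduces the
  latter to the former. For the passage from characteristic functions to weak convergence in several
  dimensions, bounded second moments take the place of tightness: a test function is wrapped around
  a large torus, where trigonometric polynomials approximate it uniformly, and the wrapping error at
  z is at most a multiple of |z|^2 / L^2.\<close>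

lemma doob_dynkin_real:
  fixes Z :: "'a \<Rightarrow> real"
  assumes Z: "Z \<in> borel_measurable (vimage_algebra \<Omega> Y N)" and Y: "Y \<in> \<Omega> \<rightarrow> space N"
  obtains h where "h \<in> borel_measurable N" "\<And>w. w \<in> \<Omega> \<Longrightarrow> Z w = h (Y w)"
proof -
  have "\<exists>B\<in>sets N. {w\<in>\<Omega>. of_rat r < Z w} = Y -` B \<inter> \<Omega>" for r :: rat
  proof -
    have "{w\<in>space (vimage_algebra \<Omega> Y N). of_rat r < Z w} \<in> sets (vimage_algebra \<Omega> Y N)"
      using Z by measurable
    then show ?thesis
      unfolding sets_vimage_algebra2[OF Y] by auto
  qed
  then obtain B where B [measurable]: "\<And>r. B r \<in> sets N"
    and B_eq: "\<And>r. {w\<in>\<Omega>. of_rat r < Z w} = Y -` B r \<inter> \<Omega>"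
    by metis
  \<comment> \<open>On the range of \<open>Y\<close> the supremum runs over the rationals below
    \<open>Z w\<close> and so recovers \<open>Z w\<close>. Elsewhere it may be infinite, hence the
    detour through \<open>ereal\<close>.\<close>
  define h where "h y = (SUP r::rat. if y \<in> B r then ereal (of_rat r) else -\<infinity>)" for y
  have [measurable]: "h \<in> borel_measurable N"
    unfolding h_def by measurable
  have "h (Y w) = ereal (Z w)" if w: "w \<in> \<Omega>" for w
  proof -
    have iff: "Y w \<in> B r \<longleftrightarrow> of_rat r < Z w" for r
      using B_eq[of r] w by auto
    show ?thesis
    proof (rule antisym)
      show "h (Y w) \<le> ereal (Z w)"
        unfolding h_def iff by (rule SUP_least) auto
      show "ereal (Z w) \<le> h (Y w)"
      proof (rule dense_le)
        fix z :: ereal assume z: "z < ereal (Z w)"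
        obtain r where r: "z < ereal r" "ereal r < ereal (Z w)"
          using ereal_dense2[OF z] by auto
        obtain s where s: "r < of_rat s" "of_rat s < Z w"
          using of_rat_dense r(2) by auto
        have "z \<le> ereal (of_rat s)"
          using r s by (meson ereal_less_eq(3) less_imp_le order_trans)
        also have "\<dots> \<le> h (Y w)"
          unfolding h_def iff by (rule SUP_upper2[of s]) (use s in auto)
        finally show "z \<le> h (Y w)" .
      qed
    qed
  qed
  then have "Z w = real_of_ereal (h (Y w))" if "w \<in> \<Omega>" for w
    using that by (metis real_of_ereal.simps(1))
  then show thesis
    by (intro that[of "\<lambda>y. real_of_ereal (h y)"]) auto
qed

context prob_space
begin

lemma integrable_bounded:
  fixes f :: "'a \<Rightarrow> 'b::{banach, second_countable_topology}"
  assumes "f \<in> borel_measurable M" "\<And>w. norm (f w) \<le> C"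
  shows "integrable M f"
  by (rule integrable_const_bound[of _ C]) (use assms in auto)

lemma integrable_bounded_mult:
  fixes f g :: "'a \<Rightarrow> real"
  assumes [measurable]: "f \<in> borel_measurable M" "g \<in> borel_measurable M"
    and "\<And>w. \<bar>f w\<bar> \<le> C" "\<And>w. \<bar>g w\<bar> \<le> D"
  shows "integrable M (\<lambda>w. f w * g w)"
proof (rule integrable_bounded[of _ "C * D"])
  fix w
  have "0 \<le> C" by (rule order_trans[OF abs_ge_zero assms(3)])
  then show "norm (f w * g w) \<le> C * D"
    unfolding real_norm_def abs_mult by (intro mult_mono assms abs_ge_zero)
qed auto

lemma subalgebra_vimage:
  assumes "Y \<in> measurable M N"
  shows "subalgebra M (vimage_algebra (space M) Y N)"
  unfolding subalgebra_def
  using assms measurable_space[OF assms] by (auto simp: sets_vimage_algebra2 measurable_sets)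

lemma sigma_finite_subalgebra_of: "subalgebra M F \<Longrightarrow> sigma_finite_subalgebra M F"
  by (intro finite_measure_subalgebra_is_sigma_finite finite_measure_subalgebra.intro
      finite_measure_subalgebra_axioms.intro finite_measure_axioms)

lemma abs_real_cond_exp_le:
  assumes F: "subalgebra M F" and U[measurable]: "U \<in> borel_measurable M" and bd: "\<And>w. \<bar>U w\<bar> \<le> C"
  shows "AE w in M. \<bar>real_cond_exp M F U w\<bar> \<le> C"
proof -
  interpret F: sigma_finite_subalgebra M F
    by (rule sigma_finite_subalgebra_of[OF F])
  have i: "integrable M U" by (rule integrable_bounded[of _ C]) (use bd in auto)
  have "AE w in M. real_cond_exp M F U w \<le> C"
    by (rule F.real_cond_exp_le_c[OF i]) (use bd in \<open>auto intro: abs_le_D1\<close>)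
  moreover have "AE w in M. real_cond_exp M F U w \<ge> - C"
    by (rule F.real_cond_exp_ge_c[OF i]) (use bd in \<open>auto simp: abs_le_iff minus_le_iff\<close>)
  ultimately show ?thesis by eventually_elim auto
qed

text \<open>The last clause is the working form: later arguments test against bounded functions of
  \<open>Y\<close>. The bound on \<open>u\<close> holds everywhere and not just almost everywhere,
  so \<open>u\<close> can itself serve as a bounded test function.\<close>

lemma cond_exp_given:
  fixes Y :: "'a \<Rightarrow> real"
  assumes Y[measurable]: "Y \<in> borel_measurable M"
    and U[measurable]: "U \<in> borel_measurable M" and bd: "\<And>w. \<bar>U w\<bar> \<le> C"
  obtains u where "u \<in> borel_measurable borel" "\<And>x. \<bar>u x\<bar> \<le> C"
    "AE w in M. real_cond_exp M (vimage_algebra (space M) Y borel) U w = u (Y w)"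
    "\<And>v D. \<lbrakk>v \<in> borel_measurable borel; \<And>x. \<bar>v x\<bar> \<le> D\<rbrakk> \<Longrightarrow>
      expectation (\<lambda>w. U w * v (Y w)) = expectation (\<lambda>w. u (Y w) * v (Y w))"
proof -
  let ?G = "vimage_algebra (space M) Y borel"
  have G: "subalgebra M ?G" by (rule subalgebra_vimage) fact
  interpret G: sigma_finite_subalgebra M ?G
    by (rule sigma_finite_subalgebra_of[OF G])
  have C0: "0 \<le> C" using bd[of undefined] by linarith
  obtain h where h[measurable]: "h \<in> borel_measurable borel"
    and h_eq: "\<And>w. w \<in> space M \<Longrightarrow> real_cond_exp M ?G U w = h (Y w)"
    by (rule doob_dynkin_real[of "real_cond_exp M ?G U" "space M" Y borel]) auto
  \<comment> \<open>Clipping at \<open>C\<close> alters the Doob-Dynkin function only on a null set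
    for the law of \<open>Y\<close>, since the conditional expectation obeys the bound almost
    everywhere.\<close>
  define u where "u x = max (- C) (min C (h x))" for x
  have u[measurable]: "u \<in> borel_measurable borel" unfolding u_def by measurable
  have ubd: "\<bar>u x\<bar> \<le> C" for x unfolding u_def using C0 by auto
  have ae: "AE w in M. real_cond_exp M ?G U w = u (Y w)"
    using abs_real_cond_exp_le[OF G U bd] AE_space
    by eventually_elim (auto simp: u_def h_eq max_def min_def abs_le_iff)
  show thesis
  proof (rule that[OF u ubd ae])
    fix v :: "real \<Rightarrow> real" and D assume v[measurable]: "v \<in> borel_measurable borel" and D: "\<And>x. \<bar>v x\<bar> \<le> D"
    have i: "integrable M (\<lambda>w. v (Y w) * U w)"
      by (rule integrable_bounded_mult[OF _ _ D bd]) auto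
    have vY: "(\<lambda>w. v (Y w)) \<in> borel_measurable ?G"
      by (rule measurable_compose[OF _ v]) (auto intro: measurable_vimage_algebra1)
    have "expectation (\<lambda>w. v (Y w) * U w) = expectation (\<lambda>w. v (Y w) * real_cond_exp M ?G U w)"
      by (rule G.real_cond_exp_intg(2)[OF i vY U, symmetric])
    also have "\<dots> = expectation (\<lambda>w. v (Y w) * u (Y w))"
      by (rule integral_cong_AE) (use ae in auto)
    finally show "expectation (\<lambda>w. U w * v (Y w)) = expectation (\<lambda>w. u (Y w) * v (Y w))"
      by (simp add: mult.commute)
  qed
qed

text \<open>The hypothesis on indicators says that E[U | Y] = 0, and this pairs to 0 with every
  bounded function of \<open>Y\<close>. It carries the Markov property, which is stated for
  indicators, over to bounded functions without approximation by simple functions.\<close>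

lemma expectation_eq_0_of_indicators:
  fixes Y :: "'a \<Rightarrow> real" and U :: "'a \<Rightarrow> real" and v :: "real \<Rightarrow> real"
  assumes Y[measurable]: "Y \<in> borel_measurable M"
    and U[measurable]: "U \<in> borel_measurable M" and bd: "\<And>w. \<bar>U w\<bar> \<le> C"
    and ind: "\<And>A. A \<in> sets borel \<Longrightarrow> expectation (\<lambda>w. U w * indicator A (Y w)) = 0"
    and v[measurable]: "v \<in> borel_measurable borel" and vb: "\<And>x. \<bar>v x\<bar> \<le> D"
  shows "expectation (\<lambda>w. U w * v (Y w)) = 0"
proof -
  let ?G = "vimage_algebra (space M) Y borel"
  have G: "subalgebra M ?G" by (rule subalgebra_vimage) fact
  interpret G: sigma_finite_subalgebra M ?G
    by (rule sigma_finite_subalgebra_of[OF G])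
  have C0: "0 \<le> C" using bd[of undefined] by linarith
  have iU: "integrable M U" by (rule integrable_bounded[of _ C]) (use bd in auto)
  have ae: "AE w in M. real_cond_exp M ?G U w = 0"
  proof (rule G.real_cond_exp_charact[OF _ iU])
    fix S assume "S \<in> sets ?G"
    then obtain A where A: "A \<in> sets borel" "S = Y -` A \<inter> space M"
      by (auto simp: sets_vimage_algebra2)
    have "(\<integral>w\<in>S. U w \<partial>M) = expectation (\<lambda>w. U w * indicator A (Y w))"
      unfolding set_lebesgue_integral_def
      by (rule Bochner_Integration.integral_cong) (auto simp: A indicator_def)
    then show "(\<integral>w\<in>S. U w \<partial>M) = (\<integral>w\<in>S. 0 \<partial>M)"
      using ind[OF A(1)] by simp
  qed auto
  have i: "integrable M (\<lambda>w. v (Y w) * U w)"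
    by (rule integrable_bounded_mult[OF _ _ vb bd]) auto
  have vY: "(\<lambda>w. v (Y w)) \<in> borel_measurable ?G"
    by (rule measurable_compose[OF _ v]) (auto intro: measurable_vimage_algebra1)
  have "expectation (\<lambda>w. v (Y w) * U w) = expectation (\<lambda>w. v (Y w) * real_cond_exp M ?G U w)"
    by (rule G.real_cond_exp_intg(2)[OF i vY U, symmetric])
  also have "\<dots> = expectation (\<lambda>w. 0)"
    by (rule integral_cong_AE) (use ae in auto)
  finally have "expectation (\<lambda>w. v (Y w) * U w) = 0" by simp
  then show ?thesis by (simp add: mult.commute)
qed

end

section \<open>The transition operator of a stationary reversible Markov chain\<close>

locale reversible_chain = prob_space M for M :: "'w measure" +
  fixes X :: "int \<Rightarrow> 'w \<Rightarrow> real"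
  assumes markov: "markov_chain M X"
    and stationary: "strictly_stationary M X"
    and reversible: "reversible M X"
begin

lemma measurable_X [measurable]: "X k \<in> borel_measurable M"
  using stationary by (auto simp: strictly_stationary_def)

lemma distr_pair:
  "distr M (borel \<Otimes>\<^sub>M borel) (\<lambda>w. (X (i + h) w, X (j + h) w)) =
   distr M (borel \<Otimes>\<^sub>M borel) (\<lambda>w. (X i w, X j w))"
proof -
  have st: "distr M (\<Pi>\<^sub>M i\<in>{i,j}. borel) (\<lambda>\<omega>. \<lambda>k\<in>{i,j}. X (k + h) \<omega>) =
        distr M (\<Pi>\<^sub>M i\<in>{i,j}. borel) (\<lambda>\<omega>. \<lambda>k\<in>{i,j}. X k \<omega>)"
    using stationary by (auto simp: strictly_stationary_def)
  have [measurable]: "(\<lambda>\<omega>. \<lambda>k\<in>{i,j}. X (k + h) \<omega>) \<in> measurable M (\<Pi>\<^sub>M i\<in>{i,j}. borel)" for h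
    by (rule measurable_restrict) auto
  have [measurable]: "(\<lambda>\<omega>. \<lambda>k\<in>{i,j}. X k \<omega>) \<in> measurable M (\<Pi>\<^sub>M i\<in>{i,j}. borel)"
    by (rule measurable_restrict) auto
  have [measurable]: "(\<lambda>f::int\<Rightarrow>real. (f i, f j)) \<in> measurable (\<Pi>\<^sub>M i\<in>{i,j}. borel) (borel \<Otimes>\<^sub>M borel)"
    by (intro measurable_Pair measurable_component_singleton) auto
  have "distr (distr M (\<Pi>\<^sub>M i\<in>{i,j}. borel) (\<lambda>\<omega>. \<lambda>k\<in>{i,j}. X (k + h) \<omega>))
      (borel \<Otimes>\<^sub>M borel) (\<lambda>f::int\<Rightarrow>real. (f i, f j)) =
    distr (distr M (\<Pi>\<^sub>M i\<in>{i,j}. borel) (\<lambda>\<omega>. \<lambda>k\<in>{i,j}. X k \<omega>))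
      (borel \<Otimes>\<^sub>M borel) (\<lambda>f::int\<Rightarrow>real. (f i, f j))"
    by (simp only: st)
  then show ?thesis
    by (subst (asm) (1 2) distr_distr) (simp_all add: comp_def)
qed

lemma expectation_pair_shift:
  assumes [measurable]: "F \<in> borel_measurable (borel \<Otimes>\<^sub>M borel)"
  shows "expectation (\<lambda>w. F (X (i + h) w, X (j + h) w) :: real) = expectation (\<lambda>w. F (X i w, X j w))"
proof -
  have "(\<integral>z. F z \<partial>distr M (borel \<Otimes>\<^sub>M borel) (\<lambda>w. (X (i + h) w, X (j + h) w))) =
    (\<integral>z. F z \<partial>distr M (borel \<Otimes>\<^sub>M borel) (\<lambda>w. (X i w, X j w)))"
    by (simp only: distr_pair)
  then show ?thesis by (simp add: integral_distr)
qed

lemma expectation_prod_shift: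
  assumes [measurable]: "u \<in> borel_measurable borel" "v \<in> borel_measurable borel"
  shows "expectation (\<lambda>w. u (X (i + h) w) * v (X (j + h) w) :: real) = expectation (\<lambda>w. u (X i w) * v (X j w))"
  using expectation_pair_shift[of "\<lambda>(x, y). u x * v y" i h j] by simp

lemma expectation_shift:
  assumes [measurable]: "u \<in> borel_measurable borel"
  shows "expectation (\<lambda>w. u (X k w) :: real) = expectation (\<lambda>w. u (X 0 w))"
  using expectation_prod_shift[of u "\<lambda>_. 1" 0 k 0] by simp

lemma expectation_reverse:
  assumes [measurable]: "u \<in> borel_measurable borel" "v \<in> borel_measurable borel"
  shows "expectation (\<lambda>w. u (X 0 w) * v (X 1 w) :: real) = expectation (\<lambda>w. v (X 0 w) * u (X 1 w))"
proof -
  have "(\<integral>z. u (fst z) * v (snd z) \<partial>distr M (borel \<Otimes>\<^sub>M borel) (\<lambda>w. (X 0 w, X 1 w))) =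
    (\<integral>z. u (fst z) * v (snd z) \<partial>distr M (borel \<Otimes>\<^sub>M borel) (\<lambda>w. (X 1 w, X 0 w)))"
    using reversible by (simp only: reversible_def)
  then show ?thesis by (simp add: integral_distr mult.commute)
qed

text \<open>A version of x -> E[v(X_1) | X_0 = x], pinned down by its pairing with bounded functions
  of \<open>X 0\<close>. The clause on bounds makes it obey every uniform bound of \<open>v\<close>
  pointwise, so that its powers can be iterated on functions. The choice is meaningful for bounded
  Borel \<open>v\<close>.\<close>

definition trans_op :: "(real \<Rightarrow> real) \<Rightarrow> real \<Rightarrow> real" where
  "trans_op v = (SOME h. h \<in> borel_measurable borel \<and> (\<forall>C. (\<forall>x. \<bar>v x\<bar> \<le> C) \<longrightarrow> (\<forall>x. \<bar>h x\<bar> \<le> C)) \<and>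
     (\<forall>u D. u \<in> borel_measurable borel \<longrightarrow> (\<forall>x. \<bar>u x\<bar> \<le> D) \<longrightarrow>
        expectation (\<lambda>w. u (X 0 w) * v (X 1 w)) = expectation (\<lambda>w. u (X 0 w) * h (X 0 w))))"

definition bdd_borel :: "(real \<Rightarrow> real) \<Rightarrow> bool" where
  "bdd_borel v \<longleftrightarrow> v \<in> borel_measurable borel \<and> (\<exists>C. \<forall>x. \<bar>v x\<bar> \<le> C)"

lemma bdd_borelI: "v \<in> borel_measurable borel \<Longrightarrow> (\<And>x. \<bar>v x\<bar> \<le> C) \<Longrightarrow> bdd_borel v"
  by (auto simp: bdd_borel_def)

lemma bdd_borel_measurable: "bdd_borel v \<Longrightarrow> v \<in> borel_measurable borel"
  by (auto simp: bdd_borel_def)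

lemma trans_op_spec:
  assumes v: "bdd_borel v"
  shows "trans_op v \<in> borel_measurable borel \<and> (\<forall>C. (\<forall>x. \<bar>v x\<bar> \<le> C) \<longrightarrow> (\<forall>x. \<bar>trans_op v x\<bar> \<le> C)) \<and>
     (\<forall>u D. u \<in> borel_measurable borel \<longrightarrow> (\<forall>x. \<bar>u x\<bar> \<le> D) \<longrightarrow>
        expectation (\<lambda>w. u (X 0 w) * v (X 1 w)) = expectation (\<lambda>w. u (X 0 w) * trans_op v (X 0 w)))"
proof -
  have [measurable]: "v \<in> borel_measurable borel" using v by (rule bdd_borel_measurable)
  \<comment> \<open>The least bound of |v|: a version clipped at \<open>S\<close> obeys all
    admissible \<open>C\<close> at once.\<close>
  define S where "S = (SUP x. \<bar>v x\<bar>)"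
  have bdd: "bdd_above (range (\<lambda>x. \<bar>v x\<bar>))"
    using v by (auto simp: bdd_borel_def intro: bdd_aboveI2)
  have S: "\<bar>v x\<bar> \<le> S" for x unfolding S_def by (rule cSUP_upper[OF _ bdd]) simp
  obtain u where u: "u \<in> borel_measurable borel" "\<And>x. \<bar>u x\<bar> \<le> S"
    "\<And>g D. \<lbrakk>g \<in> borel_measurable borel; \<And>x. \<bar>g x\<bar> \<le> D\<rbrakk> \<Longrightarrow>
      expectation (\<lambda>w. v (X 1 w) * g (X 0 w)) = expectation (\<lambda>w. u (X 0 w) * g (X 0 w))"
    by (rule cond_exp_given[of "X 0" "\<lambda>w. v (X 1 w)" S]) (use S in auto)
  have u3: "expectation (\<lambda>w. g (X 0 w) * v (X 1 w)) = expectation (\<lambda>w. g (X 0 w) * u (X 0 w))"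
    if "g \<in> borel_measurable borel" "\<forall>x. \<bar>g x\<bar> \<le> D" for g D
    using u(3)[of g D] that by (simp add: mult.commute)
  have "S \<le> C" if "\<forall>x. \<bar>v x\<bar> \<le> C" for C
    unfolding S_def using that by (intro cSUP_least) auto
  then have "\<exists>h. h \<in> borel_measurable borel \<and> (\<forall>C. (\<forall>x. \<bar>v x\<bar> \<le> C) \<longrightarrow> (\<forall>x. \<bar>h x\<bar> \<le> C)) \<and>
     (\<forall>u D. u \<in> borel_measurable borel \<longrightarrow> (\<forall>x. \<bar>u x\<bar> \<le> D) \<longrightarrow>
        expectation (\<lambda>w. u (X 0 w) * v (X 1 w)) = expectation (\<lambda>w. u (X 0 w) * h (X 0 w)))"
    using u(1,2) u3 by (intro exI[of _ u]) (auto intro: order_trans)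
  from someI_ex[OF this] show ?thesis
    unfolding trans_op_def .
qed

lemma trans_op_measurable: "bdd_borel v \<Longrightarrow> trans_op v \<in> borel_measurable borel"
  using trans_op_spec by blast

lemma trans_op_bound: "bdd_borel v \<Longrightarrow> (\<And>x. \<bar>v x\<bar> \<le> C) \<Longrightarrow> \<bar>trans_op v x\<bar> \<le> C"
  using trans_op_spec by blast

lemma bdd_borel_trans_op: "bdd_borel v \<Longrightarrow> bdd_borel (trans_op v)"
  by (metis bdd_borel_def trans_op_measurable trans_op_bound)

lemma bdd_borel_trans_op_pow: "bdd_borel v \<Longrightarrow> bdd_borel ((trans_op ^^ k) v)"
  by (induction k) (auto intro: bdd_borel_trans_op)

lemma trans_op_pow_bound: "bdd_borel v \<Longrightarrow> (\<And>x. \<bar>v x\<bar> \<le> C) \<Longrightarrow> \<bar>(trans_op ^^ k) v x\<bar> \<le> C"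
  by (induction k arbitrary: x) (auto intro: trans_op_bound bdd_borel_trans_op_pow)

lemma expectation_trans_op:
  assumes "bdd_borel u" "bdd_borel v"
  shows "expectation (\<lambda>w. u (X k w) * v (X (k + 1) w)) = expectation (\<lambda>w. u (X k w) * trans_op v (X k w))"
proof -
  have [measurable]: "u \<in> borel_measurable borel" "v \<in> borel_measurable borel" "trans_op v \<in> borel_measurable borel"
    using assms by (auto intro: bdd_borel_measurable trans_op_measurable)
  have "expectation (\<lambda>w. u (X (0 + k) w) * v (X (1 + k) w)) = expectation (\<lambda>w. u (X 0 w) * v (X 1 w))"
    by (rule expectation_prod_shift) auto
  also have "\<dots> = expectation (\<lambda>w. u (X 0 w) * trans_op v (X 0 w))"
    using trans_op_spec[OF assms(2)] assms(1) by (auto simp: bdd_borel_def)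
  also have "\<dots> = expectation (\<lambda>w. u (X (0 + k) w) * trans_op v (X (0 + k) w))"
    by (rule expectation_prod_shift[symmetric]) auto
  finally show ?thesis by (simp add: add.commute)
qed

lemma subalgebra_past: "subalgebra M (past_algebra M X k)"
  unfolding past_algebra_def by (rule subalgebra_vimage) (auto intro!: measurable_restrict)

lemma X_measurable_past: "i \<le> k \<Longrightarrow> X i \<in> borel_measurable (past_algebra M X k)"
proof -
  assume i: "i \<le> k"
  have 1: "(\<lambda>\<omega>. \<lambda>i\<in>{..k}. X i \<omega>) \<in> measurable (past_algebra M X k) (\<Pi>\<^sub>M i\<in>{..k}. borel)"
    unfolding past_algebra_def
    by (rule measurable_vimage_algebra1) (auto simp: space_PiM)
  have 2: "(\<lambda>f. f i) \<in> measurable (\<Pi>\<^sub>M i\<in>{..k}. borel) borel"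
    by (rule measurable_component_singleton) (use i in auto)
  show ?thesis using measurable_compose[OF 1 2] i by simp
qed

lemma past_mono:
  assumes "k \<le> l"
  shows "sets (past_algebra M X k) \<subseteq> sets (past_algebra M X l)"
proof -
  have m: "(\<lambda>\<omega>. \<lambda>i\<in>{..k}. X i \<omega>) \<in> measurable (past_algebra M X l) (\<Pi>\<^sub>M i\<in>{..k}. borel)"
    by (rule measurable_restrict) (use assms in \<open>auto intro: X_measurable_past\<close>)
  show ?thesis
  proof
    fix S assume "S \<in> sets (past_algebra M X k)"
    then obtain B where B: "B \<in> sets (\<Pi>\<^sub>M i\<in>{..k}. (borel::real measure))" "S = (\<lambda>\<omega>. \<lambda>i\<in>{..k}. X i \<omega>) -` B \<inter> space M"
      unfolding past_algebra_def by (subst (asm) sets_vimage_algebra2) (auto simp: space_PiM)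
    with measurable_sets[OF m B(1)] show "S \<in> sets (past_algebra M X l)"
      by (simp add: past_algebra_def)
  qed
qed

lemma measurable_past_mono:
  "U \<in> borel_measurable (past_algebra M X k) \<Longrightarrow> k \<le> l \<Longrightarrow> U \<in> borel_measurable (past_algebra M X l)"
  using past_mono[of k l] by (auto simp: measurable_def past_algebra_def)

text \<open>\<open>U\<close> is projected onto \<open>X k\<close>. By the Markov hypothesis the
  difference from the projection is orthogonal to indicators of \<open>X (k + 1)\<close>, hence to
  all its bounded functions. Then only the pair of \<open>X k\<close> and \<open>X (k + 1)\<close>
  is involved, where \<open>expectation_trans_op\<close> applies, and the projection is finally
  undone.\<close>

lemma markov_property:
  assumes U: "U \<in> borel_measurable (past_algebra M X k)" and bd: "\<And>w. \<bar>U w\<bar> \<le> C" and v: "bdd_borel v"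
  shows "expectation (\<lambda>w. U w * v (X (k + 1) w)) = expectation (\<lambda>w. U w * trans_op v (X k w))"
proof -
  let ?F = "past_algebra M X k" and ?G = "vimage_algebra (space M) (X k) borel"
  have G: "subalgebra M ?G" by (rule subalgebra_vimage) auto
  interpret F: sigma_finite_subalgebra M ?F
    by (rule sigma_finite_subalgebra_of[OF subalgebra_past])
  interpret G: sigma_finite_subalgebra M ?G
    by (rule sigma_finite_subalgebra_of[OF G])
  have UM[measurable]: "U \<in> borel_measurable M"
    by (rule measurable_from_subalg[OF subalgebra_past U])
  have C0: "0 \<le> C" using bd[of undefined] by linarith
  have [measurable]: "v \<in> borel_measurable borel" "trans_op v \<in> borel_measurable borel"
    using v by (auto intro: bdd_borel_measurable trans_op_measurable)
  obtain D where D: "\<And>x. \<bar>v x\<bar> \<le> D" using v by (auto simp: bdd_borel_def)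
  obtain u where u[measurable]: "u \<in> borel_measurable borel" and ub: "\<And>x. \<bar>u x\<bar> \<le> C"
    and u_ae: "AE w in M. real_cond_exp M ?G U w = u (X k w)"
    and u_eq: "\<And>v D. \<lbrakk>v \<in> borel_measurable borel; \<And>x. \<bar>v x\<bar> \<le> D\<rbrakk> \<Longrightarrow>
      expectation (\<lambda>w. U w * v (X k w)) = expectation (\<lambda>w. u (X k w) * v (X k w))"
    by (rule cond_exp_given[OF measurable_X UM bd]) blast
  have bd2: "\<bar>U w - u (X k w)\<bar> \<le> 2 * C" for w
    using bd[of w] ub[of "X k w"] by linarith
  have "expectation (\<lambda>w. (U w - u (X k w)) * v (X (k + 1) w)) = 0"
  proof (rule expectation_eq_0_of_indicators[OF measurable_X _ bd2 _ _ D])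
    fix A :: "real set" assume A[measurable]: "A \<in> sets borel"
    let ?I = "\<lambda>w. indicator A (X (k + 1) w) :: real"
    have I: "\<bar>?I w\<bar> \<le> 1" for w by (auto simp: indicator_def)
    have ae: "AE w in M. real_cond_exp M ?F ?I w = real_cond_exp M ?G ?I w"
      using markov A unfolding markov_chain_def by blast
    have aeb: "AE w in M. \<bar>real_cond_exp M ?G ?I w\<bar> \<le> 1"
      by (rule abs_real_cond_exp_le[OF G _ I]) auto
    have i1: "integrable M (\<lambda>w. U w * ?I w)"
      by (rule integrable_bounded_mult[OF _ _ bd I]) auto
    have i2: "integrable M (\<lambda>w. u (X k w) * ?I w)"
      by (rule integrable_bounded_mult[OF _ _ ub I]) auto
    have i3: "integrable M (\<lambda>w. real_cond_exp M ?G ?I w * U w)"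
    proof (rule integrable_const_bound[of _ "1 * C"])
      show "AE w in M. norm (real_cond_exp M ?G ?I w * U w) \<le> 1 * C"
        using aeb by eventually_elim (unfold real_norm_def abs_mult, intro mult_mono bd abs_ge_zero, auto)
    qed auto
    have uX: "(\<lambda>w. u (X k w)) \<in> borel_measurable ?G"
      by (rule measurable_compose[OF _ u]) (auto intro: measurable_vimage_algebra1)
    \<comment> \<open>\<open>U\<close> is measurable for the past, so the indicator may be
      conditioned on the past, which the Markov hypothesis turns into conditioning on
      \<open>X k\<close>. That conditioning is then moved over to \<open>U\<close>, being
      self-adjoint, and removed from the indicator.\<close>
    have "expectation (\<lambda>w. U w * ?I w) = expectation (\<lambda>w. U w * real_cond_exp M ?F ?I w)"
      by (rule F.real_cond_exp_intg(2)[OF i1 U, symmetric]) auto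
    also have "\<dots> = expectation (\<lambda>w. real_cond_exp M ?G ?I w * U w)"
      by (rule integral_cong_AE) (use ae in auto)
    also have "\<dots> = expectation (\<lambda>w. real_cond_exp M ?G ?I w * real_cond_exp M ?G U w)"
      by (rule G.real_cond_exp_intg(2)[OF i3, symmetric]) auto
    also have "\<dots> = expectation (\<lambda>w. u (X k w) * real_cond_exp M ?G ?I w)"
      by (rule integral_cong_AE) (use u_ae in auto)
    also have "\<dots> = expectation (\<lambda>w. u (X k w) * ?I w)"
      by (rule G.real_cond_exp_intg(2)[OF i2 uX]) auto
    finally show "expectation (\<lambda>w. (U w - u (X k w)) * ?I w) = 0"
      using i1 i2 by (simp add: left_diff_distrib)
  qed auto
  moreover have "integrable M (\<lambda>w. U w * v (X (k + 1) w))"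
    by (rule integrable_bounded_mult[OF _ _ bd D]) auto
  moreover have "integrable M (\<lambda>w. u (X k w) * v (X (k + 1) w))"
    by (rule integrable_bounded_mult[OF _ _ ub D]) auto
  ultimately have "expectation (\<lambda>w. U w * v (X (k + 1) w)) = expectation (\<lambda>w. u (X k w) * v (X (k + 1) w))"
    by (simp add: left_diff_distrib)
  also have "\<dots> = expectation (\<lambda>w. u (X k w) * trans_op v (X k w))"
    by (rule expectation_trans_op[OF bdd_borelI[OF u ub] v])
  also have "\<dots> = expectation (\<lambda>w. U w * trans_op v (X k w))"
    by (rule u_eq[symmetric]) (auto intro: trans_op_bound v D)
  finally show ?thesis .
qed

end

section \<open>Autocovariances and mixing coefficients\<close>

context reversible_chain
begin

lemma markov_property_pow:
  assumes U: "U \<in> borel_measurable (past_algebra M X k)" and bd: "\<And>w. \<bar>U w\<bar> \<le> C" and v: "bdd_borel v"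
  shows "expectation (\<lambda>w. U w * v (X (k + int n) w)) = expectation (\<lambda>w. U w * (trans_op ^^ n) v (X k w))"
  using v
proof (induction n arbitrary: v)
  case (Suc n)
  have "expectation (\<lambda>w. U w * v (X (k + int (Suc n)) w)) = expectation (\<lambda>w. U w * v (X ((k + int n) + 1) w))"
    by (simp add: algebra_simps)
  also have "\<dots> = expectation (\<lambda>w. U w * trans_op v (X (k + int n) w))"
    by (rule markov_property[OF measurable_past_mono[OF U] bd Suc.prems]) simp
  also have "\<dots> = expectation (\<lambda>w. U w * (trans_op ^^ n) (trans_op v) (X k w))"
    by (rule Suc.IH[OF bdd_borel_trans_op[OF Suc.prems]])
  finally show ?case by (simp add: funpow_swap1)
qed simp

lemma X_compose_past: "u \<in> borel_measurable borel \<Longrightarrow> i \<le> k \<Longrightarrow> (\<lambda>w. u (X i w)) \<in> borel_measurable (past_algebra M X k)"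
  using measurable_compose[OF X_measurable_past] by blast

lemma bdd_borel_X: "bdd_borel u \<Longrightarrow> (\<lambda>w. u (X i w)) \<in> borel_measurable M"
  using bdd_borel_measurable[of u] by measurable

lemma integrable_bdd_borel_mult:
  assumes "bdd_borel u" "bdd_borel v"
  shows "integrable M (\<lambda>w. u (X i w) * v (X j w))"
proof -
  obtain C D where "\<And>x. \<bar>u x\<bar> \<le> C" "\<And>x. \<bar>v x\<bar> \<le> D"
    using assms by (auto simp: bdd_borel_def)
  then show ?thesis
    by (intro integrable_bounded_mult[of _ _ C D]) (auto intro: bdd_borel_X assms)
qed

lemma integrable_bdd_borel: "bdd_borel u \<Longrightarrow> integrable M (\<lambda>w. u (X i w))"
  using integrable_bdd_borel_mult[of u "\<lambda>_. 1" i i] by (auto simp: bdd_borel_def)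

lemma expectation_trans_op_pow:
  assumes u: "bdd_borel u" and v: "bdd_borel v"
  shows "expectation (\<lambda>w. u (X i w) * v (X (i + int n) w)) = expectation (\<lambda>w. u (X 0 w) * (trans_op ^^ n) v (X 0 w))"
proof -
  have [measurable]: "u \<in> borel_measurable borel" "(trans_op ^^ n) v \<in> borel_measurable borel"
    using assms by (auto intro: bdd_borel_measurable bdd_borel_trans_op_pow)
  obtain C where C: "\<And>x. \<bar>u x\<bar> \<le> C" using u by (auto simp: bdd_borel_def)
  have "expectation (\<lambda>w. u (X i w) * v (X (i + int n) w)) = expectation (\<lambda>w. u (X i w) * (trans_op ^^ n) v (X i w))"
    by (rule markov_property_pow[OF X_compose_past C v]) auto
  also have "\<dots> = expectation (\<lambda>w. u (X 0 w) * (trans_op ^^ n) v (X 0 w))"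
    by (rule expectation_shift[of "\<lambda>x. u x * (trans_op ^^ n) v x"]) auto
  finally show ?thesis .
qed

text \<open>Both sides are pairings of \<open>u\<close> and \<open>v\<close> at times 0 and 1, read
  in the two directions of time. Reversibility enters the proof only here, through
  \<open>expectation_reverse\<close>.\<close>

lemma trans_op_self_adjoint:
  assumes "bdd_borel u" "bdd_borel v"
  shows "expectation (\<lambda>w. u (X 0 w) * trans_op v (X 0 w)) = expectation (\<lambda>w. trans_op u (X 0 w) * v (X 0 w))"
  using expectation_trans_op[OF assms, of 0] expectation_trans_op[OF assms(2,1), of 0]
    expectation_reverse[of u v] assms
  by (auto simp: mult.commute bdd_borel_def)

lemma trans_op_pow_self_adjoint:
  assumes "bdd_borel u" "bdd_borel v"
  shows "expectation (\<lambda>w. u (X 0 w) * (trans_op ^^ n) v (X 0 w)) = expectation (\<lambda>w. (trans_op ^^ n) u (X 0 w) * v (X 0 w))"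
  using assms
proof (induction n arbitrary: u)
  case (Suc n)
  then show ?case
    using trans_op_self_adjoint[of u "(trans_op ^^ n) v"] Suc.IH[of "trans_op u"]
    by (simp add: bdd_borel_trans_op bdd_borel_trans_op_pow funpow_swap1)
qed simp

text \<open>Write P for \<open>trans_op\<close> and expand 0 <= E (v(X_1) - P v(X_0))^2: the cross
  term is -2 E (P v(X_0))^2 by the defining property of P, and stationarity turns v(X_1) into
  v(X_0).\<close>

lemma trans_op_contraction:
  assumes v: "bdd_borel v"
  shows "expectation (\<lambda>w. (trans_op v (X 0 w))\<^sup>2) \<le> expectation (\<lambda>w. (v (X 0 w))\<^sup>2)"
proof -
  note Pv = bdd_borel_trans_op[OF v]
  have [measurable]: "v \<in> borel_measurable borel" using v by (rule bdd_borel_measurable)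
  have "0 \<le> expectation (\<lambda>w. (v (X 1 w) - trans_op v (X 0 w))\<^sup>2)" by simp
  also have "\<dots> = expectation (\<lambda>w. v (X 1 w) * v (X 1 w) - 2 * (trans_op v (X 0 w) * v (X 1 w))
      + trans_op v (X 0 w) * trans_op v (X 0 w))"
    by (rule Bochner_Integration.integral_cong) (auto simp: power2_eq_square algebra_simps)
  also have "\<dots> = expectation (\<lambda>w. v (X 1 w) * v (X 1 w)) - 2 * expectation (\<lambda>w. trans_op v (X 0 w) * v (X 1 w))
      + expectation (\<lambda>w. trans_op v (X 0 w) * trans_op v (X 0 w))"
    using integrable_bdd_borel_mult v Pv by simp
  also have "expectation (\<lambda>w. trans_op v (X 0 w) * v (X 1 w)) = expectation (\<lambda>w. trans_op v (X 0 w) * trans_op v (X 0 w))"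
    using expectation_trans_op[OF Pv v, of 0] by simp
  also have "expectation (\<lambda>w. v (X 1 w) * v (X 1 w)) = expectation (\<lambda>w. v (X 0 w) * v (X 0 w))"
    by (rule expectation_shift[of "\<lambda>x. v x * v x"]) auto
  finally show ?thesis by (simp add: power2_eq_square)
qed

lemma trans_op_pow_antimono:
  assumes v: "bdd_borel v" and "m \<le> n"
  shows "expectation (\<lambda>w. ((trans_op ^^ n) v (X 0 w))\<^sup>2) \<le> expectation (\<lambda>w. ((trans_op ^^ m) v (X 0 w))\<^sup>2)"
  using \<open>m \<le> n\<close>
  by (induction rule: dec_induct)
    (auto intro: order_trans[OF trans_op_contraction[OF bdd_borel_trans_op_pow[OF v]]])

text \<open>Self-adjointness lets the lag be shared freely between the two factors. Equal shares
  turn an even lag into a squared norm; lag 2 is the squared norm of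
  \<open>trans_op g\<close>.\<close>

lemma autocovariance_eq:
  assumes g: "bdd_borel g"
  shows "expectation (\<lambda>w. g (X 0 w) * g (X (int (m + n)) w)) =
    expectation (\<lambda>w. (trans_op ^^ m) g (X 0 w) * (trans_op ^^ n) g (X 0 w))"
  using expectation_trans_op_pow[OF g g, of 0 "m + n"]
    trans_op_pow_self_adjoint[OF g bdd_borel_trans_op_pow[OF g, of n], of m]
  by (simp add: funpow_add)

text \<open>Cauchy-Schwarz in the additive form 2 |u v| <= r u^2 + v^2 / r. The free weight
  \<open>r\<close> avoids square roots of expectations and is balanced later.\<close>

lemma abs_expectation_mult_le:
  assumes u: "bdd_borel u" and v: "bdd_borel v" and r: "0 < r"
  shows "\<bar>expectation (\<lambda>w. u (X 0 w) * v (X 0 w))\<bar> \<le>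
    (r * expectation (\<lambda>w. (u (X 0 w))\<^sup>2) + expectation (\<lambda>w. (v (X 0 w))\<^sup>2) / r) / 2"
proof -
  note i = integrable_bdd_borel_mult[OF u u, of 0 0] integrable_bdd_borel_mult[OF v v, of 0 0]
  have *: "\<bar>a * b\<bar> \<le> (r * (a * a) + (b * b) / r) / 2" for a b :: real
  proof -
    have "0 \<le> (r * \<bar>a\<bar> - \<bar>b\<bar>)\<^sup>2" by simp
    then have "2 * r * \<bar>a * b\<bar> \<le> r\<^sup>2 * (a * a) + b * b"
      by (simp add: power2_eq_square algebra_simps abs_mult)
    then show ?thesis using r by (simp add: field_simps power2_eq_square)
  qed
  have "\<bar>expectation (\<lambda>w. u (X 0 w) * v (X 0 w))\<bar> \<le> expectation (\<lambda>w. \<bar>u (X 0 w) * v (X 0 w)\<bar>)"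
    by (rule integral_abs_bound)
  also have "\<dots> \<le> expectation (\<lambda>w. (r * (u (X 0 w) * u (X 0 w)) + v (X 0 w) * v (X 0 w) / r) / 2)"
    using * i integrable_bdd_borel_mult[OF u v, of 0 0] by (intro integral_mono) auto
  also have "\<dots> = (r * expectation (\<lambda>w. (u (X 0 w))\<^sup>2) + expectation (\<lambda>w. (v (X 0 w))\<^sup>2) / r) / 2"
    using i by (simp add: power2_eq_square)
  finally show ?thesis .
qed

text \<open>Both halves of \<open>k\<close> contain at least one step of the operator, and the norms
  of its iterates decrease. So both factors have at most the norm of \<open>trans_op g\<close>,
  whose square is the lag 2 autocovariance.\<close>

lemma abs_autocovariance_le_lag2:
  assumes g: "bdd_borel g" and k: "2 \<le> k"
  shows "\<bar>expectation (\<lambda>w. g (X 0 w) * g (X (int k) w))\<bar> \<le> expectation (\<lambda>w. g (X 0 w) * g (X 2 w))"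
proof -
  define m n where "m = k div 2" and "n = k - m"
  have mn: "k = m + n" "1 \<le> m" "1 \<le> n" using k by (auto simp: m_def n_def)
  let ?N = "\<lambda>k. expectation (\<lambda>w. ((trans_op ^^ k) g (X 0 w))\<^sup>2)"
  have "\<bar>expectation (\<lambda>w. g (X 0 w) * g (X (int k) w))\<bar> \<le> (1 * ?N m + ?N n / 1) / 2"
    unfolding mn(1) autocovariance_eq[OF g]
    by (rule abs_expectation_mult_le) (auto intro: bdd_borel_trans_op_pow g)
  also have "\<dots> \<le> ?N 1"
    using trans_op_pow_antimono[OF g mn(2)] trans_op_pow_antimono[OF g mn(3)] by simp
  also have "\<dots> = expectation (\<lambda>w. g (X 0 w) * g (X 2 w))"
    using autocovariance_eq[OF g, of 1 1] by (simp add: power2_eq_square)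
  finally show ?thesis .
qed

text \<open>The lag is shared as 0 + 1, which pairs \<open>g\<close> with \<open>trans_op g\<close>.
  When the second moment is of order b and lag 2 of order b^2, the weight r = sqrt b puts both terms
  at b^(3/2).\<close>

lemma abs_autocovariance_lag1_le:
  assumes g: "bdd_borel g" and r: "0 < r"
  shows "\<bar>expectation (\<lambda>w. g (X 0 w) * g (X 1 w))\<bar> \<le>
    (r * expectation (\<lambda>w. (g (X 0 w))\<^sup>2) + expectation (\<lambda>w. g (X 0 w) * g (X 2 w)) / r) / 2"
  using abs_expectation_mult_le[OF g bdd_borel_trans_op[OF g] r]
    autocovariance_eq[OF g, of 1 1] autocovariance_eq[OF g, of 0 1]
  by (simp add: power2_eq_square)

section \<open>Covariance inequalities from the mixing coefficients\<close>

lemma alpha_mixing_upper: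
  assumes [measurable]: "A \<in> sets borel" "B \<in> sets borel"
  shows "\<bar>\<P>(w in M. X 0 w \<in> A \<and> X (int k) w \<in> B) - \<P>(w in M. X 0 w \<in> A) * \<P>(w in M. X (int k) w \<in> B)\<bar>
    \<le> alpha_mixing M X k"
proof -
  \<comment> \<open>A real supremum dominates its members only over a set that is bounded above; 1
    bounds all these differences.\<close>
  have bd: "\<bar>p - q * r\<bar> \<le> 1" if "0 \<le> p" "p \<le> 1" "0 \<le> q" "q \<le> 1" "0 \<le> r" "r \<le> 1" for p q r :: real
    using that mult_le_one[of q r] mult_nonneg_nonneg[of q r] by linarith
  have "bdd_above ((\<lambda>(A, B). \<bar>\<P>(w in M. X 0 w \<in> A \<and> X (int k) w \<in> B) -
      \<P>(w in M. X 0 w \<in> A) * \<P>(w in M. X (int k) w \<in> B)\<bar>) ` (sets borel \<times> sets borel))"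
    by (rule bdd_aboveI2[of _ _ 1]) (auto intro!: bd measure_nonneg prob_le_1)
  from cSUP_upper[OF _ this, of "(A, B)"] show ?thesis
    by (simp add: alpha_mixing_def)
qed

lemma alpha_mixing_nonneg: "0 \<le> alpha_mixing M X k"
  using alpha_mixing_upper[of "{}" "{}" k] by simp

lemma expectation_eq_prob:
  fixes f :: "'w \<Rightarrow> real"
  assumes "{w \<in> space M. P w} \<in> sets M" "\<And>w. w \<in> space M \<Longrightarrow> f w = (if P w then 1 else 0)"
  shows "expectation f = \<P>(w in M. P w)"
proof -
  have "expectation f = expectation (indicator {w \<in> space M. P w})"
    by (rule Bochner_Integration.integral_cong) (use assms(2) in \<open>auto simp: indicator_def\<close>)
  also have "{w \<in> space M. P w} \<inter> space M = {w \<in> space M. P w}" by auto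
  then have "expectation (indicator {w \<in> space M. P w}) = \<P>(w in M. P w)"
    by simp
  finally show ?thesis .
qed

text \<open>The factor 4 is 2 * 2: passing from indicators to signs by t -> 2 t - 1 multiplies a
  covariance by both slopes. An upper bound without absolute value suffices, because the sets will
  be chosen to make the covariance nonnegative.\<close>

lemma sign_covariance_le:
  assumes [measurable]: "A \<in> sets borel" "B \<in> sets borel"
  defines "s \<equiv> \<lambda>A x :: real. 2 * indicator A x - 1 :: real"
  shows "expectation (\<lambda>w. s A (X 0 w) * s B (X (int k) w)) -
    expectation (\<lambda>w. s A (X 0 w)) * expectation (\<lambda>w. s B (X 0 w)) \<le> 4 * alpha_mixing M X k"
proof -
  have ind: "bdd_borel (indicator S)" if "S \<in> sets borel" for S
    using that by (intro bdd_borelI[of _ 1]) (auto simp: indicator_def)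
  let ?A = "\<lambda>w. indicator A (X 0 w) :: real" and ?B = "\<lambda>i w. indicator B (X i w) :: real"
  have i: "integrable M ?A" "integrable M (?B i)" "integrable M (\<lambda>w. ?A w * ?B i w)" for i
    by (auto intro!: integrable_bdd_borel integrable_bdd_borel_mult ind)
  have "expectation ?A = \<P>(w in M. X 0 w \<in> A)"
    by (rule expectation_eq_prob) (auto simp: indicator_def)
  moreover have "expectation (?B (int k)) = \<P>(w in M. X (int k) w \<in> B)"
    by (rule expectation_eq_prob) (auto simp: indicator_def)
  moreover have "expectation (\<lambda>w. ?A w * ?B (int k) w) = \<P>(w in M. X 0 w \<in> A \<and> X (int k) w \<in> B)"
    by (rule expectation_eq_prob) (auto simp: indicator_def)
  ultimately have le: "expectation (\<lambda>w. ?A w * ?B (int k) w) - expectation ?A * expectation (?B (int k)) \<le> alpha_mixing M X k"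
    using abs_le_D1[OF alpha_mixing_upper[OF assms(1,2), of k]] by simp
  have B0: "expectation (?B (int k)) = expectation (?B 0)"
    by (rule expectation_shift) auto
  have "(\<lambda>w. s A (X 0 w) * s B (X (int k) w)) = (\<lambda>w. 4 * (?A w * ?B (int k) w) - 2 * ?A w - 2 * ?B (int k) w + 1)"
    by (auto simp: s_def algebra_simps)
  then have e1: "expectation (\<lambda>w. s A (X 0 w) * s B (X (int k) w)) =
      4 * expectation (\<lambda>w. ?A w * ?B (int k) w) - 2 * expectation ?A - 2 * expectation (?B (int k)) + 1"
    using i by (simp add: prob_space)
  have e2: "expectation (\<lambda>w. s A (X 0 w)) = 2 * expectation ?A - 1"
    "expectation (\<lambda>w. s B (X 0 w)) = 2 * expectation (?B (int k)) - 1"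
    using i B0 by (simp_all add: s_def prob_space)
  show ?thesis unfolding e1 e2 using le by (simp add: algebra_simps)
qed

text \<open>Conditioning on one variable and replacing the other factor by the sign of the resulting
  centred conditional expectation can only increase the covariance; doing this on both sides leaves
  two functions with values in \<open>{-1, 1}\<close>.\<close>

lemma covariance_le_alpha_mixing:
  assumes u: "u \<in> borel_measurable borel" "\<And>x. \<bar>u x\<bar> \<le> 1"
    and v: "v \<in> borel_measurable borel" "\<And>x. \<bar>v x\<bar> \<le> 1"
  shows "\<bar>expectation (\<lambda>w. u (X i w) * v (X (i + int k) w)) -
    expectation (\<lambda>w. u (X 0 w)) * expectation (\<lambda>w. v (X 0 w))\<bar> \<le> 4 * alpha_mixing M X k"
proof -
  define s where "s = (\<lambda>A x :: real. 2 * indicator A x - 1 :: real)"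
  have s: "bdd_borel (s A)" if "A \<in> sets borel" for A
    using that by (intro bdd_borelI[of _ 1]) (auto simp: s_def indicator_def)
  have bu: "bdd_borel u" and bv: "bdd_borel v" using u v by (auto intro: bdd_borelI)
  define T where "T h = (\<lambda>x. (trans_op ^^ k) h x - expectation (\<lambda>w. h (X 0 w)))" for h
  have T: "bdd_borel (T h)" if h: "bdd_borel h" for h
  proof -
    obtain C where C: "\<And>x. \<bar>h x\<bar> \<le> C" using h by (auto simp: bdd_borel_def)
    have [measurable]: "(trans_op ^^ k) h \<in> borel_measurable borel"
      using bdd_borel_trans_op_pow[OF h] by (rule bdd_borel_measurable)
    show ?thesis unfolding T_def
    proof (rule bdd_borelI)
      show "\<bar>(trans_op ^^ k) h x - expectation (\<lambda>w. h (X 0 w))\<bar> \<le> C + \<bar>expectation (\<lambda>w. h (X 0 w))\<bar>" for x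
        using trans_op_pow_bound[OF h C, of k x] by linarith
    qed auto
  qed
  have cov: "expectation (\<lambda>w. p (X 0 w) * T h (X 0 w)) =
      expectation (\<lambda>w. p (X 0 w) * h (X (int k) w)) - expectation (\<lambda>w. p (X 0 w)) * expectation (\<lambda>w. h (X 0 w))"
    if p: "bdd_borel p" and h: "bdd_borel h" for p h
    using expectation_trans_op_pow[OF p h, of 0 k] integrable_bdd_borel[OF p]
      integrable_bdd_borel_mult[OF p bdd_borel_trans_op_pow[OF h, of k], of 0 0]
    by (simp add: T_def right_diff_distrib)
  \<comment> \<open>Self-adjointness of the power makes the covariance symmetric, so the same
    replacement by a sign serves first for \<open>u\<close> and then, with the roles exchanged, for
    \<open>v\<close>.\<close>
  have cov_sym: "expectation (\<lambda>w. p (X 0 w) * T h (X 0 w)) = expectation (\<lambda>w. h (X 0 w) * T p (X 0 w))"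
    if p: "bdd_borel p" and h: "bdd_borel h" for p h
    using cov[OF p h] cov[OF h p] expectation_trans_op_pow[OF p h, of 0 k]
      expectation_trans_op_pow[OF h p, of 0 k] trans_op_pow_self_adjoint[OF p h, of k]
    by (simp add: mult.commute)
  have sgn: "\<exists>A\<in>sets borel. \<bar>expectation (\<lambda>w. p (X 0 w) * T h (X 0 w))\<bar> \<le> expectation (\<lambda>w. s A (X 0 w) * T h (X 0 w))"
    if p: "bdd_borel p" "\<And>x. \<bar>p x\<bar> \<le> 1" and h: "bdd_borel h" for p h
  proof -
    have [measurable]: "T h \<in> borel_measurable borel" using T[OF h] by (rule bdd_borel_measurable)
    define A where "A = {x \<in> space borel. 0 \<le> T h x}"
    have A: "A \<in> sets borel" unfolding A_def by measurable
    have eq: "s A x * T h x = \<bar>T h x\<bar>" for x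
      by (auto simp: s_def A_def indicator_def)
    have "\<bar>expectation (\<lambda>w. p (X 0 w) * T h (X 0 w))\<bar> \<le> expectation (\<lambda>w. \<bar>p (X 0 w) * T h (X 0 w)\<bar>)"
      by (rule integral_abs_bound)
    also have "\<dots> \<le> expectation (\<lambda>w. s A (X 0 w) * T h (X 0 w))"
    proof (rule integral_mono)
      show "\<bar>p (X 0 w) * T h (X 0 w)\<bar> \<le> s A (X 0 w) * T h (X 0 w)" for w
        unfolding eq abs_mult using p(2)[of "X 0 w"] by (simp add: mult_left_le_one_le)
    qed (use integrable_bdd_borel_mult[OF p(1) T[OF h], of 0 0] integrable_bdd_borel_mult[OF s[OF A] T[OF h], of 0 0] in auto)
    finally show ?thesis using A by blast
  qed
  obtain A where A: "A \<in> sets borel"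
    "\<bar>expectation (\<lambda>w. u (X 0 w) * T v (X 0 w))\<bar> \<le> expectation (\<lambda>w. s A (X 0 w) * T v (X 0 w))"
    using sgn[OF bu u(2) bv] by blast
  obtain B where B: "B \<in> sets borel"
    "\<bar>expectation (\<lambda>w. v (X 0 w) * T (s A) (X 0 w))\<bar> \<le> expectation (\<lambda>w. s B (X 0 w) * T (s A) (X 0 w))"
    using sgn[OF bv v(2) s[OF A(1)]] by blast
  have "\<bar>expectation (\<lambda>w. u (X 0 w) * T v (X 0 w))\<bar> \<le> expectation (\<lambda>w. s A (X 0 w) * T (s B) (X 0 w))"
    using A(2) B(2) cov_sym[OF s[OF A(1)] bv] cov_sym[OF s[OF A(1)] s[OF B(1)]] by linarith
  also have "\<dots> \<le> 4 * alpha_mixing M X k"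
    using sign_covariance_le[OF A(1) B(1), of k] cov[OF s[OF A(1)] s[OF B(1)]]
    by (simp add: s_def)
  finally show ?thesis
    using cov[OF bu bv] expectation_trans_op_pow[OF bu bv, of 0 k] expectation_trans_op_pow[OF bu bv, of i k] by simp
qed

lemma covariance_le_alpha_mixing_scaled:
  assumes u: "u \<in> borel_measurable borel" "\<And>x. \<bar>u x\<bar> \<le> C" and C: "0 < C"
    and z: "expectation (\<lambda>w. u (X 0 w)) = 0"
  shows "\<bar>expectation (\<lambda>w. u (X 0 w) * u (X (int k) w))\<bar> \<le> 4 * C\<^sup>2 * alpha_mixing M X k"
proof -
  have "\<bar>expectation (\<lambda>w. (u (X 0 w) / C) * (u (X (0 + int k) w) / C)) -
      expectation (\<lambda>w. u (X 0 w) / C) * expectation (\<lambda>w. u (X 0 w) / C)\<bar> \<le> 4 * alpha_mixing M X k"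
    by (rule covariance_le_alpha_mixing[of "\<lambda>x. u x / C" "\<lambda>x. u x / C"]) (use u C in \<open>auto simp: divide_simps\<close>)
  then have "\<bar>expectation (\<lambda>w. u (X 0 w) * u (X (int k) w))\<bar> / C\<^sup>2 \<le> 4 * alpha_mixing M X k"
    using z C by (simp add: power2_eq_square)
  then show ?thesis using C by (simp add: field_simps)
qed

text \<open>The operator carries the indicator of \<open>B\<close> from time \<open>m\<close> back
  to a function \<open>v\<close> of \<open>X k\<close>. This function takes values in [-1, 1] but is
  no longer an indicator, so the covariance inequality is applied to it at the price of the factor
  4.\<close>

lemma alpha_mixing_quasi_antimono:
  assumes "k \<le> m"
  shows "alpha_mixing M X m \<le> 4 * alpha_mixing M X k"
  unfolding alpha_mixing_def[of M X m]
proof (rule cSUP_least)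
  fix AB :: "real set \<times> real set" assume "AB \<in> sets borel \<times> sets borel"
  then obtain A B where AB: "AB = (A, B)" and [measurable]: "A \<in> sets borel" "B \<in> sets borel" by auto
  define v where "v = (trans_op ^^ (m - k)) (indicator B)"
  have A: "bdd_borel (indicator A)" and B: "bdd_borel (indicator B)"
    by (rule bdd_borelI[of _ 1]; auto simp: indicator_def)+
  have v: "v \<in> borel_measurable borel" "\<And>x. \<bar>v x\<bar> \<le> 1"
    unfolding v_def using bdd_borel_trans_op_pow[OF B]
    by (auto intro!: trans_op_pow_bound B bdd_borel_measurable simp: indicator_def)
  let ?A = "\<lambda>w. indicator A (X 0 w) :: real" and ?B = "\<lambda>w. indicator B (X (int m) w) :: real"
  have prob: "expectation ?A = \<P>(w in M. X 0 w \<in> A)" "expectation ?B = \<P>(w in M. X (int m) w \<in> B)"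
    "expectation (\<lambda>w. ?A w * ?B w) = \<P>(w in M. X 0 w \<in> A \<and> X (int m) w \<in> B)"
    by (rule expectation_eq_prob; auto simp: indicator_def; fail)+
  have m: "(trans_op ^^ m) h = (trans_op ^^ k) ((trans_op ^^ (m - k)) h)" for h
    using assms by (simp flip: funpow_add[THEN fun_cong, unfolded comp_def])
  have "expectation (\<lambda>w. ?A w * ?B w) = expectation (\<lambda>w. ?A w * v (X (int k) w))"
    using expectation_trans_op_pow[OF A B, of 0 m]
      expectation_trans_op_pow[OF A bdd_borel_trans_op_pow[OF B, of "m - k"], of 0 k] m[of "indicator B"]
    by (simp add: v_def)
  moreover have "expectation ?B = expectation (\<lambda>w. v (X 0 w))"
    using expectation_trans_op_pow[OF bdd_borelI[of "\<lambda>_. 1" 1] B, of k "m - k"] assms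
    by (simp add: v_def of_nat_diff)
  ultimately show "(case AB of (A, B) \<Rightarrow> \<bar>\<P>(w in M. X 0 w \<in> A \<and> X (int m) w \<in> B) -
      \<P>(w in M. X 0 w \<in> A) * \<P>(w in M. X (int m) w \<in> B)\<bar>) \<le> 4 * alpha_mixing M X k"
    using covariance_le_alpha_mixing[of "indicator A" v 0 k] v
    by (simp add: AB flip: prob)
qed auto

end

section \<open>Decoupling of separated blocks\<close>

context reversible_chain
begin

text \<open>The real and the imaginary part are each a sum or difference of two real covariances,
  which gives 4 in total.\<close>

lemma cov_complex:
  fixes a b c d :: "'w \<Rightarrow> real"
  assumes i: "integrable M a" "integrable M b" "integrable M c" "integrable M d"
    "integrable M (\<lambda>w. a w * c w)" "integrable M (\<lambda>w. a w * d w)" "integrable M (\<lambda>w. b w * c w)" "integrable M (\<lambda>w. b w * d w)"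
    and le: "\<bar>expectation (\<lambda>w. a w * c w) - expectation a * expectation c\<bar> \<le> e"
      "\<bar>expectation (\<lambda>w. a w * d w) - expectation a * expectation d\<bar> \<le> e"
      "\<bar>expectation (\<lambda>w. b w * c w) - expectation b * expectation c\<bar> \<le> e"
      "\<bar>expectation (\<lambda>w. b w * d w) - expectation b * expectation d\<bar> \<le> e"
  shows "cmod (expectation (\<lambda>w. Complex (a w) (b w) * Complex (c w) (d w)) -
    expectation (\<lambda>w. Complex (a w) (b w)) * expectation (\<lambda>w. Complex (c w) (d w))) \<le> 4 * e"
proof -
  have ex: "integrable M (\<lambda>w. Complex (f w) (g w)) \<and> expectation (\<lambda>w. Complex (f w) (g w)) = Complex (expectation f) (expectation g)"
    if "integrable M f" "integrable M g" for f g :: "'w \<Rightarrow> real"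
  proof -
    have eq: "(\<lambda>w. Complex (f w) (g w)) = (\<lambda>w. of_real (f w) + \<i> * of_real (g w))"
      by (auto simp: complex_eq_iff)
    have "integrable M (\<lambda>w. of_real (f w) + \<i> * of_real (g w))"
      using that by auto
    moreover have "expectation (\<lambda>w. of_real (f w) + \<i> * of_real (g w)) = of_real (expectation f) + \<i> * of_real (expectation g)"
      using that by (subst Bochner_Integration.integral_add) auto
    ultimately show ?thesis unfolding eq by (auto simp: complex_eq_iff)
  qed
  let ?z = "expectation (\<lambda>w. Complex (a w) (b w) * Complex (c w) (d w)) -
    expectation (\<lambda>w. Complex (a w) (b w)) * expectation (\<lambda>w. Complex (c w) (d w))"
  have z: "?z = Complex
     (expectation (\<lambda>w. a w * c w) - expectation a * expectation c - (expectation (\<lambda>w. b w * d w) - expectation b * expectation d))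
     (expectation (\<lambda>w. a w * d w) - expectation a * expectation d + (expectation (\<lambda>w. b w * c w) - expectation b * expectation c))"
    using ex[of a b] ex[of c d] ex[of "\<lambda>w. a w * c w - b w * d w" "\<lambda>w. a w * d w + b w * c w"] i
    by (simp add: complex_mult complex_eq_iff)
  have "cmod ?z \<le> \<bar>Re ?z\<bar> + \<bar>Im ?z\<bar>" by (rule cmod_le)
  also have "\<dots> \<le> 4 * e" unfolding z using le by simp
  finally show ?thesis .
qed

text \<open>This says that the conditional expectation of \<open>V\<close> given the past up to
  \<open>l\<close> is \<open>v (X l)\<close>, in the form of a test against bounded past-measurable
  \<open>U\<close>. \<open>V\<close> itself may involve all of the future.\<close>

definition depends_on :: "int \<Rightarrow> ('w \<Rightarrow> real) \<Rightarrow> (real \<Rightarrow> real) \<Rightarrow> bool" where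
  "depends_on l V v \<longleftrightarrow> bdd_borel v \<and>
    (\<forall>U C. U \<in> borel_measurable (past_algebra M X l) \<longrightarrow> (\<forall>w. \<bar>U w\<bar> \<le> C) \<longrightarrow>
      expectation (\<lambda>w. U w * V w) = expectation (\<lambda>w. U w * v (X l w)))"

lemma depends_onD:
  "depends_on l V v \<Longrightarrow> U \<in> borel_measurable (past_algebra M X l) \<Longrightarrow> (\<And>w. \<bar>U w\<bar> \<le> C) \<Longrightarrow>
    expectation (\<lambda>w. U w * V w) = expectation (\<lambda>w. U w * v (X l w))"
  unfolding depends_on_def by blast

text \<open>A product of functions of \<open>X l, \<dots>, X (l + n)\<close> has, seen from the past of \<open>l\<close>, a
  conditional expectation that depends on \<open>X l\<close> only.\<close>

lemma future_projection:
  fixes h :: "real \<Rightarrow> complex"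
  assumes h[measurable]: "h \<in> borel_measurable borel" and hb: "\<And>x. cmod (h x) \<le> 1"
  shows "\<exists>v1 v2. depends_on l (\<lambda>w. Re (\<Prod>i\<le>n. h (X (l + int i) w))) v1 \<and>
    depends_on l (\<lambda>w. Im (\<Prod>i\<le>n. h (X (l + int i) w))) v2"
proof (induction n arbitrary: l)
  case 0
  have "bdd_borel (\<lambda>x. Re (h x))" "bdd_borel (\<lambda>x. Im (h x))"
    by (rule bdd_borelI[of _ 1]; use hb in \<open>auto intro: order_trans[OF abs_Re_le_cmod] order_trans[OF abs_Im_le_cmod]\<close>)+
  then show ?case by (intro exI[of _ "\<lambda>x. Re (h x)"] exI[of _ "\<lambda>x. Im (h x)"]) (auto simp: depends_on_def)
next
  case (Suc n)
  define W where "W w = (\<Prod>i\<le>n. h (X (l + 1 + int i) w))" for w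
  obtain v1 v2 where v1: "depends_on (l + 1) (\<lambda>w. Re (W w)) v1" and v2: "depends_on (l + 1) (\<lambda>w. Im (W w)) v2"
    using Suc.IH[of "l + 1"] unfolding W_def by blast
  have v: "bdd_borel v1" "bdd_borel v2" using v1 v2 by (auto simp: depends_on_def)
  define r1 r2 where "r1 x = Re (h x)" and "r2 x = Im (h x)" for x
  have r: "r1 \<in> borel_measurable borel" "\<bar>r1 x\<bar> \<le> 1" "r2 \<in> borel_measurable borel" "\<bar>r2 x\<bar> \<le> 1" for x
    unfolding r1_def r2_def using hb by (auto intro: order_trans[OF abs_Re_le_cmod] order_trans[OF abs_Im_le_cmod])
  have Wm[measurable]: "W \<in> borel_measurable M" unfolding W_def by measurable
  have Wb: "cmod (W w) \<le> 1" for w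
    unfolding W_def prod_norm[symmetric] by (rule prod_le_1) (auto simp: hb)
  have Wr: "\<bar>Re (W w)\<bar> \<le> 1" "\<bar>Im (W w)\<bar> \<le> 1" for w
    using Wb[of w] abs_Re_le_cmod[of "W w"] abs_Im_le_cmod[of "W w"] by linarith+
  have prod: "(\<Prod>i\<le>Suc n. h (X (l + int i) w)) = h (X l w) * W w" for w
    unfolding W_def prod.atMost_Suc_shift by (simp add: algebra_simps)
  define P1 P2 where "P1 = trans_op v1" and "P2 = trans_op v2"
  have P: "bdd_borel P1" "bdd_borel P2" unfolding P1_def P2_def by (auto intro: bdd_borel_trans_op v)
  \<comment> \<open>Real and imaginary part of h * (P1 + i P2): the factor \<open>h (X l)\<close>
    belongs to the past of \<open>l\<close> and stays, while the remaining product, already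
    projected onto \<open>X (l + 1)\<close>, is carried to \<open>X l\<close> by one
    transition.\<close>
  define u1 u2 where "u1 x = r1 x * P1 x - r2 x * P2 x" and "u2 x = r1 x * P2 x + r2 x * P1 x" for x
  obtain C1 C2 where C: "\<And>x. \<bar>P1 x\<bar> \<le> C1" "\<And>x. \<bar>P2 x\<bar> \<le> C2"
    using P by (auto simp: bdd_borel_def)
  have rP: "\<bar>a * c\<bar> \<le> D" if "\<bar>a\<bar> \<le> 1" "\<bar>c\<bar> \<le> D" for a c D :: real
    using mult_mono[OF that] by (simp add: abs_mult)
  have "u1 \<in> borel_measurable borel" "u2 \<in> borel_measurable borel"
    unfolding u1_def u2_def using r P[THEN bdd_borel_measurable] by auto
  moreover have "\<bar>u1 x\<bar> \<le> C1 + C2" for x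
    unfolding u1_def using rP[OF r(2) C(1)] rP[OF r(4) C(2)]
    by (intro abs_triangle_ineq4[THEN order_trans] add_mono) auto
  moreover have "\<bar>u2 x\<bar> \<le> C2 + C1" for x
    unfolding u2_def using rP[OF r(2) C(2)] rP[OF r(4) C(1)]
    by (intro abs_triangle_ineq[THEN order_trans] add_mono) auto
  ultimately have u: "bdd_borel u1" "bdd_borel u2" by (auto intro: bdd_borelI)
  show ?case
    unfolding depends_on_def
  proof (rule exI[of _ u1], rule exI[of _ u2], intro conjI allI impI u)
    fix U :: "'w \<Rightarrow> real" and C assume U: "U \<in> borel_measurable (past_algebra M X l)" and UC: "\<forall>w. \<bar>U w\<bar> \<le> C"
    have [measurable]: "U \<in> borel_measurable M" by (rule measurable_from_subalg[OF subalgebra_past U])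
    have step: "expectation (\<lambda>w. (U w * s (X l w)) * q w) = expectation (\<lambda>w. (U w * s (X l w)) * trans_op v (X l w)) \<and>
        integrable M (\<lambda>w. (U w * s (X l w)) * q w) \<and> integrable M (\<lambda>w. (U w * s (X l w)) * trans_op v (X l w))"
      if s: "s \<in> borel_measurable borel" "\<And>x. \<bar>s x\<bar> \<le> 1" and v: "bdd_borel v" and q: "q \<in> borel_measurable M" "\<And>w. \<bar>q w\<bar> \<le> 1"
        and eq: "depends_on (l + 1) q v" for s q v
    proof -
      note [measurable] = s(1) q(1) bdd_borel_measurable[OF bdd_borel_trans_op[OF v]]
      have Us: "(\<lambda>w. U w * s (X l w)) \<in> borel_measurable (past_algebra M X l)"
        using U X_compose_past[OF s(1), of l l] by measurable
      have C0: "0 \<le> C" by (rule order_trans[OF abs_ge_zero]) (use UC in blast)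
      have Usb: "\<bar>U w * s (X l w)\<bar> \<le> C * 1" for w
        unfolding abs_mult by (intro mult_mono s) (use UC C0 in auto)
      obtain D where D: "\<And>x. \<bar>trans_op v x\<bar> \<le> D" using bdd_borel_trans_op[OF v] by (auto simp: bdd_borel_def)
      have "expectation (\<lambda>w. (U w * s (X l w)) * q w) = expectation (\<lambda>w. (U w * s (X l w)) * v (X (l + 1) w))"
        by (rule depends_onD[OF eq measurable_past_mono[OF Us] Usb]) simp
      also have "\<dots> = expectation (\<lambda>w. (U w * s (X l w)) * trans_op v (X l w))"
        by (rule markov_property[OF Us Usb v])
      finally show ?thesis
        using integrable_bounded_mult[of "\<lambda>w. U w * s (X l w)" q, OF _ _ Usb q(2)]
          integrable_bounded_mult[of "\<lambda>w. U w * s (X l w)" "\<lambda>w. trans_op v (X l w)", OF _ _ Usb D] by simp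
    qed
    have W: "(\<lambda>w. Re (W w)) \<in> borel_measurable M" "(\<lambda>w. Im (W w)) \<in> borel_measurable M" by auto
    note s11 = step[OF r(1,2) v(1) W(1) Wr(1) v1, folded P1_def]
    note s12 = step[OF r(1,2) v(2) W(2) Wr(2) v2, folded P2_def]
    note s21 = step[OF r(3,4) v(1) W(1) Wr(1) v1, folded P1_def]
    note s22 = step[OF r(3,4) v(2) W(2) Wr(2) v2, folded P2_def]
    have "expectation (\<lambda>w. U w * Re (\<Prod>i\<le>Suc n. h (X (l + int i) w))) =
      expectation (\<lambda>w. (U w * r1 (X l w)) * Re (W w) - (U w * r2 (X l w)) * Im (W w))"
      unfolding prod by (simp add: r1_def r2_def algebra_simps)
    also have "\<dots> = expectation (\<lambda>w. (U w * r1 (X l w)) * P1 (X l w) - (U w * r2 (X l w)) * P2 (X l w))"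
      using s11 s22 by simp
    also have "\<dots> = expectation (\<lambda>w. U w * u1 (X l w))"
      by (simp add: u1_def algebra_simps)
    finally show "expectation (\<lambda>w. U w * Re (\<Prod>i\<le>Suc n. h (X (l + int i) w))) = expectation (\<lambda>w. U w * u1 (X l w))" .
    have "expectation (\<lambda>w. U w * Im (\<Prod>i\<le>Suc n. h (X (l + int i) w))) =
      expectation (\<lambda>w. (U w * r1 (X l w)) * Im (W w) + (U w * r2 (X l w)) * Re (W w))"
      unfolding prod by (simp add: r1_def r2_def algebra_simps)
    also have "\<dots> = expectation (\<lambda>w. (U w * r1 (X l w)) * P2 (X l w) + (U w * r2 (X l w)) * P1 (X l w))"
      using s12 s21 by simp
    also have "\<dots> = expectation (\<lambda>w. U w * u2 (X l w))"
      by (simp add: u2_def algebra_simps)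
    finally show "expectation (\<lambda>w. U w * Im (\<Prod>i\<le>Suc n. h (X (l + int i) w))) = expectation (\<lambda>w. U w * u2 (X l w))" .
  qed
qed

text \<open>The covariance equals that of \<open>u (X k)\<close> and \<open>z (X ?l)\<close>, the
  projections of \<open>U\<close> and \<open>V\<close> onto single coordinates. The given
  \<open>v\<close> is bounded, but not visibly by 1, and so it is exchanged for \<open>z\<close>.
  That exchange needs a function of \<open>X ?l\<close> in the place of \<open>U\<close>, which is
  the auxiliary projection \<open>y\<close>.\<close>

lemma covariance_past_future_le:
  assumes U: "U \<in> borel_measurable (past_algebra M X k)" and Ub: "\<And>w. \<bar>U w\<bar> \<le> 1"
    and V: "V \<in> borel_measurable M" and Vb: "\<And>w. \<bar>V w\<bar> \<le> 1"
    and proj: "depends_on (k + int d) V v"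
  shows "\<bar>expectation (\<lambda>w. U w * V w) - expectation U * expectation V\<bar> \<le> 4 * alpha_mixing M X d"
proof -
  let ?l = "k + int d"
  have UM: "U \<in> borel_measurable M" by (rule measurable_from_subalg[OF subalgebra_past U])
  have v: "bdd_borel v" using proj by (simp add: depends_on_def)
  obtain u where u: "u \<in> borel_measurable borel" "\<And>x. \<bar>u x\<bar> \<le> 1"
    and u_eq: "\<And>v D. \<lbrakk>v \<in> borel_measurable borel; \<And>x. \<bar>v x\<bar> \<le> D\<rbrakk> \<Longrightarrow>
      expectation (\<lambda>w. U w * v (X k w)) = expectation (\<lambda>w. u (X k w) * v (X k w))"
    by (rule cond_exp_given[OF measurable_X UM Ub]) blast
  obtain y where y: "y \<in> borel_measurable borel" "\<And>x. \<bar>y x\<bar> \<le> 1"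
    and y_eq: "\<And>v D. \<lbrakk>v \<in> borel_measurable borel; \<And>x. \<bar>v x\<bar> \<le> D\<rbrakk> \<Longrightarrow>
      expectation (\<lambda>w. U w * v (X ?l w)) = expectation (\<lambda>w. y (X ?l w) * v (X ?l w))"
    by (rule cond_exp_given[OF measurable_X UM Ub]) blast
  obtain z where z: "z \<in> borel_measurable borel" "\<And>x. \<bar>z x\<bar> \<le> 1"
    and z_eq: "\<And>v D. \<lbrakk>v \<in> borel_measurable borel; \<And>x. \<bar>v x\<bar> \<le> D\<rbrakk> \<Longrightarrow>
      expectation (\<lambda>w. V w * v (X ?l w)) = expectation (\<lambda>w. z (X ?l w) * v (X ?l w))"
    by (rule cond_exp_given[OF measurable_X V Vb]) blast
  have bz: "bdd_borel z" by (rule bdd_borelI[OF z])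
  obtain D where D: "\<And>x. \<bar>v x\<bar> \<le> D" using v by (auto simp: bdd_borel_def)
  have "expectation (\<lambda>w. U w * V w) = expectation (\<lambda>w. U w * v (X ?l w))"
    by (rule depends_onD[OF proj measurable_past_mono[OF U] Ub]) simp
  also have "\<dots> = expectation (\<lambda>w. y (X ?l w) * v (X ?l w))"
    by (rule y_eq[OF bdd_borel_measurable[OF v] D])
  also have "\<dots> = expectation (\<lambda>w. y (X ?l w) * V w)"
    by (rule depends_onD[OF proj X_compose_past[OF y(1)] y(2), symmetric]) simp
  also have "\<dots> = expectation (\<lambda>w. y (X ?l w) * z (X ?l w))"
    using z_eq[OF y] by (simp add: mult.commute)
  also have "\<dots> = expectation (\<lambda>w. U w * z (X ?l w))"
    by (rule y_eq[OF z, symmetric])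
  also have "\<dots> = expectation (\<lambda>w. U w * (trans_op ^^ d) z (X k w))"
    by (rule markov_property_pow[OF U Ub bz])
  also have "\<dots> = expectation (\<lambda>w. u (X k w) * (trans_op ^^ d) z (X k w))"
    by (rule u_eq[OF bdd_borel_measurable[OF bdd_borel_trans_op_pow[OF bz]] trans_op_pow_bound[OF bz z(2)]])
  also have "\<dots> = expectation (\<lambda>w. u (X k w) * z (X ?l w))"
    by (rule markov_property_pow[symmetric, OF X_compose_past[OF u(1)] u(2) bz]) simp
  finally have "expectation (\<lambda>w. U w * V w) = expectation (\<lambda>w. u (X k w) * z (X ?l w))" .
  moreover have "expectation U = expectation (\<lambda>w. u (X 0 w))"
    using u_eq[of "\<lambda>_. 1" 1] expectation_shift[OF u(1), of k] by simp
  moreover have "expectation V = expectation (\<lambda>w. z (X 0 w))"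
    using z_eq[of "\<lambda>_. 1" 1] expectation_shift[OF z(1), of ?l] by simp
  ultimately show ?thesis
    using covariance_le_alpha_mixing[OF u z, of k d] by simp
qed

text \<open>The constant 16 is 4 * 4: four real covariances in \<open>cov_complex\<close>, each at
  most four mixing coefficients by \<open>covariance_past_future_le\<close>.\<close>

lemma complex_covariance_past_future_le:
  fixes U :: "'w \<Rightarrow> complex" and h :: "real \<Rightarrow> complex" and n d :: nat
  assumes U: "U \<in> borel_measurable (past_algebra M X k)" and Ub: "\<And>w. cmod (U w) \<le> 1"
    and h[measurable]: "h \<in> borel_measurable borel" and hb: "\<And>x. cmod (h x) \<le> 1"
  defines "V \<equiv> \<lambda>w. \<Prod>i\<le>n. h (X (k + int d + int i) w)"
  shows "cmod (expectation (\<lambda>w. U w * V w) - expectation U * expectation V) \<le> 16 * alpha_mixing M X d"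
proof -
  let ?l = "k + int d"
  have UM[measurable]: "U \<in> borel_measurable M" by (rule measurable_from_subalg[OF subalgebra_past U])
  have VM[measurable]: "V \<in> borel_measurable M" unfolding V_def by measurable
  have Vb: "cmod (V w) \<le> 1" for w
    unfolding V_def prod_norm[symmetric] by (rule prod_le_1) (auto simp: hb)
  obtain v1 v2 where v: "depends_on ?l (\<lambda>w. Re (V w)) v1" "depends_on ?l (\<lambda>w. Im (V w)) v2"
    using future_projection[OF h hb, of ?l n] unfolding V_def by blast
  have Ur: "\<bar>Re (U w)\<bar> \<le> 1" "\<bar>Im (U w)\<bar> \<le> 1" for w
    using Ub[of w] abs_Re_le_cmod[of "U w"] abs_Im_le_cmod[of "U w"] by linarith+
  have Vr: "\<bar>Re (V w)\<bar> \<le> 1" "\<bar>Im (V w)\<bar> \<le> 1" for w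
    using Vb[of w] abs_Re_le_cmod[of "V w"] abs_Im_le_cmod[of "V w"] by linarith+
  have Um: "(\<lambda>w. Re (U w)) \<in> borel_measurable (past_algebra M X k)" "(\<lambda>w. Im (U w)) \<in> borel_measurable (past_algebra M X k)"
    using U by measurable
  have Vm: "(\<lambda>w. Re (V w)) \<in> borel_measurable M" "(\<lambda>w. Im (V w)) \<in> borel_measurable M"
    by measurable
  have UmM: "(\<lambda>w. Re (U w)) \<in> borel_measurable M" "(\<lambda>w. Im (U w)) \<in> borel_measurable M"
    by measurable
  note ib = integrable_bounded[of "\<lambda>w. Re (U w)" 1, OF UmM(1), unfolded real_norm_def, OF Ur(1)]
    integrable_bounded[of "\<lambda>w. Im (U w)" 1, OF UmM(2), unfolded real_norm_def, OF Ur(2)]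
    integrable_bounded[of "\<lambda>w. Re (V w)" 1, OF Vm(1), unfolded real_norm_def, OF Vr(1)]
    integrable_bounded[of "\<lambda>w. Im (V w)" 1, OF Vm(2), unfolded real_norm_def, OF Vr(2)]
  note im = integrable_bounded_mult[OF UmM(1) Vm(1) Ur(1) Vr(1)] integrable_bounded_mult[OF UmM(1) Vm(2) Ur(1) Vr(2)]
    integrable_bounded_mult[OF UmM(2) Vm(1) Ur(2) Vr(1)] integrable_bounded_mult[OF UmM(2) Vm(2) Ur(2) Vr(2)]
  have "cmod (expectation (\<lambda>w. Complex (Re (U w)) (Im (U w)) * Complex (Re (V w)) (Im (V w))) -
    expectation (\<lambda>w. Complex (Re (U w)) (Im (U w))) * expectation (\<lambda>w. Complex (Re (V w)) (Im (V w))))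
    \<le> 4 * (4 * alpha_mixing M X d)"
  proof (rule cov_complex)
    note c = covariance_past_future_le[OF Um(1) Ur(1) Vm(1) Vr(1) v(1)]
      covariance_past_future_le[OF Um(1) Ur(1) Vm(2) Vr(2) v(2)]
      covariance_past_future_le[OF Um(2) Ur(2) Vm(1) Vr(1) v(1)]
      covariance_past_future_le[OF Um(2) Ur(2) Vm(2) Vr(2) v(2)]
    show "\<bar>expectation (\<lambda>w. Re (U w) * Re (V w)) - expectation (\<lambda>w. Re (U w)) * expectation (\<lambda>w. Re (V w))\<bar> \<le> 4 * alpha_mixing M X d"
      "\<bar>expectation (\<lambda>w. Re (U w) * Im (V w)) - expectation (\<lambda>w. Re (U w)) * expectation (\<lambda>w. Im (V w))\<bar> \<le> 4 * alpha_mixing M X d"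
      "\<bar>expectation (\<lambda>w. Im (U w) * Re (V w)) - expectation (\<lambda>w. Im (U w)) * expectation (\<lambda>w. Re (V w))\<bar> \<le> 4 * alpha_mixing M X d"
      "\<bar>expectation (\<lambda>w. Im (U w) * Im (V w)) - expectation (\<lambda>w. Im (U w)) * expectation (\<lambda>w. Im (V w))\<bar> \<le> 4 * alpha_mixing M X d"
      by (rule c)+
  qed (fact ib im)+
  then show ?thesis by simp
qed

text \<open>Each block has \<open>p + 1\<close> terms; the last index of a block and the first of the next differ by \<open>d\<close>.\<close>

lemma block_decoupling:
  fixes h :: "real \<Rightarrow> complex" and p d :: nat
  assumes h[measurable]: "h \<in> borel_measurable borel" and hb: "\<And>x. cmod (h x) \<le> 1"
  defines "V \<equiv> \<lambda>j w. \<Prod>i\<le>p. h (X (int (j * (p + d)) + 1 + int i) w)"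
  shows "cmod (expectation (\<lambda>w. \<Prod>j<m. V j w) - (\<Prod>j<m. expectation (V j))) \<le> real m * (16 * alpha_mixing M X d)"
proof (induction m)
  case 0 show ?case by (simp add: prob_space)
next
  case (Suc m)
  let ?P = "\<lambda>w. \<Prod>j<m. V j w"
  have Vb: "cmod (V j w) \<le> 1" for j w
    unfolding V_def prod_norm[symmetric] by (rule prod_le_1) (auto simp: hb)
  have Pb: "cmod (?P w) \<le> 1" for w
    unfolding prod_norm[symmetric] by (rule prod_le_1) (auto simp: Vb)
  have VM[measurable]: "V j \<in> borel_measurable M" for j unfolding V_def by measurable
  have EV: "cmod (expectation (V m)) \<le> 1"
  proof -
    have "cmod (expectation (V m)) \<le> expectation (\<lambda>w. cmod (V m w))" by (rule integral_norm_bound)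
    also have "\<dots> \<le> expectation (\<lambda>w. 1)"
      by (rule integral_mono) (auto intro: integrable_bounded[of _ 1] simp: Vb)
    finally show ?thesis by (simp add: prob_space)
  qed
  have step: "cmod (expectation (\<lambda>w. ?P w * V m w) - expectation ?P * expectation (V m)) \<le> 16 * alpha_mixing M X d"
  proof (cases m)
    case 0
    then show ?thesis by (simp add: prob_space alpha_mixing_nonneg)
  next
    case (Suc m')
    \<comment> \<open>The block before block \<open>m\<close> ends at index m (p + d) + 1 - d, which
      is \<open>d\<close> steps before the first index m (p + d) + 1 of block
      \<open>m\<close>.\<close>
    have Vpast: "V j \<in> borel_measurable (past_algebra M X (int (m * (p + d)) + 1 - int d))" if "j < m" for j
    proof -
      have "j * (p + d) + (p + d) \<le> m * (p + d)"
        using that by (metis Suc_leI mult_le_mono1 mult_Suc add.commute)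
      then have "int (j * (p + d)) + int p + int d \<le> int (m * (p + d))" by linarith
      then have "int (j * (p + d)) + 1 + int i \<le> int (m * (p + d)) + 1 - int d" if "i \<le> p" for i
        using that by linarith
      then show ?thesis
        unfolding V_def by (intro borel_measurable_prod measurable_compose[OF X_measurable_past h]) auto
    qed
    have "?P \<in> borel_measurable (past_algebra M X (int (m * (p + d)) + 1 - int d))"
      by (intro borel_measurable_prod Vpast) auto
    from complex_covariance_past_future_le[OF this Pb h hb, of d p]
    show ?thesis by (simp add: V_def)
  qed
  \<comment> \<open>Splitting off the last block costs one covariance. The earlier discrepancy is
    multiplied by an expectation of modulus at most 1, so the errors merely add up.\<close>
  have "expectation (\<lambda>w. \<Prod>j<Suc m. V j w) - (\<Prod>j<Suc m. expectation (V j)) =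
    (expectation (\<lambda>w. ?P w * V m w) - expectation ?P * expectation (V m)) +
    (expectation ?P - (\<Prod>j<m. expectation (V j))) * expectation (V m)"
    by (simp add: algebra_simps)
  also have "cmod \<dots> \<le> 16 * alpha_mixing M X d + real m * (16 * alpha_mixing M X d) * 1"
    unfolding norm_mult
    by (intro norm_triangle_le add_mono step order_trans[OF eq_refl[OF norm_mult]] mult_mono Suc.IH EV)
      (auto simp: alpha_mixing_nonneg)
  finally show ?case by (simp add: algebra_simps)
qed

end

section \<open>Second moments of sums\<close>

text \<open>Blocks are short against \<open>n\<close>, and gaps against blocks. The third quotient
  is the number of blocks times d^-2, the order of the mixing coefficient across a gap. The last
  limit makes block sums over sqrt (n b) uniformly small, as n b^4 >= 1 gives sqrt (n b) >= n^(3/8).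
  The exponents 9/25 for \<open>p\<close> and 33/100 for \<open>d\<close> work because 33/100 < 9/25
  < 3/8 and 9/25 + 2 * 33/100 > 1.\<close>

lemma block_lengths:
  obtains p d :: "nat \<Rightarrow> nat"
  where "\<And>n. 1 \<le> d n" "(\<lambda>n. real (p n + d n) / real n) \<longlonglongrightarrow> 0" "(\<lambda>n. real (d n) / real (p n + d n)) \<longlonglongrightarrow> 0"
    "(\<lambda>n. real n / (real (p n + d n) * (real (d n))\<^sup>2)) \<longlonglongrightarrow> 0"
    "(\<lambda>n. (real (p n) + 1) / real n powr (3/8)) \<longlonglongrightarrow> 0"
proof
  define P Q where "P n = real n powr (9/25)" and "Q n = real n powr (33/100)" for n :: nat
  define p d where "p n = nat \<lfloor>P n\<rfloor>" and "d n = Suc (nat \<lfloor>Q n\<rfloor>)" for n :: nat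
  have P0: "0 \<le> P n" "0 \<le> Q n" for n by (auto simp: P_def Q_def)
  have b: "real (p n) \<le> P n" "P n \<le> real (p n) + 1" "real (d n) \<le> Q n + 1" "Q n \<le> real (d n)" for n
    using P0[of n] of_int_floor_le[of "P n"] of_int_floor_le[of "Q n"] real_of_int_floor_add_one_ge[of "P n"] real_of_int_floor_add_one_ge[of "Q n"]
    by (simp_all add: p_def d_def of_nat_nat add.commute)
  show d1: "1 \<le> d n" for n by (simp add: d_def)
  have pd: "P n \<le> real (p n + d n)" for n
    using b(2)[of n] by (simp add: d_def)
  have ev: "\<forall>\<^sub>F n in sequentially. 0 < P n \<and> 0 < Q n"
    using eventually_gt_at_top[of 0] by eventually_elim (auto simp: P_def Q_def)
  show "(\<lambda>n. real (p n + d n) / real n) \<longlonglongrightarrow> 0"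
  proof (rule tendsto_sandwich[OF always_eventually always_eventually tendsto_const])
    show "(\<lambda>n. (P n + (Q n + 1)) / real n) \<longlonglongrightarrow> 0" unfolding P_def Q_def by real_asymp
  qed (use b in \<open>auto intro!: divide_right_mono add_mono\<close>)
  show "(\<lambda>n. real (d n) / real (p n + d n)) \<longlonglongrightarrow> 0"
  proof (rule tendsto_sandwich[OF always_eventually _ tendsto_const])
    show "\<forall>\<^sub>F n in sequentially. real (d n) / real (p n + d n) \<le> (Q n + 1) / P n"
      using ev
    proof eventually_elim
      fix n assume "0 < P n \<and> 0 < Q n"
      then show "real (d n) / real (p n + d n) \<le> (Q n + 1) / P n"
        using b[of n] pd[of n] P0[of n] by (intro frac_le) auto
    qed
    show "(\<lambda>n. (Q n + 1) / P n) \<longlonglongrightarrow> 0" unfolding P_def Q_def by real_asymp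
  qed auto
  show "(\<lambda>n. real n / (real (p n + d n) * (real (d n))\<^sup>2)) \<longlonglongrightarrow> 0"
  proof (rule tendsto_sandwich[OF always_eventually _ tendsto_const])
    show "\<forall>\<^sub>F n in sequentially. real n / (real (p n + d n) * (real (d n))\<^sup>2) \<le> real n / (P n * (Q n)\<^sup>2)"
      using ev
    proof eventually_elim
      fix n assume "0 < P n \<and> 0 < Q n"
      then show "real n / (real (p n + d n) * (real (d n))\<^sup>2) \<le> real n / (P n * (Q n)\<^sup>2)"
        using b[of n] pd[of n] P0[of n] by (intro frac_le mult_mono power_mono) auto
    qed
    show "(\<lambda>n. real n / (P n * (Q n)\<^sup>2)) \<longlonglongrightarrow> 0" unfolding P_def Q_def by real_asymp
  qed auto
  show "(\<lambda>n. (real (p n) + 1) / real n powr (3/8)) \<longlonglongrightarrow> 0"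
  proof (rule tendsto_sandwich[OF always_eventually always_eventually tendsto_const])
    show "(\<lambda>n. (P n + 1) / real n powr (3/8)) \<longlonglongrightarrow> 0" unfolding P_def by real_asymp
  qed (use b in \<open>auto intro!: divide_right_mono\<close>)
qed

text \<open>The upper bound comes from (1 - x + x^2) (1 + x) = 1 + x^3 >= 1 together with 1 + x <=
  exp x, the lower one from 1 - x <= exp (-x).\<close>

lemma exp_minus_le_quadratic:
  fixes x :: real
  assumes "0 \<le> x"
  shows "\<bar>exp (- x) - (1 - x)\<bar> \<le> x\<^sup>2"
proof -
  have "1 \<le> (1 - x + x\<^sup>2) * (1 + x)"
    using assms by (simp add: power2_eq_square algebra_simps)
  also have "\<dots> \<le> (1 - x + x\<^sup>2) * exp x"
  proof (rule mult_left_mono)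
    have "0 \<le> (1 - x / 2)\<^sup>2 + 3 / 4 * x\<^sup>2" by simp
    then show "0 \<le> 1 - x + x\<^sup>2" by (simp add: power2_eq_square algebra_simps)
  qed simp
  finally have "exp (- x) \<le> 1 - x + x\<^sup>2"
    by (simp add: exp_minus field_simps)
  moreover have "1 - x \<le> exp (- x)"
    using exp_ge_add_one_self[of "- x"] by simp
  ultimately show ?thesis by linarith
qed

context prob_space
begin

text \<open>A Taylor remainder of third order in which one factor |B| is replaced by its uniform
  bound. In use, \<open>C\<close> bounds a scaled block sum and tends to 0, which takes the place of
  a Lindeberg condition.\<close>

lemma iexp_second_order:
  assumes [measurable]: "B \<in> borel_measurable M" and B: "\<And>w. \<bar>B w\<bar> \<le> C" and z: "expectation B = 0"
  shows "cmod (expectation (\<lambda>w. iexp (B w)) - of_real (1 - expectation (\<lambda>w. (B w)\<^sup>2) / 2)) \<le> C * expectation (\<lambda>w. (B w)\<^sup>2)"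
proof -
  have i1: "integrable M B" by (rule integrable_bounded[of _ C]) (use B in auto)
  have i2: "integrable M (\<lambda>w. (B w)\<^sup>2)"
    using integrable_bounded_mult[of B B C C] B by (simp add: power2_eq_square)
  have ie: "integrable M (\<lambda>w. iexp (B w))" by (rule integrable_bounded[of _ 1]) auto
  define R where "R w = 1 - (B w)\<^sup>2 / 2" for w
  have iR: "integrable M R" and ER: "expectation R = 1 - expectation (\<lambda>w. (B w)\<^sup>2) / 2"
    unfolding R_def using i2 by (auto simp: prob_space)
  define Q where "Q w = complex_of_real (R w) + \<i> * complex_of_real (B w)" for w
  have iQ: "integrable M Q" unfolding Q_def using i1 iR by auto
  have EQ: "expectation Q = of_real (1 - expectation (\<lambda>w. (B w)\<^sup>2) / 2)"
    unfolding Q_def ER[symmetric] using i1 iR z by (subst Bochner_Integration.integral_add) auto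
  have le: "cmod (iexp (B w) - Q w) \<le> C * (B w)\<^sup>2" for w
  proof -
    have "cmod (iexp (B w) - Q w) \<le> \<bar>B w\<bar> ^ 3 / 6"
      using iexp_approx1[of "B w" 2] by (simp add: Q_def R_def numeral_eq_Suc algebra_simps)
    also have "\<dots> \<le> \<bar>B w\<bar> * (B w)\<^sup>2"
    proof -
      have "\<bar>B w\<bar> ^ 3 = \<bar>B w\<bar> * (B w)\<^sup>2" by (simp add: power3_eq_cube power2_eq_square)
      then show ?thesis by simp
    qed
    also have "\<dots> \<le> C * (B w)\<^sup>2" by (intro mult_right_mono B) auto
    finally show ?thesis .
  qed
  have "cmod (expectation (\<lambda>w. iexp (B w)) - expectation Q) = cmod (expectation (\<lambda>w. iexp (B w) - Q w))"
    using ie iQ by simp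
  also have "\<dots> \<le> expectation (\<lambda>w. cmod (iexp (B w) - Q w))" by (rule integral_norm_bound)
  also have "\<dots> \<le> expectation (\<lambda>w. C * (B w)\<^sup>2)"
    using ie iQ i2 le by (intro integral_mono) auto
  finally show ?thesis unfolding EQ by simp
qed

text \<open>\<open>iexp\<close> is 1-Lipschitz, and a nonnegative variance bounds the first absolute
  moment by the root of the second. This disposes of the indices outside the blocks.\<close>

lemma expectation_iexp_diff_le:
  assumes [measurable]: "Y \<in> borel_measurable M" "Z \<in> borel_measurable M"
    and b: "\<And>w. \<bar>Y w\<bar> \<le> C" "\<And>w. \<bar>Z w\<bar> \<le> D"
  shows "cmod (expectation (\<lambda>w. iexp (Y w)) - expectation (\<lambda>w. iexp (Z w))) \<le> sqrt (expectation (\<lambda>w. (Y w - Z w)\<^sup>2))"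
proof -
  have bd: "\<bar>Y w - Z w\<bar> \<le> C + D" for w using b[of w] by linarith
  have i: "integrable M (\<lambda>w. iexp (Y w))" "integrable M (\<lambda>w. iexp (Z w))"
    by (rule integrable_bounded[of _ 1]; auto)+
  have i1: "integrable M (\<lambda>w. Y w - Z w)" by (rule integrable_bounded[of _ "C + D"]) (use bd in auto)
  have i2: "integrable M (\<lambda>w. \<bar>Y w - Z w\<bar>\<^sup>2)"
    using integrable_bounded_mult[of "\<lambda>w. Y w - Z w" "\<lambda>w. Y w - Z w", OF _ _ bd bd] by (simp add: power2_eq_square)
  have lip: "cmod (iexp (Y w) - iexp (Z w)) \<le> \<bar>Y w - Z w\<bar>" for w
  proof -
    have "iexp (Y w) - iexp (Z w) = iexp (Z w) * (iexp (Y w - Z w) - 1)"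
      by (simp add: algebra_simps flip: exp_add)
    then have "cmod (iexp (Y w) - iexp (Z w)) = cmod (iexp (Y w - Z w) - 1)"
      by (simp add: norm_mult)
    then show ?thesis using iexp_approx1[of "Y w - Z w" 0] by simp
  qed
  have "cmod (expectation (\<lambda>w. iexp (Y w)) - expectation (\<lambda>w. iexp (Z w))) = cmod (expectation (\<lambda>w. iexp (Y w) - iexp (Z w)))"
    using i by simp
  also have "\<dots> \<le> expectation (\<lambda>w. cmod (iexp (Y w) - iexp (Z w)))" by (rule integral_norm_bound)
  also have "\<dots> \<le> expectation (\<lambda>w. \<bar>Y w - Z w\<bar>)"
    using i i1 lip by (intro integral_mono) auto
  also have "\<dots> \<le> sqrt (expectation (\<lambda>w. \<bar>Y w - Z w\<bar>\<^sup>2))"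
  proof (rule real_le_rsqrt)
    have "0 \<le> variance (\<lambda>w. \<bar>Y w - Z w\<bar>)" by simp
    then show "(expectation (\<lambda>w. \<bar>Y w - Z w\<bar>))\<^sup>2 \<le> expectation (\<lambda>w. \<bar>Y w - Z w\<bar>\<^sup>2)"
      using i1 i2 by (subst (asm) variance_eq) auto
  qed
  finally show ?thesis by simp
qed

end

section \<open>Variance of sums and the sum of the autocovariances\<close>

context reversible_chain
begin

lemma autocovariance_shift:
  assumes "bdd_borel g"
  shows "expectation (\<lambda>w. g (X i w) * g (X j w)) = expectation (\<lambda>w. g (X 0 w) * g (X (int (nat \<bar>i - j\<bar>)) w))"
proof (cases "i \<le> j")
  case True
  then have ij: "0 + i = i" "int (nat \<bar>i - j\<bar>) + i = j" by linarith+
  show ?thesis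
    using expectation_prod_shift[of g g 0 i "int (nat \<bar>i - j\<bar>)"] bdd_borel_measurable[OF assms] unfolding ij by blast
next
  case False
  then have ij: "0 + j = j" "int (nat \<bar>i - j\<bar>) + j = i" by linarith+
  show ?thesis
    using expectation_prod_shift[of g g 0 j "int (nat \<bar>i - j\<bar>)"] bdd_borel_measurable[OF assms] unfolding ij
    by (simp only: mult.commute)
qed

text \<open>After expanding the square, row i contains each lag k at most twice, at i - k and at i +
  k. The index set is arbitrary, so that one statement covers a block, the full sum and the
  scattered indices left over by the blocks.\<close>

lemma second_moment_sum:
  assumes g: "bdd_borel g" and I: "finite I" "\<And>i j. i \<in> I \<Longrightarrow> j \<in> I \<Longrightarrow> \<bar>i - j\<bar> \<le> int N"
  defines "\<gamma> \<equiv> \<lambda>k. expectation (\<lambda>w. g (X 0 w) * g (X (int k) w))"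
  shows "\<bar>expectation (\<lambda>w. (\<Sum>i\<in>I. g (X i w))\<^sup>2) - real (card I) * \<gamma> 0\<bar> \<le> real (card I) * (2 * (\<Sum>k=1..N. \<bar>\<gamma> k\<bar>))"
proof -
  have "expectation (\<lambda>w. (\<Sum>i\<in>I. g (X i w))\<^sup>2) = expectation (\<lambda>w. \<Sum>i\<in>I. \<Sum>j\<in>I. g (X i w) * g (X j w))"
    by (rule Bochner_Integration.integral_cong[OF refl]) (rule trans[OF power2_eq_square sum_product])
  also have "\<dots> = (\<Sum>i\<in>I. expectation (\<lambda>w. \<Sum>j\<in>I. g (X i w) * g (X j w)))"
    by (rule Bochner_Integration.integral_sum) (intro Bochner_Integration.integrable_sum integrable_bdd_borel_mult[OF g g])
  also have "\<dots> = (\<Sum>i\<in>I. \<Sum>j\<in>I. expectation (\<lambda>w. g (X i w) * g (X j w)))"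
    by (rule sum.cong[OF refl], rule Bochner_Integration.integral_sum) (rule integrable_bdd_borel_mult[OF g g])
  also have "\<dots> = (\<Sum>i\<in>I. \<Sum>j\<in>I. \<gamma> (nat \<bar>i - j\<bar>))"
    unfolding \<gamma>_def by (intro sum.cong refl autocovariance_shift g)
  also have "\<dots> = (\<Sum>i\<in>I. \<gamma> 0 + (\<Sum>j\<in>I - {i}. \<gamma> (nat \<bar>i - j\<bar>)))"
  proof (rule sum.cong)
    fix i assume i: "i \<in> I"
    have "\<gamma> (nat \<bar>i - i\<bar>) = \<gamma> 0" by (simp only: diff_self abs_zero nat_0)
    then show "(\<Sum>j\<in>I. \<gamma> (nat \<bar>i - j\<bar>)) = \<gamma> 0 + (\<Sum>j\<in>I - {i}. \<gamma> (nat \<bar>i - j\<bar>))"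
      using sum.remove[OF I(1) i, of "\<lambda>j. \<gamma> (nat \<bar>i - j\<bar>)"] by (simp only:)
  qed simp
  also have "\<dots> = real (card I) * \<gamma> 0 + (\<Sum>i\<in>I. \<Sum>j\<in>I - {i}. \<gamma> (nat \<bar>i - j\<bar>))"
    by (simp add: sum.distrib)
  finally have eq: "expectation (\<lambda>w. (\<Sum>i\<in>I. g (X i w))\<^sup>2) - real (card I) * \<gamma> 0 = (\<Sum>i\<in>I. \<Sum>j\<in>I - {i}. \<gamma> (nat \<bar>i - j\<bar>))"
    by simp
  have half: "(\<Sum>j\<in>K. \<bar>\<gamma> (f j)\<bar>) \<le> (\<Sum>k=1..N. \<bar>\<gamma> k\<bar>)" if "finite K" "inj_on f K" "f ` K \<subseteq> {1..N}" for K and f :: "int \<Rightarrow> nat"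
  proof -
    have "(\<Sum>j\<in>K. \<bar>\<gamma> (f j)\<bar>) = (\<Sum>k\<in>f ` K. \<bar>\<gamma> k\<bar>)"
      by (simp add: sum.reindex[OF that(2)])
    also have "\<dots> \<le> (\<Sum>k=1..N. \<bar>\<gamma> k\<bar>)" by (rule sum_mono2) (use that in auto)
    finally show ?thesis .
  qed
  have row: "(\<Sum>j\<in>I - {i}. \<bar>\<gamma> (nat \<bar>i - j\<bar>)\<bar>) \<le> 2 * (\<Sum>k=1..N. \<bar>\<gamma> k\<bar>)" if i: "i \<in> I" for i
  proof -
    have split: "I - {i} = {j\<in>I. j < i} \<union> {j\<in>I. i < j}" by auto
    have "(\<Sum>j\<in>I - {i}. \<bar>\<gamma> (nat \<bar>i - j\<bar>)\<bar>) =
        (\<Sum>j\<in>{j\<in>I. j < i}. \<bar>\<gamma> (nat \<bar>i - j\<bar>)\<bar>) + (\<Sum>j\<in>{j\<in>I. i < j}. \<bar>\<gamma> (nat \<bar>i - j\<bar>)\<bar>)"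
      unfolding split by (rule sum.union_disjoint) (use I(1) in auto)
    also have "\<dots> \<le> (\<Sum>k=1..N. \<bar>\<gamma> k\<bar>) + (\<Sum>k=1..N. \<bar>\<gamma> k\<bar>)"
    proof (intro add_mono half)
      show "inj_on (\<lambda>j. nat \<bar>i - j\<bar>) {j \<in> I. j < i}" "inj_on (\<lambda>j. nat \<bar>i - j\<bar>) {j \<in> I. i < j}"
        by (rule inj_onI, elim CollectE conjE, linarith)+
      have img: "nat \<bar>i - j\<bar> \<in> {1..N}" if "j \<in> I" "j \<noteq> i" for j
        unfolding atLeastAtMost_iff using I(2)[OF i that(1)] that(2) by linarith
      show "(\<lambda>j. nat \<bar>i - j\<bar>) ` {j \<in> I. j < i} \<subseteq> {1..N}" "(\<lambda>j. nat \<bar>i - j\<bar>) ` {j \<in> I. i < j} \<subseteq> {1..N}"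
        by (rule image_subsetI, rule img; force)+
    qed (use I(1) in auto)
    finally show ?thesis by simp
  qed
  have "\<bar>\<Sum>i\<in>I. \<Sum>j\<in>I - {i}. \<gamma> (nat \<bar>i - j\<bar>)\<bar> \<le> (\<Sum>i\<in>I. \<Sum>j\<in>I - {i}. \<bar>\<gamma> (nat \<bar>i - j\<bar>)\<bar>)"
    by (rule order_trans[OF sum_abs]) (intro sum_mono sum_abs)
  also have "\<dots> \<le> (\<Sum>i\<in>I. 2 * (\<Sum>k=1..N. \<bar>\<gamma> k\<bar>))" by (rule sum_mono) (rule row)
  finally show ?thesis unfolding eq by simp
qed

text \<open>By quasi-monotonicity each of the first m terms k * alpha_k is at least k * alpha_m / 4,
  and 1 + ... + m = m (m + 1) / 2; the constant 8 is 4 * 2.\<close>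

lemma alpha_mixing_le_inverse_square:
  assumes mixing: "summable (\<lambda>k. real (Suc k) * alpha_mixing M X (Suc k))" and m: "1 \<le> m"
  shows "alpha_mixing M X m \<le> 8 * (\<Sum>k. real (Suc k) * alpha_mixing M X (Suc k)) / (real m)\<^sup>2"
proof -
  have gauss: "(\<Sum>k<m. real (Suc k)) = real m * (real m + 1) / 2"
    by (induction m) (auto simp: field_simps)
  have "alpha_mixing M X m / 4 * (real m * (real m + 1) / 2) = (\<Sum>k<m. real (Suc k) * (alpha_mixing M X m / 4))"
    unfolding gauss[symmetric] sum_distrib_right[symmetric] by simp
  also have "\<dots> \<le> (\<Sum>k<m. real (Suc k) * alpha_mixing M X (Suc k))"
  proof (intro sum_mono mult_left_mono)
    fix k assume "k \<in> {..<m}"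
    then show "alpha_mixing M X m / 4 \<le> alpha_mixing M X (Suc k)"
      using alpha_mixing_quasi_antimono[of "Suc k" m] by simp
  qed simp
  also have "\<dots> \<le> (\<Sum>k. real (Suc k) * alpha_mixing M X (Suc k))"
    by (rule sum_le_suminf[OF mixing]) (auto simp: alpha_mixing_nonneg)
  finally have *: "alpha_mixing M X m * (real m * (real m + 1)) \<le> 8 * (\<Sum>k. real (Suc k) * alpha_mixing M X (Suc k))"
    by simp
  have "alpha_mixing M X m * (real m)\<^sup>2 \<le> alpha_mixing M X m * (real m * (real m + 1))"
    by (intro mult_left_mono alpha_mixing_nonneg) (auto simp: power2_eq_square algebra_simps)
  with * m show ?thesis by (simp add: field_simps)
qed

text \<open>Beyond the cut-off, alpha_k <= k * alpha_k / (m + 1), so the mixing bound gains the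
  factor 1 / (m + 1) that makes up for a \<open>C\<close> independent of the bandwidth. The cut-off
  \<open>m\<close> and the weight \<open>r\<close> are left free for a later balance.\<close>

lemma autocovariance_sum_le:
  assumes mixing: "summable (\<lambda>k. real (Suc k) * alpha_mixing M X (Suc k))"
    and g: "g \<in> borel_measurable borel" "\<And>x. \<bar>g x\<bar> \<le> C" "0 < C" and z: "expectation (\<lambda>w. g (X 0 w)) = 0"
    and r: "0 < r"
  defines "\<gamma> \<equiv> \<lambda>k. expectation (\<lambda>w. g (X 0 w) * g (X (int k) w))"
  shows "(\<Sum>k=1..N. \<bar>\<gamma> k\<bar>) \<le> (r * \<gamma> 0 + \<gamma> 2 / r) / 2 + real m * \<gamma> 2 +
    4 * C\<^sup>2 * (\<Sum>k. real (Suc (k + m)) * alpha_mixing M X (Suc (k + m))) / real (Suc m)"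
proof -
  have bg: "bdd_borel g" using g by (auto intro: bdd_borelI)
  define a where "a k = real (Suc k) * alpha_mixing M X (Suc k)" for k
  define \<tau> where "\<tau> = (\<Sum>k. a (k + m))"
  have a0: "0 \<le> a k" for k by (simp add: a_def alpha_mixing_nonneg)
  have sa: "summable (\<lambda>k. a (k + m))" using mixing by (subst summable_iff_shift) (simp add: a_def[abs_def])
  define H where "H = (r * \<gamma> 0 + \<gamma> 2 / r) / 2"
  \<comment> \<open>A majorant with one summand for each range of lags. The first two ranges overlap
    at lag 1, which is harmless since all summands are nonnegative. \<open>a (k - 1)\<close> is k
    times the mixing coefficient at k, because \<open>a\<close> counts from 0.\<close>
  define h where "h k = (if k = 1 then H else 0) + (if k \<in> {1..m} then \<gamma> 2 else 0)
     + (if m < k then 4 * C\<^sup>2 * (a (k - 1) / real (Suc m)) else 0)" for k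
  have \<gamma>2: "0 \<le> \<gamma> 2" "0 \<le> \<gamma> 0"
    using abs_autocovariance_le_lag2[OF bg, of 2] by (auto simp: \<gamma>_def)
  have h0: "0 \<le> H" using \<gamma>2 r by (auto simp: H_def)
  have h1: "0 \<le> 4 * C\<^sup>2 * (a (k - 1) / real (Suc m))" for k
    by (intro mult_nonneg_nonneg divide_nonneg_nonneg a0) auto
  have le: "\<bar>\<gamma> k\<bar> \<le> h k" if k: "1 \<le> k" for k
  proof -
    consider "k = 1" | "2 \<le> k" "k \<le> m" | "m < k" using k by linarith
    then show ?thesis
    proof cases
      case 1
      then show ?thesis
      proof -
        have "\<bar>\<gamma> 1\<bar> \<le> H"
          using abs_autocovariance_lag1_le[OF bg r] by (simp add: H_def \<gamma>_def power2_eq_square)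
        moreover have "H \<le> h k"
          unfolding h_def using 1 \<gamma>2(1) h1[of k] by auto
        ultimately show ?thesis using 1 by simp
      qed
    next
      case 2
      then show ?thesis
        using abs_autocovariance_le_lag2[OF bg 2(1)] by (auto simp: h_def \<gamma>_def)
    next
      case 3
      have "real (Suc m) * alpha_mixing M X k \<le> real k * alpha_mixing M X k"
        using 3 by (intro mult_right_mono alpha_mixing_nonneg) auto
      then have "alpha_mixing M X k \<le> a (k - 1) / real (Suc m)"
        using k by (simp add: a_def field_simps)
      then have "4 * C\<^sup>2 * alpha_mixing M X k \<le> 4 * C\<^sup>2 * (a (k - 1) / real (Suc m))"
        by (intro mult_left_mono) auto
      moreover have "\<bar>\<gamma> k\<bar> \<le> 4 * C\<^sup>2 * alpha_mixing M X k"
        unfolding \<gamma>_def by (rule covariance_le_alpha_mixing_scaled[OF g z])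
      ultimately show ?thesis using 3 h0 by (auto simp: h_def)
    qed
  qed
  have "(\<Sum>k=1..N. \<bar>\<gamma> k\<bar>) \<le> (\<Sum>k=1..N. h k)" by (rule sum_mono) (use le in auto)
  also have "\<dots> = (\<Sum>k=1..N. if k = 1 then H else 0) + (\<Sum>k=1..N. if k \<in> {1..m} then \<gamma> 2 else 0)
     + (\<Sum>k=1..N. if m < k then 4 * C\<^sup>2 * (a (k - 1) / real (Suc m)) else 0)"
    unfolding h_def by (simp only: sum.distrib)
  also have "\<dots> \<le> H + real m * \<gamma> 2 + 4 * C\<^sup>2 * (\<tau> / real (Suc m))"
  proof (intro add_mono)
    show "(\<Sum>k=1..N. if k = 1 then H else 0) \<le> H"
      using h0 by (simp add: sum.delta)
    have "(\<Sum>k=1..N. if k \<in> {1..m} then \<gamma> 2 else 0) = (\<Sum>k\<in>{1..N} \<inter> {1..m}. \<gamma> 2)"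
      by (rule sum.inter_restrict[symmetric]) simp
    also have "\<dots> \<le> (\<Sum>k=1..m. \<gamma> 2)" by (rule sum_mono2) (use \<gamma>2 in auto)
    finally show "(\<Sum>k=1..N. if k \<in> {1..m} then \<gamma> 2 else 0) \<le> real m * \<gamma> 2" by simp
    have "(\<Sum>k=1..N. if m < k then 4 * C\<^sup>2 * (a (k - 1) / real (Suc m)) else 0) =
        (\<Sum>k\<in>{1..N} \<inter> {k. m < k}. 4 * C\<^sup>2 * (a (k - 1) / real (Suc m)))"
      by (simp only: sum.inter_restrict finite_atLeastAtMost mem_Collect_eq)
    also have "\<dots> \<le> (\<Sum>k\<in>{Suc m..<Suc m + N}. 4 * C\<^sup>2 * (a (k - 1) / real (Suc m)))"
      by (rule sum_mono2) (use h1 in auto)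
    also have "\<dots> = (\<Sum>k<N. 4 * C\<^sup>2 * (a (k + m) / real (Suc m)))"
      by (rule sum.reindex_bij_witness[of _ "\<lambda>k. k + Suc m" "\<lambda>k. k - Suc m"]) auto
    also have "\<dots> = 4 * C\<^sup>2 * ((\<Sum>k<N. a (k + m)) / real (Suc m))"
      by (simp add: sum_distrib_left sum_divide_distrib)
    also have "\<dots> \<le> 4 * C\<^sup>2 * (\<tau> / real (Suc m))"
      unfolding \<tau>_def by (intro mult_left_mono divide_right_mono sum_le_suminf sa) (use a0 in auto)
    finally show "(\<Sum>k=1..N. if m < k then 4 * C\<^sup>2 * (a (k - 1) / real (Suc m)) else 0) \<le> 4 * C\<^sup>2 * (\<tau> / real (Suc m))" .
  qed
  finally show ?thesis by (simp add: \<tau>_def a_def H_def)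
qed

end

section \<open>A central limit theorem for triangular arrays\<close>

context reversible_chain
begin

text \<open>With a cut-off of about eps / b, the lags from 2 to the cut-off contribute at most eps *
  D * b, and the lags beyond it a multiple of tau * b / eps with tau the tail of a convergent
  series. For fixed eps this tail vanishes as the cut-off grows, and eps is arbitrary.\<close>

lemma autocovariance_sum_negligible:
  fixes g :: "nat \<Rightarrow> real \<Rightarrow> real" and b :: "nat \<Rightarrow> real"
  assumes mixing: "summable (\<lambda>k. real (Suc k) * alpha_mixing M X (Suc k))"
    and b: "\<forall>n\<ge>1. 0 < b n" "b \<longlonglongrightarrow> 0"
    and g: "\<And>n. g n \<in> borel_measurable borel" "\<And>n x. \<bar>g n x\<bar> \<le> C" "0 < C"
    and z: "\<And>n. expectation (\<lambda>w. g n (X 0 w)) = 0"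
    and var: "(\<lambda>n. expectation (\<lambda>w. g n (X 0 w) * g n (X 0 w)) / b n) \<longlonglongrightarrow> s"
    and lag2: "\<forall>\<^sub>F n in sequentially. expectation (\<lambda>w. g n (X 0 w) * g n (X 2 w)) \<le> D * (b n)\<^sup>2" and D: "0 < D"
  shows "(\<lambda>n. (\<Sum>k=1..n. \<bar>expectation (\<lambda>w. g n (X 0 w) * g n (X (int k) w))\<bar>) / b n) \<longlonglongrightarrow> 0"
proof -
  define \<gamma> where "\<gamma> n k = expectation (\<lambda>w. g n (X 0 w) * g n (X (int k) w))" for n k
  define a where "a k = real (Suc k) * alpha_mixing M X (Suc k)" for k
  define \<tau> where "\<tau> m = (\<Sum>k. a (k + m))" for m
  have sa: "summable a" using mixing by (simp add: a_def[abs_def])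
  have "(\<lambda>m. suminf a - (\<Sum>i<m. a i)) \<longlonglongrightarrow> suminf a - suminf a"
    by (intro tendsto_intros summable_LIMSEQ sa)
  then have \<tau>: "\<tau> \<longlonglongrightarrow> 0"
    unfolding \<tau>_def[abs_def] suminf_minus_initial_segment[OF sa] by simp
  have \<tau>0: "0 \<le> \<tau> m" for m
    unfolding \<tau>_def
    by (intro suminf_nonneg summable_ignore_initial_segment[OF sa]) (simp add: a_def alpha_mixing_nonneg)
  have main: "\<forall>\<^sub>F n in sequentially. (\<Sum>k=1..n. \<bar>\<gamma> n k\<bar>) / b n < e" if e: "0 < e" for e
  proof -
    \<comment> \<open>This makes \<epsilon> * D equal to half of \<open>e\<close>; the other terms
      of \<open>R\<close> below tend to 0.\<close>
    define \<epsilon> where "\<epsilon> = e / (2 * D)"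
    have \<epsilon>: "0 < \<epsilon>" "\<epsilon> * D < e" using e D by (auto simp: \<epsilon>_def field_simps)
    define m where "m n = nat \<lfloor>\<epsilon> / b n\<rfloor>" for n
    have m: "filterlim m at_top sequentially"
      unfolding filterlim_at_top
    proof
      fix k :: nat
      have "\<forall>\<^sub>F n in sequentially. b n < \<epsilon> / (real k + 1)"
        by (rule order_tendstoD(2)[OF b(2)]) (use \<epsilon> in auto)
      then show "\<forall>\<^sub>F n in sequentially. k \<le> m n"
        using eventually_ge_at_top[of 1]
      proof eventually_elim
        case (elim n)
        then have "real k + 1 < \<epsilon> / b n" using b(1) by (simp add: field_simps)
        then show ?case unfolding m_def by linarith
      qed
    qed
    \<comment> \<open>The bound of \<open>autocovariance_sum_le\<close> for the weight
      \<open>sqrt (b n)\<close>, divided by \<open>b n\<close>: both lag 1 terms become O(sqrt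
      b).\<close>
    define R where "R n = sqrt (b n) * (\<gamma> n 0 / b n) / 2 + D * sqrt (b n) / 2 + \<epsilon> * D + 4 * C\<^sup>2 * (\<tau> (m n) / \<epsilon>)" for n
    have "R \<longlonglongrightarrow> sqrt 0 * s / 2 + D * sqrt 0 / 2 + \<epsilon> * D + 4 * C\<^sup>2 * (0 / \<epsilon>)"
      unfolding R_def[abs_def] using var
      by (intro tendsto_intros b(2) filterlim_compose[OF \<tau> m]) (use \<epsilon> in \<open>auto simp: \<gamma>_def\<close>)
    then have "\<forall>\<^sub>F n in sequentially. R n < e"
      by (intro order_tendstoD(2)) (use \<epsilon> in auto)
    then show ?thesis
      using lag2 eventually_ge_at_top[of 1]
    proof eventually_elim
      case (elim n)
      have bn: "0 < b n" using b(1) elim(3) by simp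
      have l2: "\<gamma> n 2 \<le> D * (b n)\<^sup>2" using elim(2) by (simp add: \<gamma>_def)
      have l00: "0 \<le> \<gamma> n 0" by (simp add: \<gamma>_def)
      have l20: "0 \<le> \<gamma> n 2"
        using abs_autocovariance_le_lag2[of "g n" 2] bdd_borelI[OF g(1,2), of n] by (simp add: \<gamma>_def)
      have sq: "sqrt (b n) * sqrt (b n) = b n" using bn by simp
      have "(\<Sum>k=1..n. \<bar>\<gamma> n k\<bar>) \<le> (sqrt (b n) * \<gamma> n 0 + \<gamma> n 2 / sqrt (b n)) / 2 + real (m n) * \<gamma> n 2 +
          4 * C\<^sup>2 * \<tau> (m n) / real (Suc (m n))"
        using autocovariance_sum_le[OF mixing g(1) g(2) g(3) z, of "sqrt (b n)" n n "m n"] bn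
        by (simp add: \<gamma>_def \<tau>_def a_def)
      also have "\<dots> \<le> (sqrt (b n) * \<gamma> n 0 + D * (b n)\<^sup>2 / sqrt (b n)) / 2 + (\<epsilon> / b n) * (D * (b n)\<^sup>2) +
          4 * C\<^sup>2 * \<tau> (m n) / (\<epsilon> / b n)"
      proof -
        have "real (m n) \<le> \<epsilon> / b n" "\<epsilon> / b n \<le> real (Suc (m n))"
          unfolding m_def using \<epsilon>(1) bn by (simp_all add: of_nat_nat) linarith
        then show ?thesis using l2 l20 l00 bn \<epsilon>(1) \<tau>0[of "m n"]
          by (intro add_mono divide_right_mono mult_mono frac_le) auto
      qed
      also have "\<dots> = R n * b n"
      proof -
        have "D * (b n)\<^sup>2 / sqrt (b n) = D * sqrt (b n) * b n"
          using bn by (simp add: field_simps power2_eq_square)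
        then show ?thesis using bn \<epsilon>(1)
          by (simp add: R_def field_simps power2_eq_square)
      qed
      finally have "(\<Sum>k=1..n. \<bar>\<gamma> n k\<bar>) / b n \<le> R n" using bn by (simp add: field_simps)
      with elim(1) show ?case by simp
    qed
  qed
  have "(\<lambda>n. (\<Sum>k=1..n. \<bar>\<gamma> n k\<bar>) / b n) \<longlonglongrightarrow> 0"
  proof (rule order_tendstoI)
    fix e :: real assume e: "e < 0"
    show "\<forall>\<^sub>F n in sequentially. e < (\<Sum>k=1..n. \<bar>\<gamma> n k\<bar>) / b n"
      using eventually_ge_at_top[of 1]
    proof eventually_elim
      case (elim n)
      have "0 \<le> (\<Sum>k=1..n. \<bar>\<gamma> n k\<bar>) / b n"
        using b(1) elim by (intro divide_nonneg_nonneg sum_nonneg) (auto intro: less_imp_le)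
      with e show ?case by linarith
    qed
  qed (rule main)
  then show ?thesis by (simp add: \<gamma>_def)
qed

lemma sum_block_eq: "(\<Sum>i\<le>p. f (c + int i)) = (\<Sum>k\<in>{c..c + int p}. f k)"
  by (rule sum.reindex_bij_witness[of _ "\<lambda>k. nat (k - c)" "\<lambda>i. c + int i"]) auto

text \<open>The block is compared with a sum of independent terms of variance
  \<open>\<gamma> 0\<close>. The error consists of the Taylor remainder, the off-diagonal
  covariances and the distance of exp (-x) from 1 - x.\<close>

lemma block_estimate:
  fixes g :: "real \<Rightarrow> real" and p N :: nat
  assumes g: "g \<in> borel_measurable borel" "\<And>x. \<bar>g x\<bar> \<le> C" and z: "expectation (\<lambda>w. g (X 0 w)) = 0"
    and \<theta>: "0 \<le> \<theta>" and p: "p \<le> N"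
  defines "\<gamma> \<equiv> \<lambda>k. expectation (\<lambda>w. g (X 0 w) * g (X (int k) w))"
  defines "S \<equiv> \<Sum>k=1..N. \<bar>\<gamma> k\<bar>"
  defines "P \<equiv> real (p + 1)"
  shows "cmod (expectation (\<lambda>w. \<Prod>i\<le>p. iexp (\<theta> * g (X (c + int i) w))) - of_real (exp (- (P * \<theta>\<^sup>2 * \<gamma> 0 / 2))))
    \<le> P * C * \<theta> * (P * \<theta>\<^sup>2 * (\<gamma> 0 + 2 * S)) + P * \<theta>\<^sup>2 * S + (P * \<theta>\<^sup>2 * \<gamma> 0 / 2)\<^sup>2"
proof -
  have bg: "bdd_borel g" using g by (rule bdd_borelI)
  have [measurable]: "g \<in> borel_measurable borel" by fact
  define B where "B w = \<theta> * (\<Sum>k\<in>{c..c + int p}. g (X k w))" for w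
  have C0: "0 \<le> C" by (rule order_trans[OF abs_ge_zero g(2)])
  have S0: "0 \<le> S" unfolding S_def by (rule sum_nonneg) simp
  have P0: "0 \<le> P" by (simp add: P_def)
  have \<gamma>0: "0 \<le> \<gamma> 0" by (simp add: \<gamma>_def)
  have Bm[measurable]: "B \<in> borel_measurable M" unfolding B_def by measurable
  have prod: "(\<Prod>i\<le>p. iexp (\<theta> * g (X (c + int i) w))) = iexp (B w)" for w
    unfolding B_def by (simp add: sum_block_eq[symmetric, of _ c p] sum_distrib_left exp_sum[symmetric])
  have card: "real (card {c..c + int p}) = P" by (simp add: P_def)
  have Bb: "\<bar>B w\<bar> \<le> P * C * \<theta>" for w
  proof -
    have "\<bar>\<Sum>k\<in>{c..c + int p}. g (X k w)\<bar> \<le> (\<Sum>k\<in>{c..c + int p}. C)"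
      by (rule order_trans[OF sum_abs]) (intro sum_mono g)
    also have "\<dots> = P * C" by (simp only: sum_constant card)
    finally have "\<bar>\<Sum>k\<in>{c..c + int p}. g (X k w)\<bar> \<le> P * C" .
    from mult_left_mono[OF this \<theta>] show ?thesis
      unfolding B_def abs_mult abs_of_nonneg[OF \<theta>] by (simp only: mult.commute mult.left_commute)
  qed
  have EB: "expectation B = 0"
    unfolding B_def using integrable_bdd_borel[OF bg] expectation_shift[OF g(1)] z
    by (simp add: Bochner_Integration.integral_sum)
  define v where "v = expectation (\<lambda>w. (B w)\<^sup>2)"
  have "v = \<theta>\<^sup>2 * expectation (\<lambda>w. (\<Sum>k\<in>{c..c + int p}. g (X k w))\<^sup>2)"
    unfolding v_def B_def power_mult_distrib by simp
  moreover have m2: "\<bar>expectation (\<lambda>w. (\<Sum>k\<in>{c..c + int p}. g (X k w))\<^sup>2) - P * \<gamma> 0\<bar> \<le> P * (2 * S)"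
  proof -
    have "\<bar>i - j\<bar> \<le> int N" if "i \<in> {c..c + int p}" "j \<in> {c..c + int p}" for i j
    proof -
      have "int p \<le> int N" using p by simp
      with that show ?thesis unfolding atLeastAtMost_iff by linarith
    qed
    from second_moment_sum[where g = g and I = "{c..c + int p}" and N = N, OF bg finite_atLeastAtMost_int this] show ?thesis
      unfolding card \<gamma>_def S_def by simp
  qed
  ultimately have vv: "v - P * \<theta>\<^sup>2 * \<gamma> 0 = \<theta>\<^sup>2 * (expectation (\<lambda>w. (\<Sum>k\<in>{c..c + int p}. g (X k w))\<^sup>2) - P * \<gamma> 0)"
    by (simp add: algebra_simps)
  have "\<bar>v - P * \<theta>\<^sup>2 * \<gamma> 0\<bar> = \<theta>\<^sup>2 * \<bar>expectation (\<lambda>w. (\<Sum>k\<in>{c..c + int p}. g (X k w))\<^sup>2) - P * \<gamma> 0\<bar>"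
    unfolding vv abs_mult by simp
  also have "\<dots> \<le> \<theta>\<^sup>2 * (P * (2 * S))" by (rule mult_left_mono[OF m2]) simp
  also have "\<dots> = 2 * (P * \<theta>\<^sup>2 * S)" by simp
  finally have v: "\<bar>v - P * \<theta>\<^sup>2 * \<gamma> 0\<bar> \<le> 2 * (P * \<theta>\<^sup>2 * S)" .
  then have v2: "v \<le> P * \<theta>\<^sup>2 * (\<gamma> 0 + 2 * S)" by (simp add: algebra_simps abs_le_iff)
  let ?x = "P * \<theta>\<^sup>2 * \<gamma> 0 / 2"
  have x0: "0 \<le> ?x" using P0 \<gamma>0 by simp
  have "cmod (expectation (\<lambda>w. iexp (B w)) - of_real (1 - v / 2)) \<le> P * C * \<theta> * v"
    unfolding v_def by (rule iexp_second_order[OF Bm Bb EB])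
  also have "\<dots> \<le> P * C * \<theta> * (P * \<theta>\<^sup>2 * (\<gamma> 0 + 2 * S))"
    using v2 P0 C0 \<theta> by (intro mult_left_mono) auto
  finally have 1: "cmod (expectation (\<lambda>w. iexp (B w)) - of_real (1 - v / 2)) \<le> P * C * \<theta> * (P * \<theta>\<^sup>2 * (\<gamma> 0 + 2 * S))" .
  have "\<bar>(1 - v / 2) - exp (- ?x)\<bar> \<le> P * \<theta>\<^sup>2 * S + ?x\<^sup>2"
    using exp_minus_le_quadratic[OF x0] v unfolding abs_le_iff by linarith
  then have 2: "cmod (of_real (1 - v / 2) - of_real (exp (- ?x))) \<le> P * \<theta>\<^sup>2 * S + ?x\<^sup>2"
    by (simp only: flip: of_real_diff) (simp only: norm_of_real)
  show ?thesis
    unfolding prod using norm_triangle_le[OF add_mono[OF 1 2]] by (simp add: algebra_simps)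
qed

text \<open>The three summands are the mean square of the terms outside the blocks, \<open>m\<close>
  decoupling steps, and \<open>m\<close> times the error of one block. The difference of
  \<open>n\<close> and m * P counts the indices in the gaps and in the final incomplete
  stretch.\<close>

lemma bernstein_block_estimate:
  fixes g :: "real \<Rightarrow> real" and n p d :: nat
  assumes g: "g \<in> borel_measurable borel" "\<And>x. \<bar>g x\<bar> \<le> C" and z: "expectation (\<lambda>w. g (X 0 w)) = 0"
    and \<theta>: "0 \<le> \<theta>" and d: "1 \<le> d"
  defines "\<gamma> \<equiv> \<lambda>k. expectation (\<lambda>w. g (X 0 w) * g (X (int k) w))"
  defines "S \<equiv> \<Sum>k=1..n. \<bar>\<gamma> k\<bar>"
  defines "P \<equiv> real (p + 1)"
  defines "m \<equiv> n div (p + d)"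
  shows "cmod (expectation (\<lambda>w. iexp (\<theta> * (\<Sum>k=1..n. g (X (int k) w)))) - of_real (exp (- (real m * P * \<theta>\<^sup>2 * \<gamma> 0 / 2))))
    \<le> sqrt (\<theta>\<^sup>2 * ((real n - real m * P) * (\<gamma> 0 + 2 * S))) + real m * (16 * alpha_mixing M X d)
      + real m * (P * C * \<theta> * (P * \<theta>\<^sup>2 * (\<gamma> 0 + 2 * S)) + P * \<theta>\<^sup>2 * S + (P * \<theta>\<^sup>2 * \<gamma> 0 / 2)\<^sup>2)"
proof -
  have bg: "bdd_borel g" using g by (rule bdd_borelI)
  have [measurable]: "g \<in> borel_measurable borel" by fact
  have C0: "0 \<le> C" by (rule order_trans[OF abs_ge_zero g(2)])
  define L where "L = p + d"
  have pL: "p < L" using d by (simp add: L_def)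
  \<comment> \<open>The indices that lie in blocks. Since p < L, division by \<open>L\<close>
    recovers the block and the position in it, whence injectivity.\<close>
  define J where "J = (\<lambda>(j, i). int (j * L) + 1 + int i) ` ({..<m} \<times> {..p})"
  have inj: "inj_on (\<lambda>(j, i). int (j * L) + 1 + int i) ({..<m} \<times> {..p})"
  proof (rule inj_onI)
    fix x y assume xy: "x \<in> {..<m} \<times> {..p}" "y \<in> {..<m} \<times> {..p}"
      "(\<lambda>(j, i). int (j * L) + 1 + int i) x = (\<lambda>(j, i). int (j * L) + 1 + int i) y"
    obtain j i j' i' where [simp]: "x = (j, i)" "y = (j', i')" by (cases x, cases y)
    have "i \<in> {..p}" "i' \<in> {..p}" and eq: "int (j * L) + 1 + int i = int (j' * L) + 1 + int i'"
      using xy by simp_all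
    then have l: "i < L" "i' < L" using pL by auto
    from eq have "int (j * L + i) = int (j' * L + i')" by linarith
    then have eq: "j * L + i = j' * L + i'" by (simp only: of_nat_eq_iff)
    from arg_cong[OF eq, of "\<lambda>x. x div L"] arg_cong[OF eq, of "\<lambda>x. x mod L"] l
    show "x = y" by simp
  qed
  have cardJ: "card J = m * (p + 1)"
    unfolding J_def card_image[OF inj] by simp
  have mL: "m * L \<le> n" unfolding m_def L_def by simp
  have Jsub: "J \<subseteq> {1..int n}"
  proof
    fix x assume "x \<in> J"
    then obtain j i where ji: "j < m" "i \<le> p" "x = int (j * L) + 1 + int i" by (auto simp: J_def)
    have "Suc j * L \<le> m * L" using ji(1) by (intro mult_le_mono1) simp
    then have "j * L + 1 + i \<le> n" using mL ji(2) pL by simp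
    then have "int (j * L) + 1 + int i \<le> int n" by linarith
    then show "x \<in> {1..int n}" unfolding ji(3) by simp
  qed
  have finJ: "finite J" by (rule finite_subset[OF Jsub]) simp
  have P_nn: "real m * P = real (card J)" unfolding cardJ P_def by (rule of_nat_mult[symmetric])
  have "card J \<le> n" using card_mono[OF _ Jsub] by simp
  define I where "I = {1..int n} - J"
  have cardI: "real (card I) = real n - real m * P"
    unfolding I_def P_nn using card_Diff_subset[OF finJ Jsub] \<open>card J \<le> n\<close> by (simp add: of_nat_diff)
  have sumn: "(\<Sum>k=1..n. g (X (int k) w)) = (\<Sum>k\<in>{1..int n}. g (X k w))" for w
    by (rule sum.reindex_bij_witness[of _ nat int]) auto
  define Y where "Y w = \<theta> * (\<Sum>k\<in>{1..int n}. g (X k w))" for w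
  define Z where "Z w = \<theta> * (\<Sum>k\<in>J. g (X k w))" for w
  have YZ: "Y w - Z w = \<theta> * (\<Sum>k\<in>I. g (X k w))" for w
    unfolding Y_def Z_def I_def by (simp add: sum_diff[OF _ Jsub] algebra_simps)
  have bound: "\<bar>\<theta> * (\<Sum>k\<in>K. g (X k w))\<bar> \<le> \<theta> * (real (card K) * C)" for K w
    unfolding abs_mult using \<theta> order_trans[OF sum_abs sum_bounded_above[of K "\<lambda>k. \<bar>g (X k w)\<bar>" C]] g(2)
    by (simp add: mult_left_mono)
  have Ym[measurable]: "Y \<in> borel_measurable M" and Zm[measurable]: "Z \<in> borel_measurable M"
    unfolding Y_def Z_def by measurable
  have "cmod (expectation (\<lambda>w. iexp (Y w)) - expectation (\<lambda>w. iexp (Z w))) \<le> sqrt (expectation (\<lambda>w. (Y w - Z w)\<^sup>2))"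
    by (rule expectation_iexp_diff_le[OF Ym Zm]) (unfold Y_def Z_def, (rule bound)+)
  also have "\<dots> \<le> sqrt (\<theta>\<^sup>2 * ((real n - real m * P) * (\<gamma> 0 + 2 * S)))"
  proof (rule real_sqrt_le_mono)
    have "expectation (\<lambda>w. (Y w - Z w)\<^sup>2) = \<theta>\<^sup>2 * expectation (\<lambda>w. (\<Sum>k\<in>I. g (X k w))\<^sup>2)"
      unfolding YZ power_mult_distrib by simp
    moreover have "expectation (\<lambda>w. (\<Sum>k\<in>I. g (X k w))\<^sup>2) \<le> real (card I) * (\<gamma> 0 + 2 * S)"
    proof -
      have fI: "finite I" unfolding I_def by simp
      have "\<bar>i - j\<bar> \<le> int n" if "i \<in> I" "j \<in> I" for i j
        using that unfolding I_def Diff_iff atLeastAtMost_iff by linarith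
      from second_moment_sum[OF bg fI this] show ?thesis
        unfolding \<gamma>_def S_def by (simp add: algebra_simps abs_le_iff)
    qed
    ultimately show "expectation (\<lambda>w. (Y w - Z w)\<^sup>2) \<le> \<theta>\<^sup>2 * ((real n - real m * P) * (\<gamma> 0 + 2 * S))"
      unfolding cardI by (simp add: mult_left_mono)
  qed
  finally have 1: "cmod (expectation (\<lambda>w. iexp (Y w)) - expectation (\<lambda>w. iexp (Z w)))
    \<le> sqrt (\<theta>\<^sup>2 * ((real n - real m * P) * (\<gamma> 0 + 2 * S)))" .
  define h where "h x = iexp (\<theta> * g x)" for x
  have h[measurable]: "h \<in> borel_measurable borel" unfolding h_def by measurable
  have hb: "cmod (h x) \<le> 1" for x by (simp add: h_def)
  define V where "V j w = (\<Prod>i\<le>p. h (X (int (j * (p + d)) + 1 + int i) w))" for j w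
  have "(\<Sum>k\<in>J. g (X k w)) = (\<Sum>j<m. \<Sum>i\<le>p. g (X (int (j * L) + 1 + int i) w))" for w
    unfolding J_def sum.reindex[OF inj] sum.cartesian_product
    by (rule sum.cong) auto
  then have ZV: "iexp (Z w) = (\<Prod>j<m. V j w)" for w
    unfolding Z_def V_def h_def L_def[symmetric] by (simp add: sum_distrib_left exp_sum)
  have 2: "cmod (expectation (\<lambda>w. iexp (Z w)) - (\<Prod>j<m. expectation (V j))) \<le> real m * (16 * alpha_mixing M X d)"
    unfolding ZV V_def by (rule block_decoupling[OF h hb])
  let ?e = "of_real (exp (- (P * \<theta>\<^sup>2 * \<gamma> 0 / 2))) :: complex"
  let ?E = "P * C * \<theta> * (P * \<theta>\<^sup>2 * (\<gamma> 0 + 2 * S)) + P * \<theta>\<^sup>2 * S + (P * \<theta>\<^sup>2 * \<gamma> 0 / 2)\<^sup>2"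
  have "cmod ((\<Prod>j<m. expectation (V j)) - (\<Prod>j<m. ?e)) \<le> (\<Sum>j<m. cmod (expectation (V j) - ?e))"
  proof (rule norm_prod_diff)
    fix j assume "j \<in> {..<m}"
    have "cmod (V j w) \<le> 1" for w
      unfolding V_def prod_norm[symmetric] by (rule prod_le_1) (auto simp: hb)
    moreover have [measurable]: "V j \<in> borel_measurable M" unfolding V_def by measurable
    ultimately have "expectation (\<lambda>w. cmod (V j w)) \<le> expectation (\<lambda>w. 1)"
      by (intro integral_mono) (auto intro: integrable_bounded[of _ 1])
    then have "expectation (\<lambda>w. cmod (V j w)) \<le> 1" by (simp add: prob_space)
    then show "cmod (expectation (V j)) \<le> 1"
      by (rule order_trans[OF integral_norm_bound])
    show "cmod ?e \<le> 1" by (simp add: \<gamma>_def P_def)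
  qed
  also have "\<dots> \<le> (\<Sum>j<m. ?E)"
  proof (rule sum_mono)
    fix j assume "j \<in> {..<m}"
    \<comment> \<open>If there is a block at all, then p < L <= n, so every lag inside a block is
      among those summed in \<open>S\<close>.\<close>
    then have "0 < m" by auto
    then have "L \<le> n" using mL by (cases m) auto
    then have "p \<le> n" using pL by simp
    from block_estimate[OF g z \<theta> this, of "int (j * (p + d)) + 1"]
    show "cmod (expectation (V j) - ?e) \<le> ?E"
      unfolding V_def h_def \<gamma>_def S_def P_def .
  qed
  finally have 3: "cmod ((\<Prod>j<m. expectation (V j)) - (\<Prod>j<m. ?e)) \<le> real m * ?E" by simp
  have e: "(\<Prod>j<m. ?e) = of_real (exp (- (real m * P * \<theta>\<^sup>2 * \<gamma> 0 / 2)))"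
    by (simp flip: of_real_power exp_of_nat_mult)
  have "cmod (expectation (\<lambda>w. iexp (Y w)) - (\<Prod>j<m. ?e)) \<le>
    cmod (expectation (\<lambda>w. iexp (Y w)) - expectation (\<lambda>w. iexp (Z w))) +
    cmod (expectation (\<lambda>w. iexp (Z w)) - (\<Prod>j<m. expectation (V j))) +
    cmod ((\<Prod>j<m. expectation (V j)) - (\<Prod>j<m. ?e))"
    using norm_triangle_ineq[of "expectation (\<lambda>w. iexp (Y w)) - expectation (\<lambda>w. iexp (Z w)) + (expectation (\<lambda>w. iexp (Z w)) - (\<Prod>j<m. expectation (V j)))"
        "(\<Prod>j<m. expectation (V j)) - (\<Prod>j<m. ?e)"]
      norm_triangle_ineq[of "expectation (\<lambda>w. iexp (Y w)) - expectation (\<lambda>w. iexp (Z w))" "expectation (\<lambda>w. iexp (Z w)) - (\<Prod>j<m. expectation (V j))"]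
    by simp
  also have "\<dots> \<le> sqrt (\<theta>\<^sup>2 * ((real n - real m * P) * (\<gamma> 0 + 2 * S))) + real m * (16 * alpha_mixing M X d) + real m * ?E"
    by (intro add_mono 1 2 3)
  finally show "cmod (expectation (\<lambda>w. iexp (\<theta> * (\<Sum>k=1..n. g (X (int k) w)))) - of_real (exp (- (real m * P * \<theta>\<^sup>2 * \<gamma> 0 / 2))))
    \<le> sqrt (\<theta>\<^sup>2 * ((real n - real m * P) * (\<gamma> 0 + 2 * S))) + real m * (16 * alpha_mixing M X d) + real m * ?E"
    unfolding e Y_def sumn .
qed

text \<open>The second limit is recorded as well because it later gives the mean square consistency
  of the estimator and the bounded second moments that replace tightness.\<close>

theorem triangular_clt:
  fixes g :: "nat \<Rightarrow> real \<Rightarrow> real" and b :: "nat \<Rightarrow> real"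
  assumes mixing: "summable (\<lambda>k. real (Suc k) * alpha_mixing M X (Suc k))"
    and b: "\<forall>n\<ge>1. 0 < b n" "b \<longlonglongrightarrow> 0" and nb4: "filterlim (\<lambda>n. real n * b n ^ 4) at_top sequentially"
    and g: "\<And>n. g n \<in> borel_measurable borel" "\<And>n x. \<bar>g n x\<bar> \<le> C" "0 < C"
    and z: "\<And>n. expectation (\<lambda>w. g n (X 0 w)) = 0"
    and var: "(\<lambda>n. expectation (\<lambda>w. g n (X 0 w) * g n (X 0 w)) / b n) \<longlonglongrightarrow> s"
    and lag2: "\<forall>\<^sub>F n in sequentially. expectation (\<lambda>w. g n (X 0 w) * g n (X 2 w)) \<le> D * (b n)\<^sup>2" and D: "0 < D"
  shows "(\<lambda>n. expectation (\<lambda>w. iexp (1 / sqrt (real n * b n) * (\<Sum>k=1..n. g n (X (int k) w))))) \<longlonglongrightarrow> of_real (exp (- (s / 2)))"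
    and "(\<lambda>n. (expectation (\<lambda>w. (\<Sum>k=1..n. g n (X (int k) w))\<^sup>2)) / (real n * b n)) \<longlonglongrightarrow> s"
proof -
  obtain p d :: "nat \<Rightarrow> nat" where d: "\<And>n. 1 \<le> d n" and L: "(\<lambda>n. real (p n + d n) / real n) \<longlonglongrightarrow> 0"
    and dL: "(\<lambda>n. real (d n) / real (p n + d n)) \<longlonglongrightarrow> 0"
    and Ld: "(\<lambda>n. real n / (real (p n + d n) * (real (d n))\<^sup>2)) \<longlonglongrightarrow> 0"
    and p: "(\<lambda>n. (real (p n) + 1) / real n powr (3/8)) \<longlonglongrightarrow> 0"
    by (rule block_lengths) blast
  define \<gamma> where "\<gamma> n k = expectation (\<lambda>w. g n (X 0 w) * g n (X (int k) w))" for n k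
  define S where "S n = (\<Sum>k=1..n. \<bar>\<gamma> n k\<bar>)" for n
  define G where "G n = \<gamma> n 0 / b n" for n
  define R where "R n = S n / b n" for n
  define m where "m n = n div (p n + d n)" for n
  define P where "P n = real (p n + 1)" for n
  define \<rho> where "\<rho> n = real (m n) * P n / real n" for n
  define \<theta> where "\<theta> n = 1 / sqrt (real n * b n)" for n
  define A where "A = (\<Sum>k. real (Suc k) * alpha_mixing M X (Suc k))"
  have G: "G \<longlonglongrightarrow> s" using var by (simp add: G_def[abs_def] \<gamma>_def)
  have R: "R \<longlonglongrightarrow> 0"
    using autocovariance_sum_negligible[OF mixing b g z var lag2 D] by (simp add: R_def[abs_def] S_def \<gamma>_def)
  have A0: "0 \<le> A" unfolding A_def by (intro suminf_nonneg mixing) (simp add: alpha_mixing_nonneg)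
  have L1: "real (m n) * real (p n + d n) \<le> real n" for n
    unfolding m_def of_nat_mult[symmetric] of_nat_le_iff by (rule div_times_less_eq_dividend)
  have L0: "0 < real (p n + d n)" for n using d[of n] by simp
  \<comment> \<open>\<open>\<rho> n\<close> is the share of the indices that lie in blocks. What is
    lost is at most one stretch of length p + d at the end and \<open>d\<close> indices per
    block.\<close>
  have \<rho>: "\<rho> \<longlonglongrightarrow> 1"
  proof -
    have lower: "\<forall>\<^sub>F n in sequentially. 1 - (real (p n + d n) / real n + real (d n) / real (p n + d n)) \<le> \<rho> n"
      using eventually_ge_at_top[of 1]
    proof eventually_elim
      case (elim n)
      have "n < (m n + 1) * (p n + d n)"
        unfolding m_def using d[of n] by (metis Suc_eq_plus1 add_gr_0 dividend_less_times_div less_le_trans mult.commute mult_Suc zero_less_one add.commute)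
      then have "real n < real ((m n + 1) * (p n + d n))" by (simp only: of_nat_less_iff)
      then have n: "real n - real (m n) * real (p n + d n) \<le> real (p n + d n)"
        by (simp add: algebra_simps)
      have "real (m n) * (real (p n + d n) - P n) \<le> real (m n) * real (d n)"
        unfolding P_def by (intro mult_left_mono) auto
      also have "\<dots> \<le> (real n / real (p n + d n)) * real (d n)"
        using L1[of n] L0[of n] by (intro mult_right_mono) (simp_all add: field_simps)
      finally have "real n - real (m n) * P n \<le> real (p n + d n) + real n * (real (d n) / real (p n + d n))"
        using n by (simp add: algebra_simps)
      then have "(real n - real (m n) * P n) / real n \<le> (real (p n + d n) + real n * (real (d n) / real (p n + d n))) / real n"
        by (rule divide_right_mono) simp
      then show ?case using elim by (simp add: \<rho>_def diff_divide_distrib add_divide_distrib)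
    qed
    have upper: "\<forall>\<^sub>F n in sequentially. \<rho> n \<le> 1"
      using eventually_ge_at_top[of 1]
    proof eventually_elim
      case (elim n)
      have "real (m n) * P n \<le> real (m n) * real (p n + d n)"
        unfolding P_def using d[of n] by (intro mult_left_mono) auto
      with L1[of n] elim show ?case by (simp add: \<rho>_def)
    qed
    have "(\<lambda>n. 1 - (real (p n + d n) / real n + real (d n) / real (p n + d n))) \<longlonglongrightarrow> 1 - (0 + 0)"
      by (intro tendsto_intros L dL)
    then show ?thesis
      using tendsto_sandwich[OF lower upper] by simp
  qed
  have u: "(\<lambda>n. P n / real n) \<longlonglongrightarrow> 0"
  proof (rule tendsto_sandwich[OF always_eventually always_eventually tendsto_const L])
    show "\<forall>n. P n / real n \<le> real (p n + d n) / real n"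
      unfolding P_def using d by (intro allI divide_right_mono) auto
  qed (simp add: P_def)
  \<comment> \<open>Up to the factor \<open>C\<close> this is the uniform bound of a scaled block
    sum. From n b^4 >= 1 follows (n b)^4 >= n^3, hence sqrt (n b) >= n^(3/8), the scale provided by
    \<open>block_lengths\<close>.\<close>
  have K: "(\<lambda>n. P n * \<theta> n) \<longlonglongrightarrow> 0"
  proof (rule tendsto_sandwich[OF _ _ tendsto_const p])
    have "\<forall>\<^sub>F n in sequentially. 1 \<le> real n * b n ^ 4"
      using nb4 by (simp add: filterlim_at_top)
    then show "\<forall>\<^sub>F n in sequentially. P n * \<theta> n \<le> (real (p n) + 1) / real n powr (3/8)"
      using eventually_ge_at_top[of 1]
    proof eventually_elim
      case (elim n)
      have n: "0 < real n" and bn: "0 < b n" using elim b(1) by auto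
      have "(real n powr (3/4)) ^ 4 = real n ^ 3"
        using n by (simp add: powr_power)
      also have "\<dots> \<le> real n ^ 3 * (real n * b n ^ 4)"
        using elim(1) n by simp
      also have "\<dots> = (real n * b n) ^ 4" by (simp add: eval_nat_numeral algebra_simps)
      finally have "real n powr (3/4) \<le> real n * b n"
        using n bn by (subst (asm) power_mono_iff) auto
      then have "sqrt (real n powr (3/4)) \<le> sqrt (real n * b n)" by (rule real_sqrt_le_mono)
      moreover have "sqrt (real n powr (3/4)) = real n powr (3/8)"
        by (simp add: powr_half_sqrt[symmetric] powr_powr)
      ultimately have "real n powr (3/8) \<le> sqrt (real n * b n)" by simp
      then show ?case
        unfolding P_def \<theta>_def using n by (simp add: frac_le)
    qed
    show "\<forall>\<^sub>F n in sequentially. 0 \<le> P n * \<theta> n"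
      using eventually_ge_at_top[of 1]
      by eventually_elim (use b(1) in \<open>simp add: P_def \<theta>_def less_imp_le\<close>)
  qed
  \<comment> \<open>The bound of \<open>bernstein_block_estimate\<close> in terms of quantities with
    known limits. The constant 128 is 16 * 8, from the decoupling of blocks and from
    \<open>alpha_mixing_le_inverse_square\<close>.\<close>
  define E where "E n = sqrt ((1 - \<rho> n) * (G n + 2 * R n)) + 128 * A * (real n / (real (p n + d n) * (real (d n))\<^sup>2))
     + \<rho> n * (C * (P n * \<theta> n) * (G n + 2 * R n) + R n + (P n / real n) * (G n)\<^sup>2 / 4)" for n
  have "E \<longlonglongrightarrow> sqrt ((1 - 1) * (s + 2 * 0)) + 128 * A * 0 + 1 * (C * 0 * (s + 2 * 0) + 0 + 0 * s\<^sup>2 / 4)"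
    unfolding E_def[abs_def] by (intro tendsto_intros \<rho> G R Ld K u) auto
  then have E: "E \<longlonglongrightarrow> 0" by simp
  define \<phi> where "\<phi> n = expectation (\<lambda>w. iexp (\<theta> n * (\<Sum>k=1..n. g n (X (int k) w))))" for n
  have "\<forall>\<^sub>F n in sequentially. cmod (\<phi> n - of_real (exp (- (\<rho> n * G n / 2)))) \<le> E n"
    using eventually_ge_at_top[of 1]
  proof eventually_elim
    case (elim n)
    have n: "0 < real n" and bn: "0 < b n" using elim b(1) by auto
    have \<theta>0: "0 \<le> \<theta> n" using n bn by (simp add: \<theta>_def)
    have \<theta>2: "(\<theta> n)\<^sup>2 = 1 / (real n * b n)" using n bn by (simp add: \<theta>_def power_divide)
    have est: "cmod (\<phi> n - of_real (exp (- (real (m n) * P n * (\<theta> n)\<^sup>2 * \<gamma> n 0 / 2))))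
      \<le> sqrt ((\<theta> n)\<^sup>2 * ((real n - real (m n) * P n) * (\<gamma> n 0 + 2 * S n))) + real (m n) * (16 * alpha_mixing M X (d n))
        + real (m n) * (P n * C * \<theta> n * (P n * (\<theta> n)\<^sup>2 * (\<gamma> n 0 + 2 * S n)) + P n * (\<theta> n)\<^sup>2 * S n + (P n * (\<theta> n)\<^sup>2 * \<gamma> n 0 / 2)\<^sup>2)"
      using bernstein_block_estimate[where g = "g n" and p = "p n" and d = "d n" and n = n, OF g(1,2) z \<theta>0 d]
      unfolding \<phi>_def \<gamma>_def S_def m_def P_def by simp
    have e1: "real (m n) * P n * (\<theta> n)\<^sup>2 * \<gamma> n 0 / 2 = \<rho> n * G n / 2"
      using n bn by (simp add: \<theta>2 \<rho>_def G_def)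
    have e2: "(\<theta> n)\<^sup>2 * ((real n - real (m n) * P n) * (\<gamma> n 0 + 2 * S n)) = (1 - \<rho> n) * (G n + 2 * R n)"
      using n bn by (simp add: \<theta>2 \<rho>_def G_def R_def field_simps)
    have e3: "real (m n) * (16 * alpha_mixing M X (d n)) \<le> 128 * A * (real n / (real (p n + d n) * (real (d n))\<^sup>2))"
    proof -
      have "real (m n) * (16 * alpha_mixing M X (d n)) \<le> (real n / real (p n + d n)) * (16 * (8 * A / (real (d n))\<^sup>2))"
        using alpha_mixing_le_inverse_square[OF mixing d[of n]] L1[of n] L0[of n] alpha_mixing_nonneg[of "d n"]
        unfolding A_def[symmetric] by (intro mult_mono) (simp_all add: field_simps)
      then show ?thesis by (simp add: mult.commute mult.left_commute)
    qed
    have e4: "real (m n) * (P n * C * \<theta> n * (P n * (\<theta> n)\<^sup>2 * (\<gamma> n 0 + 2 * S n)) + P n * (\<theta> n)\<^sup>2 * S n + (P n * (\<theta> n)\<^sup>2 * \<gamma> n 0 / 2)\<^sup>2)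
      = \<rho> n * (C * (P n * \<theta> n) * (G n + 2 * R n) + R n + (P n / real n) * (G n)\<^sup>2 / 4)"
    proof -
      have a: "P n * (\<theta> n)\<^sup>2 * x = (P n / real n) * (x / b n)" for x
        unfolding \<theta>2 by simp
      have b: "(\<gamma> n 0 + 2 * S n) / b n = G n + 2 * R n" by (simp add: G_def R_def add_divide_distrib)
      show ?thesis
        unfolding a b G_def[symmetric] R_def[symmetric] \<rho>_def by (simp add: power2_eq_square algebra_simps)
    qed
    show ?case
      using est unfolding e1 e2 e4 E_def using e3 by linarith
  qed
  then have "(\<lambda>n. \<phi> n - of_real (exp (- (\<rho> n * G n / 2)))) \<longlonglongrightarrow> 0"
    by (rule Lim_null_comparison[OF _ E])
  moreover have "(\<lambda>n. of_real (exp (- (\<rho> n * G n / 2))) :: complex) \<longlonglongrightarrow> of_real (exp (- (1 * s / 2)))"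
    by (intro tendsto_intros \<rho> G) auto
  ultimately have "(\<lambda>n. (\<phi> n - of_real (exp (- (\<rho> n * G n / 2)))) + of_real (exp (- (\<rho> n * G n / 2)))) \<longlonglongrightarrow> 0 + of_real (exp (- (1 * s / 2)))"
    by (rule tendsto_add)
  then show "(\<lambda>n. expectation (\<lambda>w. iexp (1 / sqrt (real n * b n) * (\<Sum>k=1..n. g n (X (int k) w))))) \<longlonglongrightarrow> of_real (exp (- (s / 2)))"
    by (simp add: \<phi>_def \<theta>_def)
  define Q where "Q n = expectation (\<lambda>w. (\<Sum>k=1..n. g n (X (int k) w))\<^sup>2)" for n
  have Q: "\<forall>\<^sub>F n in sequentially. norm (Q n / (real n * b n) - G n) \<le> 2 * R n"
    using eventually_ge_at_top[of 1]
  proof eventually_elim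
    case (elim n)
    have n: "0 < real n" and bn: "0 < b n" using elim b(1) by auto
    have "(\<Sum>k=1..n. g n (X (int k) w)) = (\<Sum>k\<in>{1..int n}. g n (X k w))" for w
      by (rule sum.reindex_bij_witness[of _ nat int]) auto
    moreover have "\<bar>i - j\<bar> \<le> int n" if "i \<in> {1..int n}" "j \<in> {1..int n}" for i j
      using that unfolding atLeastAtMost_iff by linarith
    from second_moment_sum[where g = "g n" and I = "{1..int n}" and N = n, OF bdd_borelI[OF g(1,2)] finite_atLeastAtMost_int this]
    have "\<bar>expectation (\<lambda>w. (\<Sum>k\<in>{1..int n}. g n (X k w))\<^sup>2) - real n * \<gamma> n 0\<bar> \<le> real n * (2 * S n)"
      by (simp add: \<gamma>_def S_def)
    ultimately have "\<bar>Q n - real n * \<gamma> n 0\<bar> \<le> real n * (2 * S n)" by (simp add: Q_def)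
    then have "\<bar>Q n - real n * \<gamma> n 0\<bar> / (real n * b n) \<le> real n * (2 * S n) / (real n * b n)"
      using n bn by (intro divide_right_mono) auto
    moreover have "Q n / (real n * b n) - G n = (Q n - real n * \<gamma> n 0) / (real n * b n)"
      using n bn by (simp add: G_def field_simps)
    ultimately show ?case using n bn by (simp add: R_def)
  qed
  have "(\<lambda>n. 2 * R n) \<longlonglongrightarrow> 0" using tendsto_mult[OF tendsto_const[of 2] R] by simp
  from tendsto_add[OF Lim_null_comparison[OF Q this] G]
  show "(\<lambda>n. (expectation (\<lambda>w. (\<Sum>k=1..n. g n (X (int k) w))\<^sup>2)) / (real n * b n)) \<longlonglongrightarrow> s"
    by (simp add: Q_def)
qed

end

section \<open>Kernel asymptotics\<close>

lemma filterlim_const_div_at_top: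
  fixes b :: "nat \<Rightarrow> real"
  assumes b: "\<forall>n\<ge>1. 0 < b n" "b \<longlonglongrightarrow> 0" and r: "0 < r"
  shows "filterlim (\<lambda>n. r / b n) at_top sequentially"
  unfolding filterlim_at_top
proof
  fix Z :: real
  have "\<forall>\<^sub>F n in sequentially. b n < r / (max Z 1)"
    by (rule order_tendstoD(2)[OF b(2)]) (use r in auto)
  then show "\<forall>\<^sub>F n in sequentially. Z \<le> r / b n"
    using eventually_ge_at_top[of 1]
  proof eventually_elim
    case (elim n)
    have bn: "0 < b n" using b(1) elim by simp
    have "b n * max Z 1 < r" using elim(1) by (simp add: field_simps)
    then have "max Z 1 < r / b n" unfolding pos_less_divide_eq[OF bn] by (simp only: mult.commute)
    then show ?case by simp
  qed
qed

locale kernel =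
  fixes K :: "real \<Rightarrow> real"
  assumes nonneg: "0 \<le> K u"
    and even: "K (- u) = K u"
    and decr: "antimono_on {0<..} K"
    and integral_1: "has_bochner_integral lborel K 1"
    and decay: "((\<lambda>u. u\<^sup>2 * K u) \<longlongrightarrow> 0) at_top"
    and cont: "continuous_on UNIV K"
begin

lemma measurable_K [measurable]: "K \<in> borel_measurable borel"
  using cont by (rule borel_measurable_continuous_onI)

lemma K_abs: "K \<bar>u\<bar> = K u"
  by (simp add: abs_if even)

lemma K_antimono: assumes "0 < t" "t \<le> \<bar>u\<bar>" shows "K u \<le> K t"
  using monotone_onD[OF decr, of t "\<bar>u\<bar>"] assms by (simp add: K_abs)

text \<open>Monotonicity is given on the open half-line only, so \<open>K 0\<close> is reached as
  the limit from the right of the values at small positive arguments.\<close>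

lemma K_le_K0: "K u \<le> K 0"
proof (cases "u = 0")
  case False
  have "isCont K 0" using cont by (simp add: continuous_on_eq_continuous_at)
  then have "(K \<longlongrightarrow> K 0) (at_right 0)"
    by (auto simp: isCont_def intro: filterlim_mono[OF _ _ at_le] )
  moreover have "\<forall>\<^sub>F t in at_right 0. K u \<le> K t"
    unfolding eventually_at_right_field
    by (rule exI[of _ "\<bar>u\<bar>"]) (use False in \<open>auto intro!: K_antimono\<close>)
  ultimately show ?thesis
    by (rule tendsto_lowerbound) simp
qed simp

lemma abs_K_le: "\<bar>K u\<bar> \<le> K 0"
  using K_le_K0[of u] nonneg[of u] by simp

text \<open>The decay condition read along r / b. The rate o(b^2) is what pair moments require; for
  moments of one coordinate the rate o(b) of \<open>K_tail1\<close> is enough.\<close>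

lemma K_tail:
  fixes b :: "nat \<Rightarrow> real"
  assumes b: "\<forall>n\<ge>1. 0 < b n" "b \<longlonglongrightarrow> 0" and r: "0 < r"
  shows "(\<lambda>n. K (r / b n) / (b n)\<^sup>2) \<longlonglongrightarrow> 0"
proof -
  have "(\<lambda>n. (r / b n)\<^sup>2 * K (r / b n) / r\<^sup>2) \<longlonglongrightarrow> 0 / r\<^sup>2"
    by (intro tendsto_divide filterlim_compose[OF decay filterlim_const_div_at_top[OF b r]] tendsto_const) (use r in auto)
  then show ?thesis using r by (simp add: power_divide)
qed

lemma K_tail1:
  fixes b :: "nat \<Rightarrow> real"
  assumes b: "\<forall>n\<ge>1. 0 < b n" "b \<longlonglongrightarrow> 0" and r: "0 < r"
  shows "(\<lambda>n. K (r / b n) / b n) \<longlonglongrightarrow> 0"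
proof (rule Lim_transform_eventually)
  show "(\<lambda>n. K (r / b n) / (b n)\<^sup>2 * b n) \<longlonglongrightarrow> 0"
    using tendsto_mult[OF K_tail[OF b r] b(2)] by simp
  show "\<forall>\<^sub>F n in sequentially. K (r / b n) / (b n)\<^sup>2 * b n = K (r / b n) / b n"
    using eventually_ge_at_top[of 1]
    by eventually_elim (use b(1) in \<open>simp add: power2_eq_square\<close>)
qed

lemma integrable_K: "integrable lborel K" "integral\<^sup>L lborel K = 1"
  using integral_1 by (auto simp: has_bochner_integral_iff)

lemma integrable_K2: "integrable lborel (\<lambda>u. (K u)\<^sup>2)"
proof (rule Bochner_Integration.integrable_bound)
  show "integrable lborel (\<lambda>u. K 0 * K u)" using integrable_K by simp
  show "AE u in lborel. norm ((K u)\<^sup>2) \<le> norm (K 0 * K u)"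
    using K_le_K0 nonneg by (auto simp: power2_eq_square intro!: mult_right_mono)
qed auto

lemma integral_K2_pos: "0 < (LINT u|lborel. (K u)\<^sup>2)"
proof (rule ccontr)
  assume "\<not> 0 < (LINT u|lborel. (K u)\<^sup>2)"
  moreover have "0 \<le> (LINT u|lborel. (K u)\<^sup>2)" by simp
  ultimately have "(LINT u|lborel. (K u)\<^sup>2) = 0" by linarith
  then have "AE u in lborel. (K u)\<^sup>2 = 0"
    using integral_nonneg_eq_0_iff_AE[OF integrable_K2] by simp
  then have "AE u in lborel. K u = 0" by simp
  then have "integral\<^sup>L lborel K = 0" by (rule integral_eq_zero_AE)
  then show False using integrable_K(2) by simp
qed

end

text \<open>Near \<open>a\<close> the density is bounded, so dominated convergence applies after the substitution
  \<open>y = a - b n * u\<close>; the mass far from \<open>a\<close> is controlled by the decay of \<open>Q\<close> alone.\<close>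

lemma (in prob_space) approximate_identity:
  fixes b q :: "nat \<Rightarrow> real" and f Q :: "real \<Rightarrow> real"
  assumes Y: "distributed M lborel Y f" and f0: "\<And>t. 0 \<le> f t" and fc: "isCont f a"
    and b: "\<forall>n\<ge>1. 0 < b n" "b \<longlonglongrightarrow> 0"
    and Q: "integrable lborel Q" "\<And>u. 0 \<le> Q u" "\<And>u. Q u \<le> B"
    and tail: "\<And>r n u. 0 < r \<Longrightarrow> 1 \<le> n \<Longrightarrow> r \<le> b n * \<bar>u\<bar> \<Longrightarrow> Q u \<le> Q (r / b n)"
    and tail0: "\<And>r. 0 < r \<Longrightarrow> (\<lambda>n. Q (r / b n) / b n) \<longlonglongrightarrow> 0"
  shows "(\<lambda>n. expectation (\<lambda>w. Q ((a - Y w) / b n)) / b n) \<longlonglongrightarrow> f a * integral\<^sup>L lborel Q"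
proof -
  have [measurable]: "f \<in> borel_measurable borel"
    using distributed_real_measurable[OF _ Y] f0 by simp
  have [measurable]: "Q \<in> borel_measurable borel" using Q(1) by auto
  have Ym[measurable]: "Y \<in> borel_measurable M" using distributed_measurable[OF Y] by simp
  obtain r where r: "0 < r" and near: "\<And>t. \<bar>t - a\<bar> < r \<Longrightarrow> f t \<le> f a + 1"
  proof -
    have "\<forall>\<^sub>F t in at a. f t < f a + 1"
      using fc unfolding isCont_def by (rule order_tendstoD) simp
    then obtain r where r: "0 < r" "\<And>t. t \<noteq> a \<Longrightarrow> \<bar>t - a\<bar> < r \<Longrightarrow> f t < f a + 1"
      unfolding eventually_at dist_real_def by auto
    have "f t \<le> f a + 1" if "\<bar>t - a\<bar> < r" for t
      using r(2)[of t] that by (cases "t = a") auto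
    with r(1) show thesis by (rule that)
  qed
  define near_part where "near_part n = expectation (\<lambda>w. Q ((a - Y w) / b n) * indicator {y. \<bar>y - a\<bar> < r} (Y w)) / b n" for n
  define far_part where "far_part n = expectation (\<lambda>w. Q ((a - Y w) / b n) * indicator {y. r \<le> \<bar>y - a\<bar>} (Y w)) / b n" for n
  have iQ: "integrable M (\<lambda>w. Q ((a - Y w) / b n) * indicator S (Y w))" if [measurable]: "S \<in> sets borel" for n S
  proof (rule integrable_const_bound[of _ B])
    have "0 \<le> B" using order_trans[OF Q(2,3)] .
    then show "AE w in M. norm (Q ((a - Y w) / b n) * indicator S (Y w)) \<le> B"
      using Q(2,3) by (auto simp: indicator_def)
  qed auto
  have split: "expectation (\<lambda>w. Q ((a - Y w) / b n)) / b n = near_part n + far_part n" for n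
  proof -
    have "expectation (\<lambda>w. Q ((a - Y w) / b n)) = expectation (\<lambda>w. Q ((a - Y w) / b n) * indicator {y. \<bar>y - a\<bar> < r} (Y w)
        + Q ((a - Y w) / b n) * indicator {y. r \<le> \<bar>y - a\<bar>} (Y w))"
      by (rule Bochner_Integration.integral_cong) (auto simp: indicator_def)
    also have "\<dots> = expectation (\<lambda>w. Q ((a - Y w) / b n) * indicator {y. \<bar>y - a\<bar> < r} (Y w))
        + expectation (\<lambda>w. Q ((a - Y w) / b n) * indicator {y. r \<le> \<bar>y - a\<bar>} (Y w))"
      by (rule Bochner_Integration.integral_add) (rule iQ; measurable)+
    finally show ?thesis by (simp add: near_part_def far_part_def add_divide_distrib)
  qed
  have far: "far_part \<longlonglongrightarrow> 0"
  proof (rule tendsto_sandwich[OF _ _ tendsto_const tail0[OF r]])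
    show "\<forall>\<^sub>F n in sequentially. 0 \<le> far_part n"
      using eventually_ge_at_top[of 1]
    proof eventually_elim
      case (elim n)
      have "0 < b n" using b(1) elim by simp
      then show ?case unfolding far_part_def using Q(2) by (intro divide_nonneg_pos Bochner_Integration.integral_nonneg) auto
    qed
    show "\<forall>\<^sub>F n in sequentially. far_part n \<le> Q (r / b n) / b n"
      using eventually_ge_at_top[of 1]
    proof eventually_elim
      case (elim n)
      have bn: "0 < b n" using b(1) elim by simp
      have "expectation (\<lambda>w. Q ((a - Y w) / b n) * indicator {y. r \<le> \<bar>y - a\<bar>} (Y w)) \<le> expectation (\<lambda>w. Q (r / b n))"
      proof (rule integral_mono)
        show "integrable M (\<lambda>w. Q ((a - Y w) / b n) * indicator {y. r \<le> \<bar>y - a\<bar>} (Y w))" by (rule iQ) measurable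
        show "Q ((a - Y w) / b n) * indicator {y. r \<le> \<bar>y - a\<bar>} (Y w) \<le> Q (r / b n)" for w
        proof (cases "r \<le> \<bar>Y w - a\<bar>")
          case True
          then have "r \<le> b n * \<bar>(a - Y w) / b n\<bar>" using bn by (simp add: abs_minus_commute)
          from tail[OF r elim this] True show ?thesis by simp
        qed (use Q(2) in simp)
      qed simp
      then show ?case unfolding far_part_def using bn by (simp add: prob_space divide_right_mono)
    qed
  qed
  define loc where "loc n u = indicator {u. \<bar>b n * u\<bar> < r} u * f (a - b n * u) * Q u" for n u
  have near_eq: "near_part n = (\<integral>u. loc n u \<partial>lborel)" if n: "1 \<le> n" for n
  proof -
    have bn: "0 < b n" using b(1) n by simp
    have "expectation (\<lambda>w. Q ((a - Y w) / b n) * indicator {y. \<bar>y - a\<bar> < r} (Y w)) =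
        (\<integral>y. f y * (Q ((a - y) / b n) * indicator {y. \<bar>y - a\<bar> < r} y) \<partial>lborel)"
      by (rule distributed_integral[OF Y, symmetric]) (use f0 in auto)
    also have "\<dots> = \<bar>- b n\<bar> *\<^sub>R (\<integral>u. f (a + - b n * u) * (Q ((a - (a + - b n * u)) / b n) * indicator {y. \<bar>y - a\<bar> < r} (a + - b n * u)) \<partial>lborel)"
      by (rule lborel_integral_real_affine) (use bn in simp)
    also have "\<dots> = b n * (\<integral>u. loc n u \<partial>lborel)"
      using bn by (simp add: loc_def indicator_def mult_ac)
    finally show ?thesis using bn by (simp add: near_part_def)
  qed
  have "(\<lambda>n. \<integral>u. loc n u \<partial>lborel) \<longlonglongrightarrow> (\<integral>u. f a * Q u \<partial>lborel)"
  proof (rule integral_dominated_convergence[where w = "\<lambda>u. (f a + 1) * Q u"])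
    show "(\<lambda>u. f a * Q u) \<in> borel_measurable lborel" by measurable
    show "loc n \<in> borel_measurable lborel" for n unfolding loc_def by measurable
    show "integrable lborel (\<lambda>u. (f a + 1) * Q u)" using Q(1) by simp
    have "(\<lambda>n. loc n u) \<longlonglongrightarrow> f a * Q u" for u
    proof (rule Lim_transform_eventually)
      have bu: "(\<lambda>n. b n * u) \<longlonglongrightarrow> 0" using tendsto_mult[OF b(2) tendsto_const[of u]] by simp
      have "(\<lambda>n. a - b n * u) \<longlonglongrightarrow> a" using tendsto_diff[OF tendsto_const[of a] bu] by simp
      from isCont_tendsto_compose[OF fc this] show "(\<lambda>n. f (a - b n * u) * Q u) \<longlonglongrightarrow> f a * Q u"
        by (rule tendsto_mult[OF _ tendsto_const])
      have "\<forall>\<^sub>F n in sequentially. \<bar>b n * u\<bar> < r"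
        using tendstoD[OF bu r] by (simp add: dist_real_def)
      then show "\<forall>\<^sub>F n in sequentially. f (a - b n * u) * Q u = loc n u"
        by eventually_elim (simp add: loc_def)
    qed
    then show "AE u in lborel. (\<lambda>n. loc n u) \<longlonglongrightarrow> f a * Q u" by simp
    show "AE u in lborel. norm (loc n u) \<le> (f a + 1) * Q u" for n
    proof (rule AE_I2)
      fix u
      show "norm (loc n u) \<le> (f a + 1) * Q u"
      proof (cases "\<bar>b n * u\<bar> < r")
        case True
        then have "f (a - b n * u) \<le> f a + 1" by (intro near) simp
        then show ?thesis using True f0[of "a - b n * u"] Q(2)[of u] by (simp add: loc_def abs_mult mult_right_mono)
      next
        case False
        then show ?thesis using f0[of a] Q(2)[of u] by (simp add: loc_def)
      qed
    qed
  qed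
  then have lim: "(\<lambda>n. \<integral>u. loc n u \<partial>lborel) \<longlonglongrightarrow> f a * integral\<^sup>L lborel Q" by simp
  have "\<forall>\<^sub>F n in sequentially. (\<integral>u. loc n u \<partial>lborel) = near_part n"
    using eventually_ge_at_top[of 1] by eventually_elim (rule near_eq[symmetric])
  from Lim_transform_eventually[OF lim this]
  have "near_part \<longlonglongrightarrow> f a * integral\<^sup>L lborel Q" .
  from tendsto_add[OF this far] show ?thesis by (simp add: split)
qed

context kernel
begin

text \<open>Two instances of \<open>approximate_identity\<close>, for the kernel and for its square.
  The square inherits the tail condition through K^2 <= K 0 * K.\<close>

lemma
  fixes b :: "nat \<Rightarrow> real"
  assumes "prob_space M" and Y: "distributed M lborel Y f" and f0: "\<And>t. 0 \<le> f t" and fc: "isCont f a"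
    and b: "\<forall>n\<ge>1. 0 < b n" "b \<longlonglongrightarrow> 0"
  shows kernel_mean: "(\<lambda>n. (LINT w|M. K ((a - Y w) / b n)) / b n) \<longlonglongrightarrow> f a"
    and kernel_second_moment: "(\<lambda>n. (LINT w|M. K ((a - Y w) / b n) * K ((a - Y w) / b n)) / b n) \<longlonglongrightarrow> f a * (LINT u|lborel. (K u)\<^sup>2)"
proof -
  interpret prob_space M by fact
  have far: "K u \<le> K (r / b n)" if "0 < r" "1 \<le> n" "r \<le> b n * \<bar>u\<bar>" for r n u
    using b(1) that by (intro K_antimono) (auto simp: field_simps)
  show "(\<lambda>n. (LINT w|M. K ((a - Y w) / b n)) / b n) \<longlonglongrightarrow> f a"
    using approximate_identity[OF Y f0 fc b integrable_K(1) nonneg K_le_K0 far K_tail1[OF b]]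
    by (simp add: integrable_K(2))
  have "(\<lambda>n. (K (r / b n))\<^sup>2 / b n) \<longlonglongrightarrow> 0" if r: "0 < r" for r
  proof (rule Lim_null_comparison)
    show "(\<lambda>n. K 0 * (K (r / b n) / b n)) \<longlonglongrightarrow> 0"
      using tendsto_mult[OF tendsto_const[of "K 0"] K_tail1[OF b r]] by simp
    show "\<forall>\<^sub>F n in sequentially. norm ((K (r / b n))\<^sup>2 / b n) \<le> K 0 * (K (r / b n) / b n)"
      using eventually_ge_at_top[of 1]
    proof eventually_elim
      case (elim n)
      have bn: "0 < b n" using b(1) elim by simp
      have "(K (r / b n))\<^sup>2 \<le> K 0 * K (r / b n)"
        unfolding power2_eq_square by (intro mult_right_mono K_le_K0 nonneg)
      then show ?case using bn by (simp add: divide_right_mono)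
    qed
  qed
  from approximate_identity[OF Y f0 fc b integrable_K2 _ _ _ this, of "(K 0)\<^sup>2"]
  show "(\<lambda>n. (LINT w|M. K ((a - Y w) / b n) * K ((a - Y w) / b n)) / b n) \<longlonglongrightarrow> f a * (LINT u|lborel. (K u)\<^sup>2)"
    using far nonneg K_le_K0 by (simp add: power_mono flip: power2_eq_square)
qed

text \<open>No point is closer than half the distance of \<open>a\<close> and \<open>a'\<close> to
  both of them, so one of the two factors is always at most K (r / b) = o(b). This is the source of
  the zeros in the limiting covariance matrix.\<close>

lemma kernel_cross_moment:
  fixes b :: "nat \<Rightarrow> real" and a a' :: real and Y :: "'w \<Rightarrow> real"
  assumes "prob_space M" and [measurable]: "Y \<in> borel_measurable M" and a: "a \<noteq> a'"
    and b: "\<forall>n\<ge>1. 0 < b n" "b \<longlonglongrightarrow> 0"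
  shows "(\<lambda>n. (LINT w|M. K ((a - Y w) / b n) * K ((a' - Y w) / b n)) / b n) \<longlonglongrightarrow> 0"
proof -
  interpret prob_space M by fact
  define r where "r = \<bar>a - a'\<bar> / 2"
  have r: "0 < r" using a by (simp add: r_def)
  show ?thesis
  proof (rule Lim_null_comparison)
    show "(\<lambda>n. K 0 * (K (r / b n) / b n)) \<longlonglongrightarrow> 0"
      using tendsto_mult[OF tendsto_const[of "K 0"] K_tail1[OF b r]] by simp
    show "\<forall>\<^sub>F n in sequentially. norm ((LINT w|M. K ((a - Y w) / b n) * K ((a' - Y w) / b n)) / b n) \<le> K 0 * (K (r / b n) / b n)"
      using eventually_ge_at_top[of 1]
    proof eventually_elim
      case (elim n)
      have bn: "0 < b n" using b(1) elim by simp
      have far: "K (t / b n) \<le> K (r / b n)" if "r \<le> \<bar>t\<bar>" for t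
        using that bn r by (intro K_antimono) (auto simp: divide_right_mono)
      have pt: "K ((a - y) / b n) * K ((a' - y) / b n) \<le> K 0 * K (r / b n)" for y
      proof (cases "r \<le> \<bar>a - y\<bar>")
        case True
        have "K ((a - y) / b n) * K ((a' - y) / b n) \<le> K (r / b n) * K 0"
          by (intro mult_mono far[OF True] K_le_K0 nonneg)
        then show ?thesis by (simp only: mult.commute)
      next
        case False
        moreover have "\<bar>a - a'\<bar> \<le> \<bar>a - y\<bar> + \<bar>a' - y\<bar>"
          using abs_triangle_ineq4[of "a - y" "a' - y"] by simp
        moreover have "\<not> d / 2 \<le> p \<Longrightarrow> d \<le> p + q \<Longrightarrow> d / 2 \<le> q" for d p q :: real by linarith
        ultimately have "r \<le> \<bar>a' - y\<bar>" unfolding r_def by blast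
        then show ?thesis by (intro mult_mono K_le_K0 far nonneg)
      qed
      have "(LINT w|M. K ((a - Y w) / b n) * K ((a' - Y w) / b n)) \<le> (LINT w|M. K 0 * K (r / b n))"
        by (intro integral_mono integrable_bounded_mult[OF _ _ abs_K_le abs_K_le] pt) auto
      moreover have "0 \<le> (LINT w|M. K ((a - Y w) / b n) * K ((a' - Y w) / b n))"
        using nonneg by simp
      ultimately show ?case using bn by (simp add: prob_space divide_right_mono)
    qed
  qed
qed

text \<open>Near (a, a') the density is at most \<open>C\<close>, and the kernel product has
  Lebesgue integral exactly b^2. Elsewhere one factor is at most K (r / b), eventually below b^2,
  and the other at most \<open>K 0\<close>.\<close>

lemma kernel_pair_moment:
  fixes b :: "nat \<Rightarrow> real" and f2 :: "real \<times> real \<Rightarrow> real" and a a' C :: real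
  assumes "prob_space M" and YZ: "distributed M (lborel \<Otimes>\<^sub>M lborel) (\<lambda>w. (Y w, Z w)) f2"
    and Y[measurable]: "Y \<in> borel_measurable M" and Z[measurable]: "Z \<in> borel_measurable M"
    and f20: "\<And>p. 0 \<le> f2 p" and r: "0 < r" and bd: "\<And>s t. \<bar>s\<bar> < r \<Longrightarrow> \<bar>t\<bar> < r \<Longrightarrow> f2 (a + s, a' + t) \<le> C"
    and b: "\<forall>n\<ge>1. 0 < b n" "b \<longlonglongrightarrow> 0"
  shows "\<forall>\<^sub>F n in sequentially. (LINT w|M. K ((a - Y w) / b n) * K ((a' - Z w) / b n)) \<le> (C + K 0) * (b n)\<^sup>2"
proof -
  interpret prob_space M by fact
  have C0: "0 \<le> C" by (rule order_trans[OF f20 bd[of 0 0]]) (use r in auto)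
  have "\<forall>\<^sub>F n in sequentially. K (r / b n) / (b n)\<^sup>2 < 1"
    by (rule order_tendstoD(2)[OF K_tail[OF b r]]) simp
  then show ?thesis
    using eventually_ge_at_top[of 1]
  proof eventually_elim
    case (elim n)
    have bn: "0 < b n" using b(1) elim by simp
    have tail: "K (r / b n) \<le> (b n)\<^sup>2" using elim(1) bn by (simp add: divide_less_eq)
    \<comment> \<open>The kernel product restricted to the square on which the density is at most
      \<open>C\<close>.\<close>
    define A where "A y z = indicator {p. \<bar>a - fst p\<bar> < r \<and> \<bar>a' - snd p\<bar> < r} (y, z) * (K ((a - y) / b n) * K ((a' - z) / b n))" for y z
    have [measurable]: "(\<lambda>p. A (fst p) (snd p)) \<in> borel_measurable (borel \<Otimes>\<^sub>M borel)"
      unfolding A_def by measurable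
    have A0: "0 \<le> A y z" for y z unfolding A_def using nonneg by (auto simp: indicator_def)
    have far: "K (t / b n) \<le> (b n)\<^sup>2" if "r \<le> \<bar>t\<bar>" for t
      using that bn r by (intro order_trans[OF K_antimono tail]) (auto simp: divide_right_mono)
    have pt: "K ((a - y) / b n) * K ((a' - z) / b n) \<le> A y z + K 0 * (b n)\<^sup>2" for y z
    proof -
      consider "\<bar>a - y\<bar> < r \<and> \<bar>a' - z\<bar> < r" | "r \<le> \<bar>a - y\<bar>" | "r \<le> \<bar>a' - z\<bar>" by linarith
      then show ?thesis
      proof cases
        case 1 then show ?thesis using nonneg[of 0] by (simp add: A_def)
      next
        case 2
        have "K ((a - y) / b n) * K ((a' - z) / b n) \<le> (b n)\<^sup>2 * K 0"
          by (intro mult_mono far[OF 2] K_le_K0 nonneg) simp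
        then show ?thesis using A0[of y z] by (simp add: mult.commute)
      next
        case 3
        have "K ((a - y) / b n) * K ((a' - z) / b n) \<le> K 0 * (b n)\<^sup>2"
          by (intro mult_mono far[OF 3] K_le_K0 nonneg)
        then show ?thesis using A0[of y z] by simp
      qed
    qed
    have Am[measurable]: "(\<lambda>w. A (Y w) (Z w)) \<in> borel_measurable M"
      unfolding A_def by measurable
    have Ab: "norm (A (Y w) (Z w)) \<le> K 0 * K 0" for w
    proof -
      have "A (Y w) (Z w) \<le> K ((a - Y w) / b n) * K ((a' - Z w) / b n)"
        unfolding A_def using nonneg by (auto simp: indicator_def)
      also have "\<dots> \<le> K 0 * K 0" by (intro mult_mono K_le_K0 nonneg)
      finally show ?thesis using A0 by simp
    qed
    have iA: "integrable M (\<lambda>w. A (Y w) (Z w))" by (rule integrable_bounded[OF Am Ab])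
    have scale: "(\<integral>\<^sup>+y. ennreal (K ((c - y) / b n)) \<partial>lborel) = ennreal (b n)" for c
    proof -
      have "(\<integral>\<^sup>+y. ennreal (K ((c - y) / b n)) \<partial>lborel) =
          \<bar>- b n\<bar> * (\<integral>\<^sup>+u. ennreal (K ((c - (c + - b n * u)) / b n)) \<partial>lborel)"
        by (rule nn_integral_real_affine) (use bn in auto)
      also have "(\<integral>\<^sup>+u. ennreal (K ((c - (c + - b n * u)) / b n)) \<partial>lborel) = ennreal 1"
        using bn nn_integral_eq_integral[OF integrable_K(1)] nonneg by (simp add: integrable_K(2))
      finally show ?thesis using bn by simp
    qed
    \<comment> \<open>For nonnegative integrals the density can be replaced by \<open>C\<close> and
      the double integral factored without integrability conditions; \<open>scale\<close> evaluates
      each factor.\<close>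
    have "ennreal (LINT w|M. A (Y w) (Z w)) = (\<integral>\<^sup>+w. ennreal (A (Y w) (Z w)) \<partial>M)"
      by (rule nn_integral_eq_integral[symmetric, OF iA]) (simp add: A0)
    also have "\<dots> = (\<integral>\<^sup>+p. ennreal (f2 p) * ennreal (A (fst p) (snd p)) \<partial>(lborel \<Otimes>\<^sub>M lborel))"
      using distributed_nn_integral[OF YZ, of "\<lambda>p. ennreal (A (fst p) (snd p))"] by simp
    also have "\<dots> \<le> (\<integral>\<^sup>+p. ennreal C * (ennreal (K ((a - fst p) / b n)) * ennreal (K ((a' - snd p) / b n))) \<partial>(lborel \<Otimes>\<^sub>M lborel))"
    proof (rule nn_integral_mono)
      fix p :: "real \<times> real"
      show "ennreal (f2 p) * ennreal (A (fst p) (snd p)) \<le> ennreal C * (ennreal (K ((a - fst p) / b n)) * ennreal (K ((a' - snd p) / b n)))"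
      proof (cases "\<bar>a - fst p\<bar> < r \<and> \<bar>a' - snd p\<bar> < r")
        case True
        have "f2 (a + (fst p - a), a' + (snd p - a')) \<le> C" by (rule bd) (use True in \<open>auto simp: abs_minus_commute\<close>)
        then have "f2 p \<le> C" by simp
        then show ?thesis
          using True nonneg by (simp add: A_def ennreal_mult mult_right_mono ennreal_leI)
      qed (auto simp: A_def indicator_def)
    qed
    also have "\<dots> = ennreal C * (\<integral>\<^sup>+y. (\<integral>\<^sup>+z. ennreal (K ((a - y) / b n)) * ennreal (K ((a' - z) / b n)) \<partial>lborel) \<partial>lborel)"
      by (subst nn_integral_cmult) (auto simp: lborel.nn_integral_fst[symmetric])
    also have "\<dots> = ennreal C * (ennreal (b n) * ennreal (b n))"
      by (simp add: nn_integral_cmult nn_integral_multc scale)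
    also have "\<dots> = ennreal (C * (b n)\<^sup>2)"
      using bn C0 by (simp add: ennreal_mult power2_eq_square)
    finally have EA: "(LINT w|M. A (Y w) (Z w)) \<le> C * (b n)\<^sup>2"
      using C0 by (simp add: ennreal_le_iff)
    have "(LINT w|M. K ((a - Y w) / b n) * K ((a' - Z w) / b n)) \<le> (LINT w|M. A (Y w) (Z w) + K 0 * (b n)\<^sup>2)"
      by (intro integral_mono integrable_bounded_mult[OF _ _ abs_K_le abs_K_le] Bochner_Integration.integrable_add iA pt) auto
    also have "\<dots> = (LINT w|M. A (Y w) (Z w)) + K 0 * (b n)\<^sup>2"
      using iA by (simp add: prob_space)
    finally show ?case using EA by (simp add: algebra_simps)
  qed
qed

end

section \<open>Convergence in distribution in several dimensions\<close>

text \<open>The quadratic form and the constant both split over the basis; in this form integrals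
  can be taken coordinate by coordinate.\<close>

lemma multivariate_normal_std:
  "multivariate_normal 0 (mat 1 :: real ^ 'm ^ 'm::finite) =
    density lborel (\<lambda>z. \<Prod>b\<in>Basis. ennreal (std_normal_density (z \<bullet> b)))"
proof -
  have inv: "matrix_inv (mat 1 :: real ^ 'm ^ 'm) = mat 1"
    unfolding matrix_inv_def by (rule some_equality) simp_all
  have "exp (- (z \<bullet> z) / 2) / sqrt ((2 * pi) ^ CARD('m)) = (\<Prod>b\<in>Basis. std_normal_density (z \<bullet> b))" for z :: "real ^ 'm"
  proof -
    have "- (z \<bullet> z) / 2 = (\<Sum>b\<in>Basis. - (z \<bullet> b)\<^sup>2 / 2)"
      by (subst euclidean_inner) (simp add: power2_eq_square sum_divide_distrib sum_negf)
    moreover have "sqrt ((2 * pi) ^ CARD('m)) = sqrt (2 * pi) ^ card (Basis :: (real ^ 'm) set)"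
    proof -
      have "card (Basis :: (real ^ 'm) set) = CARD('m)" by simp
      then show ?thesis by (simp only: real_sqrt_power)
    qed
    ultimately show ?thesis
      by (simp add: std_normal_density_def prod_dividef exp_sum)
  qed
  then show ?thesis
    unfolding multivariate_normal_def inv by (simp add: prod_ennreal)
qed

lemma prob_space_multivariate_normal_std:
  "prob_space (multivariate_normal 0 (mat 1 :: real ^ 'm ^ 'm::finite))"
proof
  have 1: "(\<integral>\<^sup>+x. ennreal (std_normal_density x) \<partial>lborel) = 1"
    using prob_space.emeasure_space_1[OF prob_space_normal_density[of 1 0]]
    by (simp add: emeasure_density)
  have "emeasure (multivariate_normal 0 (mat 1 :: real ^ 'm ^ 'm)) (space (multivariate_normal 0 (mat 1 :: real ^ 'm ^ 'm)))
      = (\<integral>\<^sup>+z. (\<Prod>b\<in>Basis. ennreal (std_normal_density ((z :: real ^ 'm) \<bullet> b))) \<partial>lborel)"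
    unfolding multivariate_normal_std by (simp add: emeasure_density)
  also have "\<dots> = (\<Prod>b\<in>(Basis :: (real ^ 'm) set). \<integral>\<^sup>+x. ennreal (std_normal_density x) \<partial>lborel)"
    by (rule nn_integral_lborel_prod) auto
  finally show "emeasure (multivariate_normal 0 (mat 1 :: real ^ 'm ^ 'm)) (space (multivariate_normal 0 (mat 1 :: real ^ 'm ^ 'm))) = 1"
    by (simp add: 1)
qed

lemma integral_lborel_prod:
  fixes f :: "'a::euclidean_space \<Rightarrow> real \<Rightarrow> complex"
  assumes i: "\<And>b. b \<in> Basis \<Longrightarrow> integrable lborel (f b)"
  shows "(\<integral>z. (\<Prod>b\<in>Basis. f b (z \<bullet> b)) \<partial>lborel) = (\<Prod>b\<in>Basis. \<integral>x. f b x \<partial>lborel)"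
proof -
  interpret product_sigma_finite "\<lambda>_::'a. lborel :: real measure" ..
  have fm: "f b \<in> borel_measurable borel" if "b \<in> Basis" for b
    using i[OF that] by auto
  have 1: "(\<lambda>h. \<Sum>b\<in>Basis. h b *\<^sub>R b) \<in> measurable (\<Pi>\<^sub>M b\<in>Basis. lborel) (borel :: 'a measure)"
    by (intro borel_measurable_sum borel_measurable_scaleR measurable_const) (auto intro: measurable_component_singleton[THEN measurable_compose])
  have 2: "(\<lambda>z::'a. \<Prod>b\<in>Basis. f b (z \<bullet> b)) \<in> borel_measurable borel"
  proof (rule borel_measurable_prod)
    fix b :: 'a assume "b \<in> Basis"
    have "(\<lambda>z :: 'a. z \<bullet> b) \<in> borel_measurable borel" by simp
    from measurable_compose[OF this fm[OF \<open>b \<in> Basis\<close>]]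
    show "(\<lambda>z :: 'a. f b (z \<bullet> b)) \<in> borel_measurable borel" .
  qed
  have "(\<integral>z. (\<Prod>b\<in>Basis. f b (z \<bullet> b)) \<partial>lborel) =
      (\<integral>h. (\<Prod>b\<in>Basis. f b ((\<Sum>c\<in>Basis. h c *\<^sub>R c) \<bullet> b)) \<partial>(\<Pi>\<^sub>M b\<in>Basis. lborel))"
    by (subst lborel_eq) (rule integral_distr[OF 1 2])
  also have "\<dots> = (\<integral>h. (\<Prod>b\<in>Basis. f b (h b)) \<partial>(\<Pi>\<^sub>M b\<in>Basis. lborel))"
    by (intro Bochner_Integration.integral_cong prod.cong refl) (simp add: inner_sum_left inner_Basis if_distrib cong: if_cong)
  also have "\<dots> = (\<Prod>b\<in>Basis. \<integral>x. f b x \<partial>lborel)"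
    by (rule product_integral_prod) (auto intro: i)
  finally show ?thesis .
qed

lemma char_multivariate_normal_std:
  fixes u :: "real ^ 'm::finite"
  shows "(\<integral>z. iexp (u \<bullet> z) \<partial>multivariate_normal 0 (mat 1 :: real ^ 'm ^ 'm)) = of_real (exp (- (u \<bullet> u) / 2))"
proof -
  let ?f = "\<lambda>b x. of_real (std_normal_density x) * iexp ((u \<bullet> b) * x) :: complex"
  have i: "integrable lborel (?f b)" for b
  proof (rule Bochner_Integration.integrable_bound)
    show "integrable lborel std_normal_density"
      using integrable_normal_density[of 1 0] by simp
  qed (auto simp: norm_mult)
  have char: "(\<integral>x. ?f b x \<partial>lborel) = of_real (exp (- (u \<bullet> b)\<^sup>2 / 2))" for b
  proof -
    have "(\<integral>x. ?f b x \<partial>lborel) = char std_normal_distribution (u \<bullet> b)"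
      unfolding char_def by (subst integral_density) (auto simp: scaleR_conv_of_real)
    then show ?thesis by (simp add: char_std_normal_distribution)
  qed
  have "(\<integral>z. iexp (u \<bullet> z) \<partial>multivariate_normal 0 (mat 1 :: real ^ 'm ^ 'm)) =
      (\<integral>z. (\<Prod>b\<in>Basis. std_normal_density (z \<bullet> b)) *\<^sub>R iexp (u \<bullet> z) \<partial>lborel)"
    unfolding multivariate_normal_std prod_ennreal[OF normal_density_nonneg]
    by (rule integral_density) (auto intro!: prod_nonneg)
  also have "\<dots> = (\<integral>z. (\<Prod>b\<in>Basis. ?f b (z \<bullet> b)) \<partial>lborel)"
  proof (rule Bochner_Integration.integral_cong[OF refl])
    fix z :: "real ^ 'm"
    have "iexp (u \<bullet> z) = (\<Prod>b\<in>Basis. iexp ((u \<bullet> b) * (z \<bullet> b)))"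
      by (subst euclidean_inner) (simp add: sum_distrib_left exp_sum)
    then show "(\<Prod>b\<in>Basis. std_normal_density (z \<bullet> b)) *\<^sub>R iexp (u \<bullet> z) = (\<Prod>b\<in>Basis. ?f b (z \<bullet> b))"
      by (simp only: prod.distrib scaleR_conv_of_real of_real_prod)
  qed
  also have "\<dots> = (\<Prod>b\<in>Basis. of_real (exp (- (u \<bullet> b)\<^sup>2 / 2)))"
    unfolding char[symmetric] by (rule integral_lborel_prod[OF i])
  also have "\<dots> = of_real (exp (- (u \<bullet> u) / 2))"
  proof -
    have "- (u \<bullet> u) / 2 = (\<Sum>b\<in>Basis. - (u \<bullet> b)\<^sup>2 / 2)"
      by (subst euclidean_inner) (simp add: power2_eq_square sum_divide_distrib sum_negf)
    then show ?thesis by (simp add: exp_sum)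
  qed
  finally show ?thesis .
qed

section \<open>Trigonometric polynomials and test functions on the torus\<close>

text \<open>The complex span of the waves, so convergence of characteristic functions extends to it
  by induction over the clauses. It is closed under products as well, as Stone-Weierstrass
  requires.\<close>

inductive trig_poly :: "(real ^ 'm::finite \<Rightarrow> complex) \<Rightarrow> bool" where
  wave: "trig_poly (\<lambda>z. iexp (u \<bullet> z))"
| add: "trig_poly f \<Longrightarrow> trig_poly g \<Longrightarrow> trig_poly (\<lambda>z. f z + g z)"
| scale: "trig_poly f \<Longrightarrow> trig_poly (\<lambda>z. c * f z)"

lemma trig_poly_mult: "trig_poly f \<Longrightarrow> trig_poly g \<Longrightarrow> trig_poly (\<lambda>z. f z * g z)"
proof (induction rule: trig_poly.induct)
  case (wave u)
  from wave show ?case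
  proof (induction rule: trig_poly.induct)
    case (wave v)
    have "(\<lambda>z. iexp (u \<bullet> z) * iexp (v \<bullet> z)) = (\<lambda>z. iexp ((u + v) \<bullet> z))"
      by (simp add: inner_add_left algebra_simps flip: exp_add)
    then show ?case using trig_poly.wave[of "u + v"] by simp
  next
    case (add f g)
    then show ?case unfolding distrib_left by (intro trig_poly.add)
  next
    case (scale f c)
    then show ?case unfolding mult.left_commute[of _ c] by (intro trig_poly.scale)
  qed
next
  case (add f g)
  then show ?case unfolding distrib_right by (intro trig_poly.add)
next
  case (scale f c)
  then show ?case unfolding mult.assoc by (intro trig_poly.scale)
qed

lemma trig_poly_const: "trig_poly (\<lambda>_. c)"
  using trig_poly.scale[OF trig_poly.wave[of 0], of c] by simp

lemma trig_poly_bounded_measurable: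
  "trig_poly f \<Longrightarrow> f \<in> borel_measurable borel \<and> (\<exists>C. \<forall>z. cmod (f z) \<le> C)"
proof (induction rule: trig_poly.induct)
  case (wave u)
  then show ?case by (auto intro!: exI[of _ 1])
next
  case (add f g)
  then obtain C D where "\<And>z. cmod (f z) \<le> C" "\<And>z. cmod (g z) \<le> D" by blast
  then have "cmod (f z + g z) \<le> C + D" for z by (intro norm_triangle_le add_mono)
  with add show ?case by auto
next
  case (scale f c)
  then obtain C where "\<And>z. cmod (f z) \<le> C" by blast
  then have "cmod (c * f z) \<le> cmod c * C" for z by (simp add: norm_mult mult_left_mono)
  with scale show ?case by auto
qed

text \<open>Wraps space around a compact torus with period 2 pi L in each coordinate, which makes
  uniform approximation possible. The coordinates are waves of frequency 1 / L.\<close>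

definition torus_map :: "real \<Rightarrow> real ^ 'm \<Rightarrow> complex ^ 'm::finite" where
  "torus_map L z = (\<chi> j. cis (z $ j / L))"

lemma continuous_on_torus_map: "continuous_on UNIV (torus_map L)"
  unfolding torus_map_def cis_conv_exp divide_inverse by (intro continuous_intros)

lemma trig_poly_torus_coordinate:
  "trig_poly (\<lambda>z. of_real (Re (torus_map L z $ j)))" "trig_poly (\<lambda>z. of_real (Im (torus_map L z $ j)))"
proof -
  let ?u = "axis j (1 / L) :: real ^ 'a"
  have u: "?u \<bullet> z = z $ j / L" "(- ?u) \<bullet> z = - (z $ j / L)" for z
    by (simp_all add: inner_axis')
  have "(\<lambda>z. of_real (Re (torus_map L z $ j))) = (\<lambda>z. (1/2) * (iexp (?u \<bullet> z) + iexp ((- ?u) \<bullet> z)))"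
    unfolding u by (auto simp: torus_map_def complex_eq_iff Re_exp Im_exp)
  then show "trig_poly (\<lambda>z. of_real (Re (torus_map L z $ j)))"
    using trig_poly.scale[OF trig_poly.add[OF trig_poly.wave[of ?u] trig_poly.wave[of "- ?u"]], of "1/2"] by simp
  have "(\<lambda>z. of_real (Im (torus_map L z $ j))) = (\<lambda>z. (- \<i>/2) * (iexp (?u \<bullet> z) + (- 1) * iexp ((- ?u) \<bullet> z)))"
    unfolding u by (auto simp: torus_map_def complex_eq_iff Re_exp Im_exp)
  then show "trig_poly (\<lambda>z. of_real (Im (torus_map L z $ j)))"
    using trig_poly.scale[OF trig_poly.add[OF trig_poly.wave[of ?u] trig_poly.scale[OF trig_poly.wave[of "- ?u"], of "- 1"]], of "- \<i>/2"] by simp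
qed

text \<open>Stone-Weierstrass for the functions whose composition with \<open>torus_map\<close> is a
  trigonometric polynomial; real and imaginary parts of the coordinates separate points. It is
  applied on a ball containing the torus, whose compactness is immediate.\<close>

lemma torus_approximation:
  fixes H :: "complex ^ 'm::finite \<Rightarrow> real"
  assumes H: "continuous_on UNIV H" and e: "0 < e"
  obtains p where "trig_poly (\<lambda>z. of_real (p z))" "\<And>z. \<bar>H (torus_map L z) - p z\<bar> < e"
proof -
  let ?S = "cball 0 (real CARD('m)) :: (complex ^ 'm) set"
  have S: "torus_map L z \<in> ?S" for z
  proof -
    have "norm (torus_map L z) \<le> (\<Sum>j\<in>UNIV. norm (torus_map L z $ j))"
      unfolding norm_vec_def by (rule L2_set_le_sum) simp
    then show ?thesis by (simp add: torus_map_def)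
  qed
  define P where "P h \<longleftrightarrow> continuous_on ?S h \<and> trig_poly (\<lambda>z. of_real (h (torus_map L z)))" for h :: "complex ^ 'm \<Rightarrow> real"
  have "\<exists>h. P h \<and> (\<forall>w\<in>?S. \<bar>H w - h w\<bar> < e)"
  proof (rule Stone_Weierstrass_HOL)
    show "P (\<lambda>x. c)" for c unfolding P_def using trig_poly_const by auto
    show "P (\<lambda>x. f x + g x)" if "P f \<and> P g" for f g
      using that trig_poly.add unfolding P_def of_real_add by (auto intro: continuous_on_add)
    show "P (\<lambda>x. f x * g x)" if "P f \<and> P g" for f g
      using that trig_poly_mult unfolding P_def of_real_mult by (auto intro: continuous_on_mult)
    show "\<exists>f. P f \<and> f x \<noteq> f y" if "x \<in> ?S \<and> y \<in> ?S \<and> x \<noteq> y" for x y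
    proof -
      have "x \<noteq> y" using that by blast
      then obtain j where "x $ j \<noteq> y $ j" unfolding vec_eq_iff by blast
      then consider "Re (x $ j) \<noteq> Re (y $ j)" | "Im (x $ j) \<noteq> Im (y $ j)" by (auto simp: complex_eq_iff)
      then show ?thesis
      proof cases
        case 1
        then show ?thesis unfolding P_def
          by (intro exI[of _ "\<lambda>w. Re (w $ j)"]) (auto intro!: continuous_intros trig_poly_torus_coordinate)
      next
        case 2
        then show ?thesis unfolding P_def
          by (intro exI[of _ "\<lambda>w. Im (w $ j)"]) (auto intro!: continuous_intros trig_poly_torus_coordinate)
      qed
    qed
  qed (use H e in \<open>auto simp: P_def intro: continuous_on_subset\<close>)
  then obtain h where "P h" "\<And>w. w \<in> ?S \<Longrightarrow> \<bar>H w - h w\<bar> < e" by blast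
  then show thesis
    using S by (intro that[of "\<lambda>z. h (torus_map L z)"]) (auto simp: P_def)
qed

text \<open>The cosine factors kill the discontinuity that arises when the cube is wrapped around the torus.\<close>

definition wrap :: "real \<Rightarrow> (real ^ 'm \<Rightarrow> real) \<Rightarrow> complex ^ 'm::finite \<Rightarrow> real" where
  "wrap L g w = (\<Prod>j\<in>UNIV. max 0 (Re (w $ j))) * g (\<chi> j. L * arcsin (max (- 1) (min 1 (Im (w $ j)))))"

lemma continuous_on_wrap:
  fixes g :: "real ^ 'm::finite \<Rightarrow> real"
  assumes g: "continuous_on UNIV g"
  shows "continuous_on UNIV (wrap L g)"
proof -
  have "continuous_on UNIV (\<lambda>w :: complex ^ 'm. \<chi> j. L * arcsin (max (- 1) (min 1 (Im (w $ j)))))"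
    by (intro continuous_intros) auto
  from continuous_on_compose2[OF g this] show ?thesis
    unfolding wrap_def by (intro continuous_intros) auto
qed

lemma one_minus_prod_le:
  fixes a :: "'i \<Rightarrow> real"
  assumes "finite I" "\<And>i. i \<in> I \<Longrightarrow> 0 \<le> a i \<and> a i \<le> 1"
  shows "0 \<le> 1 - prod a I \<and> 1 - prod a I \<le> (\<Sum>i\<in>I. 1 - a i)"
  using assms
proof (induction I rule: finite_induct)
  case (insert i I)
  have p: "0 \<le> prod a I" "prod a I \<le> 1" using insert by (auto intro!: prod_nonneg prod_le_1)
  have "a i * prod a I \<le> 1 * 1" using insert.prems p by (intro mult_mono) auto
  moreover have "(1 - a i) * (1 - prod a I) \<ge> 0" using insert.prems p by auto
  then have "1 - a i * prod a I \<le> (1 - a i) + (1 - prod a I)" by (simp add: algebra_simps)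
  ultimately show ?case using insert by auto
qed simp

lemma one_minus_cos_le: "1 - cos x \<le> (x :: real)\<^sup>2 / 2"
proof -
  have "cos x = 1 - 2 * (sin (x / 2))\<^sup>2" using cos_double_sin[of "x / 2"] by simp
  moreover have "(sin (x / 2))\<^sup>2 \<le> (x / 2)\<^sup>2"
    using abs_sin_x_le_abs_x[of "x / 2"] by (simp only: abs_le_square_iff)
  ultimately show ?thesis by (simp add: power_divide)
qed

lemma wrap_torus_map_bound:
  fixes g :: "real ^ 'm::finite \<Rightarrow> real"
  assumes "\<And>z. \<bar>g z\<bar> \<le> B"
  shows "\<bar>wrap L g (torus_map L z)\<bar> \<le> B"
proof -
  have "(\<Prod>j\<in>UNIV. max 0 (Re (torus_map L z $ j))) \<le> 1" "0 \<le> (\<Prod>j\<in>UNIV. max 0 (Re (torus_map L z $ j)))"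
    by (auto intro!: prod_le_1 prod_nonneg simp: torus_map_def)
  then show ?thesis
    unfolding wrap_def abs_mult using mult_mono[OF _ assms, of _ 1] by fastforce
qed

text \<open>For coordinates of modulus at most L pi / 2 the arcsine undoes the wrapping, and the
  error comes from the cosines alone, through 1 - cos t <= t^2 / 2. Outside that cube |z|^2 / L^2 is
  at least 1 and the trivial bound 2 B applies. A quadratic bound is chosen because second moments
  control it.\<close>

lemma wrap_torus_map_approx:
  fixes g :: "real ^ 'm::finite \<Rightarrow> real"
  assumes B: "\<And>z. \<bar>g z\<bar> \<le> B" and L: "0 < L"
  shows "\<bar>g z - wrap L g (torus_map L z)\<bar> \<le> 2 * B * ((norm z)\<^sup>2 / L\<^sup>2)"
proof -
  have B0: "0 \<le> B" by (rule order_trans[OF abs_ge_zero B])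
  have nz: "(norm z)\<^sup>2 / L\<^sup>2 = (\<Sum>j\<in>UNIV. (z $ j / L)\<^sup>2)"
    by (simp add: norm_vec_def L2_set_def sum_nonneg power_divide sum_divide_distrib)
  show ?thesis
  proof (cases "\<forall>j. \<bar>z $ j / L\<bar> \<le> pi / 2")
    case True
    then have r1: "\<bar>z $ j / L\<bar> \<le> pi / 2" for j by blast
    have r: "- (pi / 2) \<le> z $ j / L" "z $ j / L \<le> pi / 2" for j
      using r1[of j] by linarith+
    have cos0: "0 \<le> cos (z $ j / L)" for j using r[of j] by (rule cos_ge_zero)
    have "(\<chi> j. L * arcsin (max (- 1) (min 1 (Im (torus_map L z $ j))))) = z"
      using r L by (simp add: torus_map_def vec_eq_iff arcsin_sin)
    then have eq: "wrap L g (torus_map L z) = (\<Prod>j\<in>UNIV. cos (z $ j / L)) * g z"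
      using cos0 by (simp add: wrap_def torus_map_def max_absorb2)
    have p: "0 \<le> 1 - (\<Prod>j\<in>UNIV. cos (z $ j / L))" "1 - (\<Prod>j\<in>UNIV. cos (z $ j / L)) \<le> (\<Sum>j\<in>UNIV. 1 - cos (z $ j / L))"
      using one_minus_prod_le[of UNIV "\<lambda>j. cos (z $ j / L)"] cos0 by auto
    have "\<bar>g z - wrap L g (torus_map L z)\<bar> = (1 - (\<Prod>j\<in>UNIV. cos (z $ j / L))) * \<bar>g z\<bar>"
      using p(1) unfolding eq by (simp add: abs_mult flip: left_diff_distrib[of 1 _ "g z", simplified])
    also have "\<dots> \<le> (\<Sum>j\<in>UNIV. (z $ j / L)\<^sup>2 / 2) * B"
      using p B B0 by (intro mult_mono order_trans[OF p(2)] sum_mono one_minus_cos_le) (auto intro: sum_nonneg)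
    also have "\<dots> = (1 / 2) * B * (\<Sum>j\<in>UNIV. (z $ j / L)\<^sup>2)" by (simp add: sum_divide_distrib[symmetric])
    also have "\<dots> \<le> 2 * B * (\<Sum>j\<in>UNIV. (z $ j / L)\<^sup>2)"
      using B0 by (intro mult_right_mono) (auto intro: sum_nonneg)
    finally show ?thesis unfolding nz .
  next
    case False
    then obtain j where j: "pi / 2 < \<bar>z $ j / L\<bar>" by (auto simp: not_le)
    then have "1 \<le> \<bar>z $ j / L\<bar>" using pi_gt3 by linarith
    then have "1 \<le> \<bar>z $ j / L\<bar>\<^sup>2" by (rule one_le_power)
    then have "1 \<le> (z $ j / L)\<^sup>2" by (simp only: power2_abs)
    also have "\<dots> \<le> (\<Sum>j\<in>UNIV. (z $ j / L)\<^sup>2)" by (rule member_le_sum) auto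
    finally have "2 * B * 1 \<le> 2 * B * ((norm z)\<^sup>2 / L\<^sup>2)"
      unfolding nz using B0 by (intro mult_left_mono) auto
    moreover have "\<bar>g z - wrap L g (torus_map L z)\<bar> \<le> 2 * B"
      using B[of z] wrap_torus_map_bound[of g B L z, OF B] by linarith
    ultimately show ?thesis by simp
  qed
qed

text \<open>For fixed L the wrapped test function is a uniform limit of trigonometric polynomials,
  so its expectations converge. Wrapping costs at most 2 B C / L^2 under the law of
  \<open>T n\<close>, eventually uniformly in n, and L is chosen large at the end.\<close>

theorem (in prob_space) multivariate_levy_continuity:
  fixes T :: "nat \<Rightarrow> 'a \<Rightarrow> real ^ 'm::finite" and N :: "(real ^ 'm) measure"
  assumes N: "prob_space N" "sets N = sets borel"
    and T[measurable]: "\<And>n. T n \<in> borel_measurable M"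
    and second: "\<forall>\<^sub>F n in sequentially. integrable M (\<lambda>w. (norm (T n w))\<^sup>2) \<and> expectation (\<lambda>w. (norm (T n w))\<^sup>2) \<le> C"
    and char: "\<And>u. (\<lambda>n. expectation (\<lambda>w. iexp (u \<bullet> T n w))) \<longlonglongrightarrow> (\<integral>z. iexp (u \<bullet> z) \<partial>N)"
    and g: "continuous_on UNIV g" "\<And>z. \<bar>g z\<bar> \<le> B"
  shows "(\<lambda>n. expectation (\<lambda>w. g (T n w) :: real)) \<longlonglongrightarrow> (\<integral>z. g z \<partial>N)"
proof -
  interpret N: prob_space N by fact
  note [measurable_cong] = N(2)
  have B0: "0 \<le> B" by (rule order_trans[OF abs_ge_zero g(2)])
  have trig: "(\<lambda>n. expectation (\<lambda>w. f (T n w))) \<longlonglongrightarrow> (\<integral>z. f z \<partial>N)" if "trig_poly f" for f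
    using that
  proof (induction rule: trig_poly.induct)
    case (wave u) show ?case by (rule char)
  next
    case (add f h)
    have i: "integrable M (\<lambda>w. f (T n w)) \<and> integrable N f" if "trig_poly f" for f n
    proof -
      note bm = trig_poly_bounded_measurable[OF that]
      obtain C where [measurable]: "f \<in> borel_measurable borel" and C: "\<And>z. cmod (f z) \<le> C"
        using bm by blast
      show ?thesis
        using C by (auto intro!: integrable_const_bound[of _ C] N.integrable_const_bound[of _ C])
    qed
    show ?case using i[OF add(1)] i[OF add(2)] tendsto_add[OF add(3,4)] by simp
  next
    case (scale f c)
    show ?case using tendsto_mult_left[OF scale(2)] by simp
  qed
  have torus: "(\<lambda>n. expectation (\<lambda>w. H (torus_map L (T n w)))) \<longlonglongrightarrow> (\<integral>z. H (torus_map L z) \<partial>N)"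
    if H: "continuous_on UNIV H" and Hb: "\<And>z. \<bar>H (torus_map L z)\<bar> \<le> D" for H :: "complex ^ 'm \<Rightarrow> real" and L D
  proof (rule LIMSEQ_I)
    fix e :: real assume e: "0 < e"
    obtain p where p: "trig_poly (\<lambda>z. of_real (p z))" "\<And>z. \<bar>H (torus_map L z) - p z\<bar> < e / 3"
      using torus_approximation[OF H, of "e / 3" L] e by auto
    from borel_measurable_continuous_onI[OF continuous_on_compose2[OF H continuous_on_torus_map]]
    have Hm[measurable]: "(\<lambda>z. H (torus_map L z)) \<in> borel_measurable borel" by auto
    have [measurable]: "(\<lambda>z. complex_of_real (p z)) \<in> borel_measurable borel"
      using trig_poly_bounded_measurable[OF p(1)] by blast
    have "(\<lambda>z. Re (complex_of_real (p z))) \<in> borel_measurable borel" by measurable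
    then have pm[measurable]: "p \<in> borel_measurable borel" by simp
    obtain D' where D': "\<And>z. \<bar>p z\<bar> \<le> D'" using trig_poly_bounded_measurable[OF p(1)] by auto
    have close: "\<bar>(\<integral>w. H (torus_map L (f w)) \<partial>\<mu>) - (\<integral>w. p (f w) \<partial>\<mu>)\<bar> \<le> e / 3"
      if "prob_space \<mu>" and [measurable]: "f \<in> borel_measurable \<mu>" for \<mu> :: "'b measure" and f
    proof -
      interpret \<mu>: prob_space \<mu> by fact
      have i: "integrable \<mu> (\<lambda>w. H (torus_map L (f w)))" "integrable \<mu> (\<lambda>w. p (f w))"
        using Hb D' by (auto intro: \<mu>.integrable_const_bound[of _ D] \<mu>.integrable_const_bound[of _ D'])
      have "\<bar>(\<integral>w. H (torus_map L (f w)) \<partial>\<mu>) - (\<integral>w. p (f w) \<partial>\<mu>)\<bar> = \<bar>\<integral>w. H (torus_map L (f w)) - p (f w) \<partial>\<mu>\<bar>"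
        using i by simp
      also have "\<dots> \<le> (\<integral>w. \<bar>H (torus_map L (f w)) - p (f w)\<bar> \<partial>\<mu>)" by (rule integral_abs_bound)
      also have "\<dots> \<le> (\<integral>w. e / 3 \<partial>\<mu>)"
        using i p(2) by (intro integral_mono) (auto intro: less_imp_le)
      finally show ?thesis by (simp add: \<mu>.prob_space)
    qed
    have "(\<lambda>n. Re (expectation (\<lambda>w. of_real (p (T n w))))) \<longlonglongrightarrow> Re (\<integral>z. of_real (p z) \<partial>N)"
      by (rule tendsto_Re[OF trig[OF p(1)]])
    then have lim: "(\<lambda>n. expectation (\<lambda>w. p (T n w))) \<longlonglongrightarrow> (\<integral>z. p z \<partial>N)" by simp
    have "0 < e / 3" using e by simp
    from LIMSEQ_D[OF lim this]
    obtain n0 where n0: "\<forall>n\<ge>n0. norm (expectation (\<lambda>w. p (T n w)) - (\<integral>z. p z \<partial>N)) < e / 3" ..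
    have N1: "\<bar>(\<integral>z. H (torus_map L z) \<partial>N) - (\<integral>z. p z \<partial>N)\<bar> \<le> e / 3" by (rule close[OF N(1)]) simp
    have M1: "\<bar>expectation (\<lambda>w. H (torus_map L (T n w))) - expectation (\<lambda>w. p (T n w))\<bar> \<le> e / 3" for n
      by (rule close[OF prob_space_axioms T])
    have "\<bar>expectation (\<lambda>w. H (torus_map L (T n w))) - (\<integral>z. H (torus_map L z) \<partial>N)\<bar> < e" if "n0 \<le> n" for n
      using n0[rule_format, OF that, unfolded real_norm_def] N1 M1[of n] by linarith
    then show "\<exists>no. \<forall>n\<ge>no. norm (expectation (\<lambda>w. H (torus_map L (T n w))) - (\<integral>z. H (torus_map L z) \<partial>N)) < e"
      unfolding real_norm_def by (intro exI[of _ n0] allI impI)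
  qed
  have gm[measurable]: "g \<in> borel_measurable borel" using g(1) by (rule borel_measurable_continuous_onI)
  have wm[measurable]: "(\<lambda>z. wrap L g (torus_map L z)) \<in> borel_measurable borel" for L
    using borel_measurable_continuous_onI[OF continuous_on_compose2[OF continuous_on_wrap[OF g(1)] continuous_on_torus_map]] by auto
  have wb: "\<bar>wrap L g (torus_map L z)\<bar> \<le> B" for L z by (rule wrap_torus_map_bound[OF g(2)])
  \<comment> \<open>No moments of \<open>N\<close> are assumed, so under \<open>N\<close> the
    wrapping is removed by dominated convergence instead of the quadratic bound.\<close>
  have Nlim: "(\<lambda>k. (\<integral>z. wrap (real (Suc k)) g (torus_map (real (Suc k)) z) \<partial>N)) \<longlonglongrightarrow> (\<integral>z. g z \<partial>N)"
  proof (rule integral_dominated_convergence[where w = "\<lambda>_. B"])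
    have "(\<lambda>k. wrap (real (Suc k)) g (torus_map (real (Suc k)) z)) \<longlonglongrightarrow> g z" for z
    proof -
      have "(\<lambda>k. wrap (real (Suc k)) g (torus_map (real (Suc k)) z) - g z) \<longlonglongrightarrow> 0"
      proof (rule Lim_null_comparison)
        show "\<forall>\<^sub>F k in sequentially. norm (wrap (real (Suc k)) g (torus_map (real (Suc k)) z) - g z) \<le> 2 * B * ((norm z)\<^sup>2 * (inverse (real (Suc k)))\<^sup>2)"
        proof (rule always_eventually, rule allI)
          fix k
          show "norm (wrap (real (Suc k)) g (torus_map (real (Suc k)) z) - g z) \<le> 2 * B * ((norm z)\<^sup>2 * (inverse (real (Suc k)))\<^sup>2)"
            unfolding real_norm_def abs_minus_commute[of _ "g z"] power_inverse divide_inverse[symmetric]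
            by (rule wrap_torus_map_approx[OF g(2)]) simp
        qed
        have "(\<lambda>k. 2 * B * ((norm z)\<^sup>2 * (inverse (real (Suc k)))\<^sup>2)) \<longlonglongrightarrow> 2 * B * ((norm z)\<^sup>2 * 0\<^sup>2)"
          by (intro tendsto_intros LIMSEQ_inverse_real_of_nat)
        then show "(\<lambda>k. 2 * B * ((norm z)\<^sup>2 * (inverse (real (Suc k)))\<^sup>2)) \<longlonglongrightarrow> 0" by simp
      qed
      then show ?thesis by (rule LIM_zero_cancel)
    qed
    then show "AE z in N. (\<lambda>k. wrap (real (Suc k)) g (torus_map (real (Suc k)) z)) \<longlonglongrightarrow> g z" by simp
  qed (use wb in auto)
  show ?thesis
  proof (rule LIMSEQ_I)
    fix e :: real assume e: "0 < e"
    have "(\<lambda>k. 2 * B * (C * (inverse (real (Suc k)))\<^sup>2)) \<longlonglongrightarrow> 2 * B * (C * 0\<^sup>2)"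
      by (intro tendsto_intros LIMSEQ_inverse_real_of_nat)
    then have "\<forall>\<^sub>F k in sequentially. 2 * B * (C * (inverse (real (Suc k)))\<^sup>2) < e / 3"
      by (rule order_tendstoD) (use e in auto)
    moreover have "\<forall>\<^sub>F k in sequentially. dist (\<integral>z. wrap (real (Suc k)) g (torus_map (real (Suc k)) z) \<partial>N) (\<integral>z. g z \<partial>N) < e / 3"
      using tendstoD[OF Nlim, of "e / 3"] e by simp
    ultimately have "\<forall>\<^sub>F k in sequentially. 2 * B * (C * (inverse (real (Suc k)))\<^sup>2) < e / 3 \<and>
        dist (\<integral>z. wrap (real (Suc k)) g (torus_map (real (Suc k)) z) \<partial>N) (\<integral>z. g z \<partial>N) < e / 3"
      by (rule eventually_conj)
    then obtain k where k: "2 * B * (C * (inverse (real (Suc k)))\<^sup>2) < e / 3"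
        "dist (\<integral>z. wrap (real (Suc k)) g (torus_map (real (Suc k)) z) \<partial>N) (\<integral>z. g z \<partial>N) < e / 3"
      using eventually_happens'[OF sequentially_bot] by blast
    define L where "L = real (Suc k)"
    have L: "0 < L" by (simp add: L_def)
    have near: "\<forall>\<^sub>F n in sequentially. \<bar>expectation (\<lambda>w. g (T n w)) - expectation (\<lambda>w. wrap L g (torus_map L (T n w)))\<bar> < e / 3"
      using second
    proof eventually_elim
      case (elim n)
      have i: "integrable M (\<lambda>w. g (T n w))" "integrable M (\<lambda>w. wrap L g (torus_map L (T n w)))"
        using g(2) wb by (auto intro!: integrable_const_bound[of _ B])
      have "\<bar>expectation (\<lambda>w. g (T n w)) - expectation (\<lambda>w. wrap L g (torus_map L (T n w)))\<bar> =
          \<bar>expectation (\<lambda>w. g (T n w) - wrap L g (torus_map L (T n w)))\<bar>"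
        by (simp only: Bochner_Integration.integral_diff[OF i])
      also have "\<dots> \<le> expectation (\<lambda>w. \<bar>g (T n w) - wrap L g (torus_map L (T n w))\<bar>)" by (rule integral_abs_bound)
      also have "\<dots> \<le> expectation (\<lambda>w. 2 * B * ((norm (T n w))\<^sup>2 / L\<^sup>2))"
      proof (rule integral_mono)
        show "integrable M (\<lambda>w. \<bar>g (T n w) - wrap L g (torus_map L (T n w))\<bar>)"
          by (intro integrable_abs Bochner_Integration.integrable_diff i)
        show "integrable M (\<lambda>w. 2 * B * ((norm (T n w))\<^sup>2 / L\<^sup>2))"
          using elim by (intro integrable_mult_right integrable_divide) blast
      qed (rule wrap_torus_map_approx[OF g(2) L])
      also have "\<dots> = 2 * B * (expectation (\<lambda>w. (norm (T n w))\<^sup>2) / L\<^sup>2)" by simp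
      also have "\<dots> \<le> 2 * B * (C / L\<^sup>2)"
        using elim B0 by (intro mult_left_mono divide_right_mono) auto
      also have "\<dots> = 2 * B * (C * (inverse (real (Suc k)))\<^sup>2)"
        by (simp add: L_def divide_inverse power_inverse)
      finally show ?case using k(1) by linarith
    qed
    have mid: "\<forall>\<^sub>F n in sequentially. dist (expectation (\<lambda>w. wrap L g (torus_map L (T n w)))) (\<integral>z. wrap L g (torus_map L z) \<partial>N) < e / 3"
      by (rule tendstoD[OF torus[OF continuous_on_wrap[OF g(1)] wb]]) (use e in auto)
    have "\<forall>\<^sub>F n in sequentially. norm (expectation (\<lambda>w. g (T n w)) - (\<integral>z. g z \<partial>N)) < e"
      using near mid
    proof eventually_elim
      case (elim n)
      then show ?case using k(2) unfolding L_def[symmetric] dist_real_def real_norm_def by linarith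
    qed
    then show "\<exists>no. \<forall>n\<ge>no. norm (expectation (\<lambda>w. g (T n w)) - (\<integral>z. g z \<partial>N)) < e"
      by (simp add: eventually_sequentially)
  qed
qed

section \<open>The kernel density estimator\<close>

text \<open>Where \<open>T n\<close> is bounded by A and every \<open>D n j\<close> is close to
  \<open>c j\<close>, the two vectors are close and uniform continuity of \<open>g\<close> on a ball
  applies. The complement is controlled by second moments. Since the relation is asked for only
  where \<open>D n j\<close> is positive, any values elsewhere are absorbed by the
  complement.\<close>

lemma (in prob_space) slutsky_ratio:
  fixes T S :: "nat \<Rightarrow> 'a \<Rightarrow> real ^ 'm::finite" and D :: "nat \<Rightarrow> 'm \<Rightarrow> 'a \<Rightarrow> real" and c :: "'m \<Rightarrow> real"
  assumes T[measurable]: "\<And>n. T n \<in> borel_measurable M" and S[measurable]: "\<And>n. S n \<in> borel_measurable M"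
    and c: "\<And>j. 0 < c j"
    and second: "\<forall>\<^sub>F n in sequentially. integrable M (\<lambda>w. (norm (T n w))\<^sup>2) \<and> expectation (\<lambda>w. (norm (T n w))\<^sup>2) \<le> C"
    and D: "\<And>n j. integrable M (\<lambda>w. (D n j w - c j)\<^sup>2)" "\<And>j. (\<lambda>n. expectation (\<lambda>w. (D n j w - c j)\<^sup>2)) \<longlonglongrightarrow> 0"
    and rel: "\<forall>\<^sub>F n in sequentially. \<forall>w j. 0 < D n j w \<longrightarrow> S n w $ j = T n w $ j * sqrt (c j / D n j w)"
    and g: "continuous_on UNIV g" "\<And>z. \<bar>g z\<bar> \<le> B"
    and lim: "(\<lambda>n. expectation (\<lambda>w. g (T n w) :: real)) \<longlonglongrightarrow> l"
  shows "(\<lambda>n. expectation (\<lambda>w. g (S n w))) \<longlonglongrightarrow> l"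
proof -
  have gm[measurable]: "g \<in> borel_measurable borel" using g(1) by (rule borel_measurable_continuous_onI)
  have B0: "0 \<le> B" by (rule order_trans[OF abs_ge_zero g(2)])
  have "(\<lambda>n. expectation (\<lambda>w. g (S n w)) - expectation (\<lambda>w. g (T n w))) \<longlonglongrightarrow> 0"
  proof (rule tendstoI)
    fix e :: real assume e: "0 < e"
    \<comment> \<open>Large enough for Chebyshev: the event that \<open>T n\<close> exceeds A in
      norm then costs less than e / 3.\<close>
    define A where "A = 1 + 6 * B * \<bar>C\<bar> / e"
    have A1: "1 \<le> A" using B0 e by (simp add: A_def)
    have "6 * B * \<bar>C\<bar> < A * e" using e by (simp add: A_def field_simps)
    also have "A * e \<le> A\<^sup>2 * e" using A1 e by (intro mult_right_mono) (auto simp: power2_eq_square)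
    finally have A2: "2 * B * (\<bar>C\<bar> / A\<^sup>2) < e / 3" using A1 by (simp add: field_simps)
    have "uniformly_continuous_on (cball 0 (A + 1)) g"
      by (rule compact_uniformly_continuous) (auto intro: continuous_on_subset[OF g(1)])
    then obtain d where d: "0 < d" and gd: "\<And>y z. y \<in> cball 0 (A + 1) \<Longrightarrow> z \<in> cball 0 (A + 1) \<Longrightarrow> dist z y < d \<Longrightarrow> dist (g z) (g y) < e / 3"
      unfolding uniformly_continuous_on_def using e by (metis divide_pos_pos zero_less_numeral)
    define d' where "d' = min d 1"
    \<comment> \<open>If every ratio deviates from 1 by less than \<omega>, a vector of norm at most
      A moves by at most CARD('m) * A * \<omega> = d' / 2. The cap 1 in \<open>d'\<close> keeps the
      moved vector in the ball of radius A + 1.\<close>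
    define \<omega> where "\<omega> = d' / (2 * real CARD('m) * A)"
    have d': "0 < d'" "d' \<le> 1" "d' \<le> d" using d by (auto simp: d'_def)
    have \<omega>: "0 < \<omega>" using d' A1 by (auto simp: \<omega>_def)
    have "\<exists>\<eta>>0. \<forall>t. \<bar>t - c j\<bar> < \<eta> \<longrightarrow> 0 < t \<and> \<bar>sqrt (c j / t) - 1\<bar> < \<omega>" for j
    proof -
      have "((\<lambda>t. sqrt (c j / t)) \<longlongrightarrow> sqrt (c j / c j)) (nhds (c j))"
        by (intro tendsto_intros filterlim_ident) (use c[of j] in auto)
      then have "\<forall>\<^sub>F t in nhds (c j). dist (sqrt (c j / t)) 1 < \<omega>"
        using c[of j] tendstoD[OF _ \<omega>] by fastforce
      moreover have "\<forall>\<^sub>F t in nhds (c j). 0 < t"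
        by (rule order_tendstoD(1)[OF filterlim_ident c])
      ultimately have "\<forall>\<^sub>F t in nhds (c j). 0 < t \<and> dist (sqrt (c j / t)) 1 < \<omega>"
        by eventually_elim simp
      then show ?thesis unfolding eventually_nhds_metric dist_real_def by simp
    qed
    then obtain \<eta>' where \<eta>': "\<And>j. 0 < \<eta>' j" "\<And>j t. \<bar>t - c j\<bar> < \<eta>' j \<Longrightarrow> 0 < t \<and> \<bar>sqrt (c j / t) - 1\<bar> < \<omega>"
      by metis
    define \<eta> where "\<eta> = Min (range \<eta>')"
    have \<eta>0: "0 < \<eta>" unfolding \<eta>_def using \<eta>'(1) by (subst Min_gr_iff) auto
    have \<eta>: "0 < t \<and> \<bar>sqrt (c j / t) - 1\<bar> < \<omega>" if "\<bar>t - c j\<bar> < \<eta>" for j t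
    proof (rule \<eta>'(2))
      have "\<eta> \<le> \<eta>' j" unfolding \<eta>_def by (rule Min_le) auto
      with that show "\<bar>t - c j\<bar> < \<eta>' j" by simp
    qed
    define R where "R n = 2 * B * (\<Sum>j\<in>UNIV. expectation (\<lambda>w. (D n j w - c j)\<^sup>2) / \<eta>\<^sup>2)" for n
    have "R \<longlonglongrightarrow> 2 * B * (\<Sum>j\<in>(UNIV::'m set). 0 / \<eta>\<^sup>2)"
      unfolding R_def[abs_def] by (intro tendsto_intros D(2)) (use \<eta>0 in auto)
    then have "R \<longlonglongrightarrow> 0" by simp
    then have "\<forall>\<^sub>F n in sequentially. R n < e / 3" by (rule order_tendstoD(2)) (use e in simp)
    then show "\<forall>\<^sub>F n in sequentially. dist (expectation (\<lambda>w. g (S n w)) - expectation (\<lambda>w. g (T n w))) 0 < e"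
      using second rel
    proof eventually_elim
      case (elim n)
      have iT: "integrable M (\<lambda>w. (norm (T n w))\<^sup>2)" and CT: "expectation (\<lambda>w. (norm (T n w))\<^sup>2) \<le> C"
        using elim(2) by auto
      \<comment> \<open>Chebyshev in pointwise form: off the good event the bracket is at least 1,
        so that it covers the trivial bound 2 B. Integrating \<open>h\<close> avoids estimating the
        probability of the bad event separately.\<close>
      define h where "h w = e / 3 + 2 * B * ((norm (T n w))\<^sup>2 / A\<^sup>2 + (\<Sum>j\<in>UNIV. (D n j w - c j)\<^sup>2 / \<eta>\<^sup>2))" for w
      have s0: "0 \<le> (\<Sum>j\<in>UNIV. (D n j w - c j)\<^sup>2 / \<eta>\<^sup>2)" for w by (intro sum_nonneg) auto
      have h0: "e / 3 \<le> h w" for w unfolding h_def using B0 s0[of w] by simp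
      have big: "\<bar>g (S n w) - g (T n w)\<bar> \<le> h w"
        if ge: "1 \<le> (norm (T n w))\<^sup>2 / A\<^sup>2 + (\<Sum>j\<in>UNIV. (D n j w - c j)\<^sup>2 / \<eta>\<^sup>2)" for w
      proof -
        have "\<bar>g (S n w) - g (T n w)\<bar> \<le> 2 * B * 1"
          using g(2)[of "S n w"] g(2)[of "T n w"] by linarith
        also have "\<dots> \<le> 2 * B * ((norm (T n w))\<^sup>2 / A\<^sup>2 + (\<Sum>j\<in>UNIV. (D n j w - c j)\<^sup>2 / \<eta>\<^sup>2))"
          using ge B0 by (intro mult_left_mono) auto
        finally show ?thesis unfolding h_def using e by linarith
      qed
      have pt: "\<bar>g (S n w) - g (T n w)\<bar> \<le> h w" for w
      proof -
        consider "norm (T n w) \<le> A" "\<And>j. \<bar>D n j w - c j\<bar> < \<eta>" | "A < norm (T n w)" | j where "\<eta> \<le> \<bar>D n j w - c j\<bar>"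
          by (meson not_le)
        then show ?thesis
        proof cases
          case 1
          have "norm (S n w - T n w) \<le> (\<Sum>j\<in>UNIV. \<bar>(S n w - T n w) $ j\<bar>)" by (rule norm_le_l1_cart)
          also have "\<dots> \<le> (\<Sum>j\<in>(UNIV::'m set). A * \<omega>)"
          proof (rule sum_mono)
            fix j :: 'm
            have "(S n w - T n w) $ j = T n w $ j * (sqrt (c j / D n j w) - 1)"
              using elim(3) \<eta>[OF 1(2)] by (simp add: algebra_simps)
            moreover have "\<bar>T n w $ j\<bar> \<le> A" using component_le_norm_cart[of "T n w" j] 1(1) by simp
            ultimately show "\<bar>(S n w - T n w) $ j\<bar> \<le> A * \<omega>"
              using \<eta>[OF 1(2), of j] A1 unfolding abs_mult by (auto intro!: mult_mono simp: abs_mult)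
          qed
          also have "\<dots> = d' / 2" using A1 by (simp add: \<omega>_def)
          finally have close: "norm (S n w - T n w) \<le> d' / 2" .
          have "norm (S n w) \<le> A + 1"
            using norm_triangle_sub[of "S n w" "T n w"] close d' 1(1) by linarith
          then have "dist (g (S n w)) (g (T n w)) < e / 3"
            using 1(1) close d' by (intro gd) (auto simp: dist_norm)
          then show ?thesis using h0[of w] by (simp add: dist_real_def)
        next
          case 2
          then have "A\<^sup>2 \<le> (norm (T n w))\<^sup>2" using A1 by (intro power_mono) auto
          then have "1 \<le> (norm (T n w))\<^sup>2 / A\<^sup>2" using A1 by simp
          with s0[of w] show ?thesis by (intro big) simp
        next
          case 3
          then have "\<eta>\<^sup>2 \<le> \<bar>D n j w - c j\<bar>\<^sup>2" using \<eta>0 by (intro power_mono) auto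
          then have "1 \<le> (D n j w - c j)\<^sup>2 / \<eta>\<^sup>2" using \<eta>0 by simp
          also have "\<dots> \<le> (\<Sum>j\<in>UNIV. (D n j w - c j)\<^sup>2 / \<eta>\<^sup>2)"
            by (rule member_le_sum) auto
          finally have "1 \<le> (\<Sum>j\<in>UNIV. (D n j w - c j)\<^sup>2 / \<eta>\<^sup>2)" .
          moreover have "0 \<le> (norm (T n w))\<^sup>2 / A\<^sup>2" by simp
          ultimately show ?thesis by (intro big) linarith
        qed
      qed
      have ig: "integrable M (\<lambda>w. g (S n w))" "integrable M (\<lambda>w. g (T n w))"
        by (rule integrable_bounded[of _ B]; use g(2) in simp)+
      have isum: "integrable M (\<lambda>w. \<Sum>j\<in>UNIV. (D n j w - c j)\<^sup>2 / \<eta>\<^sup>2)"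
        by (intro Bochner_Integration.integrable_sum integrable_divide D(1))
      have ih: "integrable M h" unfolding h_def
        by (intro Bochner_Integration.integrable_add integrable_mult_right integrable_divide integrable_const iT isum)
      have "\<bar>expectation (\<lambda>w. g (S n w)) - expectation (\<lambda>w. g (T n w))\<bar> = \<bar>expectation (\<lambda>w. g (S n w) - g (T n w))\<bar>"
        by (simp only: Bochner_Integration.integral_diff[OF ig])
      also have "\<dots> \<le> expectation (\<lambda>w. \<bar>g (S n w) - g (T n w)\<bar>)" by (rule integral_abs_bound)
      also have "\<dots> \<le> expectation h"
        by (rule integral_mono[OF _ ih pt]) (intro integrable_abs Bochner_Integration.integrable_diff ig)
      also have "expectation h = e / 3 + 2 * B * (expectation (\<lambda>w. (norm (T n w))\<^sup>2) / A\<^sup>2 + (\<Sum>j\<in>UNIV. expectation (\<lambda>w. (D n j w - c j)\<^sup>2) / \<eta>\<^sup>2))"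
      proof -
        have "expectation h = e / 3 + 2 * B * (expectation (\<lambda>w. (norm (T n w))\<^sup>2) / A\<^sup>2 + expectation (\<lambda>w. \<Sum>j\<in>UNIV. (D n j w - c j)\<^sup>2 / \<eta>\<^sup>2))"
          unfolding h_def using iT isum by (simp add: prob_space)
        also have "expectation (\<lambda>w. \<Sum>j\<in>UNIV. (D n j w - c j)\<^sup>2 / \<eta>\<^sup>2) = (\<Sum>j\<in>UNIV. expectation (\<lambda>w. (D n j w - c j)\<^sup>2) / \<eta>\<^sup>2)"
          by (subst Bochner_Integration.integral_sum) (auto intro: integrable_divide D(1))
        finally show ?thesis .
      qed
      also have "\<dots> \<le> e / 3 + (2 * B * (\<bar>C\<bar> / A\<^sup>2) + R n)"
      proof -
        have "2 * B * (expectation (\<lambda>w. (norm (T n w))\<^sup>2) / A\<^sup>2) \<le> 2 * B * (\<bar>C\<bar> / A\<^sup>2)"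
          using CT B0 by (intro mult_left_mono divide_right_mono) auto
        then show ?thesis unfolding R_def by (simp add: distrib_left)
      qed
      also have "\<dots> < e" using A2 elim(1) by linarith
      finally show ?case by simp
    qed
  qed
  from tendsto_add[OF this lim] show ?thesis by simp
qed

section \<open>Central limit theorem for the estimator at finitely many points\<close>

locale kernel_estimation = reversible_chain M X + kernel K
  for M :: "'w measure" and X :: "int \<Rightarrow> 'w \<Rightarrow> real" and K :: "real \<Rightarrow> real" +
  fixes f :: "real \<Rightarrow> real" and f2 :: "real \<times> real \<Rightarrow> real" and b :: "nat \<Rightarrow> real" and x :: "'m::finite \<Rightarrow> real"
  assumes f_nonneg: "0 \<le> f t"
    and f_density: "distributed M lborel (X 0) f"
    and mixing: "summable (\<lambda>k. real (Suc k) * alpha_mixing M X (Suc k))"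
    and b_pos: "\<forall>n\<ge>1. 0 < b n"
    and b_lim: "b \<longlonglongrightarrow> 0"
    and nb4: "filterlim (\<lambda>n. real n * b n ^ 4) at_top sequentially"
    and x_inj: "inj x"
    and f_cont: "isCont f (x j)"
    and f_nonzero: "f (x j) \<noteq> 0"
    and f2_nonneg: "0 \<le> f2 p"
    and f2_density: "distributed M (lborel \<Otimes>\<^sub>M lborel) (\<lambda>\<omega>. (X 0 \<omega>, X 2 \<omega>)) f2"
    and f2_bounded: "\<exists>r>0. \<exists>C. \<forall>s t. \<bar>s\<bar> < r \<and> \<bar>t\<bar> < r \<longrightarrow> \<bar>f2 (x i + s, x j + t)\<bar> < C"
begin

definition \<kappa> :: real where "\<kappa> = (LINT u|lborel. (K u)\<^sup>2)"

definition Kern :: "'m \<Rightarrow> nat \<Rightarrow> real \<Rightarrow> real" where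
  "Kern j n y = K ((x j - y) / b n)"

definition Kc :: "'m \<Rightarrow> nat \<Rightarrow> real \<Rightarrow> real" where
  "Kc j n y = Kern j n y - expectation (\<lambda>w. Kern j n (X 0 w))"

text \<open>The summand of the Cramer-Wold reduction. A weighted combination of the centred kernels
  is again one function of a single coordinate, so the scalar \<open>triangular_clt\<close> applies
  to it.\<close>

definition G :: "('m \<Rightarrow> real) \<Rightarrow> nat \<Rightarrow> real \<Rightarrow> real" where
  "G a n y = (\<Sum>j\<in>UNIV. a j * Kc j n y)"

lemma f_pos: "0 < f (x j)"
  using f_nonneg[of "x j"] f_nonzero[of j] by simp

lemma \<kappa>_pos: "0 < \<kappa>"
  unfolding \<kappa>_def by (rule integral_K2_pos)

lemma Kern_measurable [measurable]: "Kern j n \<in> borel_measurable borel"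
  unfolding Kern_def by measurable

lemma Kern_bdd: "bdd_borel (Kern j n)"
  by (rule bdd_borelI[OF Kern_measurable, of j n "K 0"]) (simp only: Kern_def abs_K_le)

lemma Kc_measurable [measurable]: "Kc j n \<in> borel_measurable borel"
  unfolding Kc_def by measurable

lemma Kern_expectation_nonneg: "0 \<le> expectation (\<lambda>w. Kern j n (X 0 w))"
  by (rule Bochner_Integration.integral_nonneg) (simp add: Kern_def nonneg)

lemma Kern_expectation_le: "expectation (\<lambda>w. Kern j n (X 0 w)) \<le> K 0"
proof -
  have "expectation (\<lambda>w. Kern j n (X 0 w)) \<le> expectation (\<lambda>w. K 0)"
    by (rule integral_mono[OF integrable_bdd_borel[OF Kern_bdd]]) (simp_all add: Kern_def K_le_K0)
  then show ?thesis by (simp add: prob_space)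
qed

lemma Kc_abs_le: "\<bar>Kc j n y\<bar> \<le> 2 * K 0"
proof -
  have "\<bar>Kern j n y\<bar> \<le> K 0" "\<bar>expectation (\<lambda>w. Kern j n (X 0 w))\<bar> \<le> K 0"
    using Kern_expectation_nonneg[of j n] Kern_expectation_le[of j n] by (simp_all only: Kern_def abs_K_le abs_of_nonneg)
  from order_trans[OF abs_triangle_ineq4 add_mono[OF this]]
  show ?thesis unfolding Kc_def by simp
qed

lemma Kc_bdd: "bdd_borel (Kc j n)"
  by (rule bdd_borelI[OF Kc_measurable Kc_abs_le])

lemma Kc_expectation: "expectation (\<lambda>w. Kc j n (X 0 w)) = 0"
  unfolding Kc_def using integrable_bdd_borel[OF Kern_bdd] by (simp add: prob_space)

lemma Kc_product_expectation:
  "expectation (\<lambda>w. Kc i n (X 0 w) * Kc j n (X k w)) =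
    expectation (\<lambda>w. Kern i n (X 0 w) * Kern j n (X k w)) - expectation (\<lambda>w. Kern i n (X 0 w)) * expectation (\<lambda>w. Kern j n (X 0 w))"
proof -
  let ?e = "\<lambda>i. expectation (\<lambda>w. Kern i n (X 0 w))"
  note ii = integrable_bdd_borel[OF Kern_bdd] integrable_bdd_borel_mult[OF Kern_bdd Kern_bdd]
  have "expectation (\<lambda>w. Kc i n (X 0 w) * Kc j n (X k w)) =
    expectation (\<lambda>w. Kern i n (X 0 w) * Kern j n (X k w) - ?e j * Kern i n (X 0 w) - ?e i * Kern j n (X k w) + ?e i * ?e j)"
    by (simp only: Kc_def algebra_simps)
  also have "\<dots> = expectation (\<lambda>w. Kern i n (X 0 w) * Kern j n (X k w)) - ?e j * ?e i - ?e i * expectation (\<lambda>w. Kern j n (X k w)) + ?e i * ?e j"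
    using ii by (simp add: prob_space)
  also have "expectation (\<lambda>w. Kern j n (X k w)) = ?e j"
    by (rule expectation_shift) measurable
  finally show ?thesis by (simp add: algebra_simps)
qed

lemma Kern_mean: "(\<lambda>n. expectation (\<lambda>w. Kern j n (X 0 w)) / b n) \<longlonglongrightarrow> f (x j)"
  using kernel_mean[OF prob_space_axioms f_density f_nonneg f_cont[of j] b_pos b_lim]
  by (simp only: Kern_def)

text \<open>Centring subtracts a product of two means, each of order b, which vanishes after
  division by b. The raw moments are those of \<open>kernel_second_moment\<close> on the diagonal
  and \<open>kernel_cross_moment\<close> off it.\<close>

lemma Kc_variance:
  "(\<lambda>n. expectation (\<lambda>w. Kc i n (X 0 w) * Kc j n (X 0 w)) / b n) \<longlonglongrightarrow> (if i = j then f (x i) * \<kappa> else 0)"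
proof -
  have 1: "(\<lambda>n. expectation (\<lambda>w. Kern i n (X 0 w) * Kern j n (X 0 w)) / b n) \<longlonglongrightarrow> (if i = j then f (x i) * \<kappa> else 0)"
  proof (cases "i = j")
    case True
    then show ?thesis
      using kernel_second_moment[OF prob_space_axioms f_density f_nonneg f_cont[of i] b_pos b_lim]
      by (simp add: Kern_def \<kappa>_def)
  next
    case False
    then have "x i \<noteq> x j" using x_inj by (auto dest: injD)
    with False show ?thesis
      using kernel_cross_moment[OF prob_space_axioms measurable_X _ b_pos b_lim, of "x i" "x j" 0]
      by (simp add: Kern_def)
  qed
  have "(\<lambda>n. b n * ((expectation (\<lambda>w. Kern i n (X 0 w)) / b n) * (expectation (\<lambda>w. Kern j n (X 0 w)) / b n))) \<longlonglongrightarrow> 0 * (f (x i) * f (x j))"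
    by (intro tendsto_mult b_lim Kern_mean)
  from tendsto_diff[OF 1 this] have "(\<lambda>n. expectation (\<lambda>w. Kern i n (X 0 w) * Kern j n (X 0 w)) / b n -
      b n * ((expectation (\<lambda>w. Kern i n (X 0 w)) / b n) * (expectation (\<lambda>w. Kern j n (X 0 w)) / b n)))
    \<longlonglongrightarrow> (if i = j then f (x i) * \<kappa> else 0)" by simp
  then show ?thesis
  proof (rule Lim_transform_eventually)
    show "\<forall>\<^sub>F n in sequentially. expectation (\<lambda>w. Kern i n (X 0 w) * Kern j n (X 0 w)) / b n -
      b n * ((expectation (\<lambda>w. Kern i n (X 0 w)) / b n) * (expectation (\<lambda>w. Kern j n (X 0 w)) / b n)) =
      expectation (\<lambda>w. Kc i n (X 0 w) * Kc j n (X 0 w)) / b n"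
      using eventually_ge_at_top[of 1]
    proof eventually_elim
      case (elim n)
      then have "b n \<noteq> 0" using b_pos by fastforce
      then show ?case unfolding Kc_product_expectation by (simp add: diff_divide_distrib)
    qed
  qed
qed

text \<open>The raw product is O(b^2) by local boundedness of the pair density, and the subtracted
  product of means is O(b^2) by \<open>Kern_mean\<close>.\<close>

lemma Kc_lag2:
  "\<exists>D>0. \<forall>\<^sub>F n in sequentially. \<bar>expectation (\<lambda>w. Kc i n (X 0 w) * Kc j n (X 2 w))\<bar> \<le> D * (b n)\<^sup>2"
proof -
  obtain r C where r: "0 < r" and C: "\<And>s t. \<bar>s\<bar> < r \<and> \<bar>t\<bar> < r \<longrightarrow> \<bar>f2 (x i + s, x j + t)\<bar> < C"
    using f2_bounded[of i j] by blast
  have le: "f2 (x i + s, x j + t) \<le> C" if "\<bar>s\<bar> < r" "\<bar>t\<bar> < r" for s t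
    using C[of s t] that by auto
  have "0 < C" using C[of 0 0] r by auto
  have ev: "\<forall>\<^sub>F n in sequentially. expectation (\<lambda>w. Kern i n (X 0 w) * Kern j n (X 2 w)) \<le> (C + K 0) * (b n)\<^sup>2"
    unfolding Kern_def
    by (rule kernel_pair_moment[OF prob_space_axioms f2_density measurable_X measurable_X f2_nonneg r le b_pos b_lim])
  have m: "\<forall>\<^sub>F n in sequentially. expectation (\<lambda>w. Kern j n (X 0 w)) / b n < f (x j) + 1" for j
    by (rule order_tendstoD(2)[OF Kern_mean]) simp
  let ?D = "C + K 0 + (f (x i) + 1) * (f (x j) + 1)"
  have "\<forall>\<^sub>F n in sequentially. \<bar>expectation (\<lambda>w. Kc i n (X 0 w) * Kc j n (X 2 w))\<bar> \<le> ?D * (b n)\<^sup>2"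
    using ev m[of i] m[of j] eventually_ge_at_top[of 1]
  proof eventually_elim
    case (elim n)
    have bn: "0 < b n" using b_pos elim(4) by simp
    have "expectation (\<lambda>w. Kern i n (X 0 w)) * expectation (\<lambda>w. Kern j n (X 0 w)) \<le> ((f (x i) + 1) * b n) * ((f (x j) + 1) * b n)"
      using elim(2,3) bn f_nonneg[of "x i"] by (intro mult_mono Kern_expectation_nonneg) (auto simp: field_simps)
    moreover have "0 \<le> expectation (\<lambda>w. Kern i n (X 0 w)) * expectation (\<lambda>w. Kern j n (X 0 w))"
      by (intro mult_nonneg_nonneg Kern_expectation_nonneg)
    moreover have "0 \<le> expectation (\<lambda>w. Kern i n (X 0 w) * Kern j n (X 2 w))"
      by (rule Bochner_Integration.integral_nonneg) (simp add: Kern_def nonneg)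
    moreover have "0 \<le> (C + K 0) * (b n)\<^sup>2" using \<open>0 < C\<close> nonneg[of 0] by simp
    moreover have "((f (x i) + 1) * b n) * ((f (x j) + 1) * b n) = (f (x i) + 1) * (f (x j) + 1) * (b n)\<^sup>2"
      by (simp add: power2_eq_square)
    moreover have "0 \<le> (f (x i) + 1) * (f (x j) + 1) * (b n)\<^sup>2"
      using f_nonneg[of "x i"] f_nonneg[of "x j"] by simp
    ultimately show ?case
      unfolding Kc_product_expectation distrib_right[of "C + K 0"] using elim(1) by linarith
  qed
  moreover have "0 < ?D" using \<open>0 < C\<close> nonneg[of 0] f_nonneg[of "x i"] f_nonneg[of "x j"] by (intro add_pos_nonneg) auto
  ultimately show ?thesis by blast
qed

lemma G_expectation: "expectation (\<lambda>w. G a n (X 0 w)) = 0"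
proof -
  have "expectation (\<lambda>w. G a n (X 0 w)) = (\<Sum>j\<in>UNIV. expectation (\<lambda>w. a j * Kc j n (X 0 w)))"
    unfolding G_def
    by (rule Bochner_Integration.integral_sum) (intro integrable_mult_right integrable_bdd_borel[OF Kc_bdd])
  then show ?thesis by (simp only: integral_mult_right_zero Kc_expectation mult_zero_right sum.neutral_const)
qed

lemma G_product_expectation:
  "expectation (\<lambda>w. G a n (X 0 w) * G a n (X k w)) =
    (\<Sum>i\<in>UNIV. \<Sum>j\<in>UNIV. (a i * a j) * expectation (\<lambda>w. Kc i n (X 0 w) * Kc j n (X k w)))"
proof -
  note ii = integrable_bdd_borel_mult[OF Kc_bdd Kc_bdd]
  have "expectation (\<lambda>w. G a n (X 0 w) * G a n (X k w)) =
    expectation (\<lambda>w. \<Sum>i\<in>UNIV. \<Sum>j\<in>UNIV. (a i * a j) * (Kc i n (X 0 w) * Kc j n (X k w)))"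
    unfolding G_def sum_product by (simp only: mult_ac)
  also have "\<dots> = (\<Sum>i\<in>UNIV. expectation (\<lambda>w. \<Sum>j\<in>UNIV. (a i * a j) * (Kc i n (X 0 w) * Kc j n (X k w))))"
    by (rule Bochner_Integration.integral_sum) (intro Bochner_Integration.integrable_sum integrable_mult_right ii)
  also have "\<dots> = (\<Sum>i\<in>UNIV. \<Sum>j\<in>UNIV. expectation (\<lambda>w. (a i * a j) * (Kc i n (X 0 w) * Kc j n (X k w))))"
    by (rule sum.cong[OF refl], rule Bochner_Integration.integral_sum) (intro integrable_mult_right ii)
  finally show ?thesis by simp
qed

lemma G_clt:
  "(\<lambda>n. expectation (\<lambda>w. iexp (1 / sqrt (real n * b n) * (\<Sum>k=1..n. G a n (X (int k) w))))) \<longlonglongrightarrow>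
     of_real (exp (- ((\<Sum>j\<in>UNIV. (a j)\<^sup>2 * (f (x j) * \<kappa>)) / 2)))" (is ?clt)
  "(\<lambda>n. expectation (\<lambda>w. (\<Sum>k=1..n. G a n (X (int k) w))\<^sup>2) / (real n * b n)) \<longlonglongrightarrow> (\<Sum>j\<in>UNIV. (a j)\<^sup>2 * (f (x j) * \<kappa>))" (is ?var)
proof -
  have Gm: "G a n \<in> borel_measurable borel" for n unfolding G_def by measurable
  \<comment> \<open>The added 1 keeps the bound strictly positive even when all weights
    vanish.\<close>
  define C where "C = (\<Sum>j\<in>UNIV. \<bar>a j\<bar> * (2 * K 0)) + 1"
  have "0 \<le> (\<Sum>j\<in>UNIV. \<bar>a j\<bar> * (2 * K 0))" using nonneg[of 0] by (intro sum_nonneg) auto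
  then have C: "0 < C" by (simp add: C_def)
  have Gb: "\<bar>G a n y\<bar> \<le> C" for n y
  proof -
    have "\<bar>G a n y\<bar> \<le> (\<Sum>j\<in>UNIV. \<bar>a j * Kc j n y\<bar>)" unfolding G_def by (rule sum_abs)
    also have "\<dots> \<le> (\<Sum>j\<in>UNIV. \<bar>a j\<bar> * (2 * K 0))"
      unfolding abs_mult by (intro sum_mono mult_left_mono Kc_abs_le) auto
    finally show ?thesis by (simp add: C_def)
  qed
  have "(\<lambda>n. \<Sum>i\<in>UNIV. \<Sum>j\<in>UNIV. (a i * a j) * (expectation (\<lambda>w. Kc i n (X 0 w) * Kc j n (X 0 w)) / b n)) \<longlonglongrightarrow>
      (\<Sum>i\<in>UNIV. \<Sum>j\<in>UNIV. (a i * a j) * (if i = j then f (x i) * \<kappa> else 0))"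
    by (intro tendsto_sum tendsto_mult tendsto_const Kc_variance)
  moreover have "(\<Sum>i\<in>UNIV. \<Sum>j\<in>UNIV. (a i * a j) * (if i = j then f (x i) * \<kappa> else 0)) = (\<Sum>j\<in>UNIV. (a j)\<^sup>2 * (f (x j) * \<kappa>))"
    by (simp add: if_distrib[of "\<lambda>t. _ * t"] power2_eq_square cong: if_cong)
  ultimately have var: "(\<lambda>n. expectation (\<lambda>w. G a n (X 0 w) * G a n (X 0 w)) / b n) \<longlonglongrightarrow> (\<Sum>j\<in>UNIV. (a j)\<^sup>2 * (f (x j) * \<kappa>))"
    unfolding G_product_expectation by (simp add: sum_divide_distrib)
  let ?P = "\<lambda>i j D. 0 < D \<and> (\<forall>\<^sub>F n in sequentially. \<bar>expectation (\<lambda>w. Kc i n (X 0 w) * Kc j n (X 2 w))\<bar> \<le> D * (b n)\<^sup>2)"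
  \<comment> \<open>One constant is chosen per pair of points. There are finitely many pairs, so the
    eventual bounds hold simultaneously from some n on.\<close>
  define D where "D i j = (SOME D. ?P i j D)" for i j
  have "?P i j (D i j)" for i j
    unfolding D_def by (rule someI_ex) (rule Kc_lag2)
  then have D: "\<And>i j. 0 < D i j" "\<And>i j. \<forall>\<^sub>F n in sequentially. \<bar>expectation (\<lambda>w. Kc i n (X 0 w) * Kc j n (X 2 w))\<bar> \<le> D i j * (b n)\<^sup>2"
    by blast+
  define E where "E = (\<Sum>i\<in>UNIV. \<Sum>j\<in>UNIV. \<bar>a i * a j\<bar> * D i j) + 1"
  have "0 \<le> (\<Sum>i\<in>UNIV. \<Sum>j\<in>UNIV. \<bar>a i * a j\<bar> * D i j)"
    using D(1) by (intro sum_nonneg mult_nonneg_nonneg) (auto intro: less_imp_le)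
  then have E: "0 < E" by (simp add: E_def)
  have "\<forall>\<^sub>F n in sequentially. \<forall>i\<in>UNIV. \<forall>j\<in>UNIV. \<bar>expectation (\<lambda>w. Kc i n (X 0 w) * Kc j n (X 2 w))\<bar> \<le> D i j * (b n)\<^sup>2"
    by (intro eventually_ball_finite ballI D(2)) auto
  then have lag2: "\<forall>\<^sub>F n in sequentially. expectation (\<lambda>w. G a n (X 0 w) * G a n (X 2 w)) \<le> E * (b n)\<^sup>2"
  proof eventually_elim
    case (elim n)
    have "expectation (\<lambda>w. G a n (X 0 w) * G a n (X 2 w)) \<le>
      (\<Sum>i\<in>UNIV. \<Sum>j\<in>UNIV. \<bar>a i * a j\<bar> * (D i j * (b n)\<^sup>2))"
      unfolding G_product_expectation
    proof (intro sum_mono)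
      fix i j
      have "(a i * a j) * expectation (\<lambda>w. Kc i n (X 0 w) * Kc j n (X 2 w)) \<le> \<bar>a i * a j\<bar> * \<bar>expectation (\<lambda>w. Kc i n (X 0 w) * Kc j n (X 2 w))\<bar>"
        unfolding abs_mult[symmetric] by (rule abs_ge_self)
      also have "\<dots> \<le> \<bar>a i * a j\<bar> * (D i j * (b n)\<^sup>2)"
        by (rule mult_left_mono) (use elim in auto)
      finally show "(a i * a j) * expectation (\<lambda>w. Kc i n (X 0 w) * Kc j n (X 2 w)) \<le> \<bar>a i * a j\<bar> * (D i j * (b n)\<^sup>2)" .
    qed
    also have "\<dots> = (\<Sum>i\<in>UNIV. \<Sum>j\<in>UNIV. \<bar>a i * a j\<bar> * D i j) * (b n)\<^sup>2"
      by (simp only: sum_distrib_right mult.assoc)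
    also have "\<dots> \<le> E * (b n)\<^sup>2" unfolding E_def by (intro mult_right_mono) auto
    finally show ?case .
  qed
  show ?clt ?var
    by (rule triangular_clt[OF mixing b_pos b_lim nb4 Gm Gb C G_expectation var lag2 E])+
qed

lemma kde_eq: "kde K b X n (x j) w = 1 / (real n * b n) * (\<Sum>k=1..n. Kern j n (X (int k) w))"
  by (simp add: kde_def Kern_def)

lemma kde_centred:
  assumes n: "1 \<le> n"
  shows "kde K b X n (x j) w - expectation (\<lambda>w. kde K b X n (x j) w) = 1 / (real n * b n) * (\<Sum>k=1..n. Kc j n (X (int k) w))"
    and "expectation (\<lambda>w. kde K b X n (x j) w) = expectation (\<lambda>w. Kern j n (X 0 w)) / b n"
proof -
  have "expectation (\<lambda>w. kde K b X n (x j) w) = 1 / (real n * b n) * (\<Sum>k=1..n. expectation (\<lambda>w. Kern j n (X (int k) w)))"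
    unfolding kde_eq using integrable_bdd_borel[OF Kern_bdd] by (simp add: Bochner_Integration.integral_sum)
  also have "\<dots> = 1 / (real n * b n) * (real n * expectation (\<lambda>w. Kern j n (X 0 w)))"
  proof -
    have "(\<Sum>k=1..n. expectation (\<lambda>w. Kern j n (X (int k) w))) = (\<Sum>k=1..n. expectation (\<lambda>w. Kern j n (X 0 w)))"
      by (intro sum.cong refl expectation_shift) simp
    then show ?thesis by (simp only: sum_constant card_atLeastAtMost diff_Suc_1)
  qed
  finally have e: "expectation (\<lambda>w. kde K b X n (x j) w) = 1 / (real n * b n) * (real n * expectation (\<lambda>w. Kern j n (X 0 w)))" .
  show "kde K b X n (x j) w - expectation (\<lambda>w. kde K b X n (x j) w) = 1 / (real n * b n) * (\<Sum>k=1..n. Kc j n (X (int k) w))"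
    unfolding e unfolding kde_eq Kc_def by (simp add: sum_subtractf right_diff_distrib)
  show "expectation (\<lambda>w. kde K b X n (x j) w) = expectation (\<lambda>w. Kern j n (X 0 w)) / b n"
    unfolding e using n by simp
qed

lemma kde_measurable [measurable]: "(\<lambda>w. kde K b X n (x j) w) \<in> borel_measurable M"
  unfolding kde_eq by measurable

lemma Kc_sum_bound: "\<bar>\<Sum>k=1..n. Kc j n (X (int k) w)\<bar> \<le> real n * (2 * K 0)"
  by (rule order_trans[OF sum_abs]) (rule order_trans[OF sum_bounded_above[OF Kc_abs_le]], simp)

lemma Kc_sum_second_moment:
  "(\<lambda>n. expectation (\<lambda>w. (\<Sum>k=1..n. Kc j n (X (int k) w))\<^sup>2) / (real n * b n)) \<longlonglongrightarrow> f (x j) * \<kappa>"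
proof -
  \<comment> \<open>The coordinate vector of \<open>j\<close> turns \<open>G\<close> into the single
    centred kernel \<open>Kc j\<close>.\<close>
  let ?a = "\<lambda>i. if i = j then 1 else 0 :: real"
  have "G ?a n y = Kc j n y" for n y
    by (simp add: G_def if_distrib[of "\<lambda>t. t * _"] cong: if_cong)
  moreover have "(\<Sum>i\<in>UNIV. (?a i)\<^sup>2 * (f (x i) * \<kappa>)) = f (x j) * \<kappa>"
    by (simp add: if_distrib[of "\<lambda>t. t\<^sup>2 * _"] cong: if_cong)
  ultimately show ?thesis using G_clt(2)[of ?a] by simp
qed

lemma nb_at_top: "filterlim (\<lambda>n. real n * b n) at_top sequentially"
proof (rule filterlim_at_top_mono[OF nb4])
  have "\<forall>\<^sub>F n in sequentially. b n < 1" by (rule order_tendstoD(2)[OF b_lim]) simp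
  then show "\<forall>\<^sub>F n in sequentially. real n * b n ^ 4 \<le> real n * b n"
    using eventually_ge_at_top[of 1]
  proof eventually_elim
    case (elim n)
    have "0 < b n" using b_pos elim(2) by simp
    then have "b n ^ 4 \<le> b n ^ 1" using elim(1) by (intro power_decreasing) auto
    then show ?case by (intro mult_left_mono) auto
  qed
qed

lemma integrable_kde_error: "integrable M (\<lambda>w. (kde K b X n (x j) w - f (x j))\<^sup>2)"
proof -
  have "\<bar>\<Sum>k=1..n. Kern j n (X (int k) w)\<bar> \<le> real n * K 0" for w
    by (rule order_trans[OF sum_abs]) (rule order_trans[OF sum_bounded_above[of _ _ "K 0"]], simp_all add: Kern_def abs_K_le)
  then have "\<bar>1 / (real n * b n)\<bar> * \<bar>\<Sum>k=1..n. Kern j n (X (int k) w)\<bar> \<le> \<bar>1 / (real n * b n)\<bar> * (real n * K 0)" for w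
    by (rule mult_left_mono) simp
  then have "\<bar>kde K b X n (x j) w\<bar> \<le> \<bar>1 / (real n * b n)\<bar> * (real n * K 0)" for w
    unfolding kde_eq abs_mult .
  then have bd: "\<bar>kde K b X n (x j) w - f (x j)\<bar> \<le> \<bar>1 / (real n * b n)\<bar> * (real n * K 0) + \<bar>f (x j)\<bar>" for w
    by (intro order_trans[OF abs_triangle_ineq4] add_mono order_refl)
  show ?thesis
    unfolding power2_eq_square by (rule integrable_bounded_mult[OF _ _ bd bd]) measurable
qed

text \<open>Variance plus squared bias: the variance is O(1 / (n b)) by
  \<open>Kc_sum_second_moment\<close>, and the bias vanishes by \<open>Kern_mean\<close>. Mean
  square is the mode of convergence that \<open>slutsky_ratio\<close> takes.\<close>

lemma kde_consistent: "(\<lambda>n. expectation (\<lambda>w. (kde K b X n (x j) w - f (x j))\<^sup>2)) \<longlonglongrightarrow> 0"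
proof -
  define V where "V n = expectation (\<lambda>w. (\<Sum>k=1..n. Kc j n (X (int k) w))\<^sup>2)" for n
  define e where "e n = expectation (\<lambda>w. Kern j n (X 0 w)) / b n" for n
  have inv: "(\<lambda>n. inverse (real n * b n)) \<longlonglongrightarrow> 0"
    by (rule tendsto_inverse_0_at_top[OF nb_at_top])
  have "(\<lambda>n. 2 * (V n / (real n * b n) * inverse (real n * b n)) + 2 * (e n - f (x j))\<^sup>2) \<longlonglongrightarrow> 2 * (f (x j) * \<kappa> * 0) + 2 * (f (x j) - f (x j))\<^sup>2"
    unfolding V_def e_def by (intro tendsto_intros Kc_sum_second_moment inv Kern_mean)
  then have lim: "(\<lambda>n. 2 * (V n / (real n * b n) * inverse (real n * b n)) + 2 * (e n - f (x j))\<^sup>2) \<longlonglongrightarrow> 0" by simp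
  show ?thesis
  proof (rule Lim_null_comparison[OF _ lim])
    show "\<forall>\<^sub>F n in sequentially. norm (expectation (\<lambda>w. (kde K b X n (x j) w - f (x j))\<^sup>2)) \<le>
        2 * (V n / (real n * b n) * inverse (real n * b n)) + 2 * (e n - f (x j))\<^sup>2"
      using eventually_ge_at_top[of 1]
    proof eventually_elim
      case (elim n)
      let ?S = "\<lambda>w. \<Sum>k=1..n. Kc j n (X (int k) w)"
      have iS: "integrable M (\<lambda>w. (?S w)\<^sup>2)"
        unfolding power2_eq_square by (rule integrable_bounded_mult[OF _ _ Kc_sum_bound Kc_sum_bound]) measurable
      have sq: "(u + v)\<^sup>2 \<le> 2 * u\<^sup>2 + 2 * v\<^sup>2" for u v :: real
      proof -
        have "0 \<le> (u - v)\<^sup>2" by simp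
        then show ?thesis by (simp add: power2_eq_square algebra_simps)
      qed
      have "expectation (\<lambda>w. (kde K b X n (x j) w - f (x j))\<^sup>2) \<le>
          expectation (\<lambda>w. 2 * ((1 / (real n * b n))\<^sup>2 * (?S w)\<^sup>2) + 2 * (e n - f (x j))\<^sup>2)"
      proof (rule integral_mono[OF integrable_kde_error])
        show "integrable M (\<lambda>w. 2 * ((1 / (real n * b n))\<^sup>2 * (?S w)\<^sup>2) + 2 * (e n - f (x j))\<^sup>2)"
          using iS by (intro Bochner_Integration.integrable_add integrable_mult_right integrable_const)
        fix w
        have "kde K b X n (x j) w - f (x j) = 1 / (real n * b n) * ?S w + (e n - f (x j))"
          using kde_centred(1)[OF elim, of j w] kde_centred(2)[OF elim, of j] unfolding e_def by linarith
        then show "(kde K b X n (x j) w - f (x j))\<^sup>2 \<le> 2 * ((1 / (real n * b n))\<^sup>2 * (?S w)\<^sup>2) + 2 * (e n - f (x j))\<^sup>2"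
          using sq[of "1 / (real n * b n) * ?S w" "e n - f (x j)"] by (simp only: power_mult_distrib)
      qed
      also have "\<dots> = 2 * ((1 / (real n * b n))\<^sup>2 * V n) + 2 * (e n - f (x j))\<^sup>2"
        using iS by (simp add: V_def prob_space)
      also have "(1 / (real n * b n))\<^sup>2 * V n = V n / (real n * b n) * inverse (real n * b n)"
        by (simp add: power2_eq_square divide_inverse)
      finally show ?case by simp
    qed
  qed
qed

text \<open>The vector of the theorem with f (x j) in place of the estimator under the root;
  \<open>ratio_eq_normalized\<close> links the two.\<close>

definition normalized :: "nat \<Rightarrow> 'w \<Rightarrow> real ^ 'm" where
  "normalized n w = (\<chi> j. 1 / sqrt (real n * b n) * (\<Sum>k=1..n. Kc j n (X (int k) w)) / sqrt (f (x j) * \<kappa>))"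

lemma measurable_vec_lambda:
  fixes F :: "'m \<Rightarrow> 'w \<Rightarrow> real"
  assumes [measurable]: "\<And>j. F j \<in> borel_measurable M"
  shows "(\<lambda>w. \<chi> j. F j w) \<in> borel_measurable M"
  by (subst borel_measurable_euclidean_space) (auto simp: Basis_vec_def inner_axis)

lemma normalized_measurable [measurable]: "normalized n \<in> borel_measurable M"
  unfolding normalized_def by (rule measurable_vec_lambda) measurable

text \<open>Each coordinate has second moment tending to 1, so the sum tends to the dimension; the
  added 1 is the slack that turns the limit into an eventual bound.\<close>

lemma normalized_second_moment:
  "\<forall>\<^sub>F n in sequentially. integrable M (\<lambda>w. (norm (normalized n w))\<^sup>2) \<and> expectation (\<lambda>w. (norm (normalized n w))\<^sup>2) \<le> real CARD('m) + 1"
proof -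
  let ?S = "\<lambda>n j w. \<Sum>k=1..n. Kc j n (X (int k) w)"
  have iS: "integrable M (\<lambda>w. (?S n j w)\<^sup>2)" for n j
    unfolding power2_eq_square by (rule integrable_bounded_mult[OF _ _ Kc_sum_bound Kc_sum_bound]) measurable
  have "(\<lambda>n. \<Sum>j\<in>UNIV. expectation (\<lambda>w. (?S n j w)\<^sup>2) / (real n * b n) / (f (x j) * \<kappa>)) \<longlonglongrightarrow> (\<Sum>j\<in>UNIV. f (x j) * \<kappa> / (f (x j) * \<kappa>))"
    using f_nonzero \<kappa>_pos by (intro tendsto_sum tendsto_divide Kc_sum_second_moment tendsto_const) auto
  moreover have "(\<Sum>j\<in>(UNIV :: 'm set). f (x j) * \<kappa> / (f (x j) * \<kappa>)) = real CARD('m)"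
    using f_nonzero \<kappa>_pos by simp
  ultimately have "\<forall>\<^sub>F n in sequentially. (\<Sum>j\<in>UNIV. expectation (\<lambda>w. (?S n j w)\<^sup>2) / (real n * b n) / (f (x j) * \<kappa>)) < real CARD('m) + 1"
    by (intro order_tendstoD(2)) auto
  then show ?thesis
    using eventually_ge_at_top[of 1]
  proof eventually_elim
    case (elim n)
    have bn: "0 < b n" using b_pos elim(2) by simp
    have nrm: "(norm (normalized n w))\<^sup>2 = (\<Sum>j\<in>UNIV. (?S n j w)\<^sup>2 / (real n * b n) / (f (x j) * \<kappa>))" for w
    proof -
      have "(norm (normalized n w))\<^sup>2 = (\<Sum>j\<in>UNIV. (normalized n w $ j)\<^sup>2)"
        by (simp add: norm_vec_def L2_set_def sum_nonneg)
      also have "\<dots> = (\<Sum>j\<in>UNIV. (?S n j w)\<^sup>2 / (real n * b n) / (f (x j) * \<kappa>))"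
        using bn elim(2) f_pos \<kappa>_pos
        by (intro sum.cong refl) (simp add: normalized_def power_mult_distrib power_divide less_imp_le)
      finally show ?thesis .
    qed
    have "expectation (\<lambda>w. (norm (normalized n w))\<^sup>2) = (\<Sum>j\<in>UNIV. expectation (\<lambda>w. (?S n j w)\<^sup>2 / (real n * b n) / (f (x j) * \<kappa>)))"
      unfolding nrm by (rule Bochner_Integration.integral_sum) (intro integrable_divide iS)
    also have "\<dots> = (\<Sum>j\<in>UNIV. expectation (\<lambda>w. (?S n j w)\<^sup>2) / (real n * b n) / (f (x j) * \<kappa>))"
      by simp
    finally have "expectation (\<lambda>w. (norm (normalized n w))\<^sup>2) \<le> real CARD('m) + 1" using elim(1) by simp
    moreover have "integrable M (\<lambda>w. (norm (normalized n w))\<^sup>2)"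
      unfolding nrm by (intro Bochner_Integration.integrable_sum integrable_divide iS)
    ultimately show ?case by blast
  qed
qed

text \<open>Cramer-Wold with the weights u_j / sqrt (f (x_j) \<kappa>), chosen so that the limiting
  variance of the combination is u . u.\<close>

lemma normalized_char:
  "(\<lambda>n. expectation (\<lambda>w. iexp (u \<bullet> normalized n w))) \<longlonglongrightarrow> of_real (exp (- (u \<bullet> u) / 2))"
proof -
  define a where "a j = u $ j / sqrt (f (x j) * \<kappa>)" for j
  have "u \<bullet> normalized n w = 1 / sqrt (real n * b n) * (\<Sum>k=1..n. G a n (X (int k) w))" for n w
  proof -
    have "u \<bullet> normalized n w = (\<Sum>j\<in>UNIV. 1 / sqrt (real n * b n) * (a j * (\<Sum>k=1..n. Kc j n (X (int k) w))))"
      by (simp add: inner_vec_def normalized_def a_def)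
    also have "\<dots> = 1 / sqrt (real n * b n) * (\<Sum>j\<in>UNIV. \<Sum>k=1..n. a j * Kc j n (X (int k) w))"
      by (simp only: sum_distrib_left)
    also have "(\<Sum>j\<in>UNIV. \<Sum>k=1..n. a j * Kc j n (X (int k) w)) = (\<Sum>k=1..n. G a n (X (int k) w))"
      unfolding G_def by (rule sum.swap)
    finally show ?thesis .
  qed
  moreover have "(\<Sum>j\<in>UNIV. (a j)\<^sup>2 * (f (x j) * \<kappa>)) = u \<bullet> u"
  proof -
    have "(a j)\<^sup>2 * (f (x j) * \<kappa>) = u $ j * u $ j" for j
      using f_pos[of j] \<kappa>_pos by (simp add: a_def power_divide) (simp add: power2_eq_square)
    then show ?thesis by (simp add: inner_vec_def)
  qed
  ultimately show ?thesis using G_clt(1)[of a] by simp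
qed

lemma ratio_eq_normalized:
  assumes n: "1 \<le> n" and pos: "0 < kde K b X n (x j) w"
  shows "sqrt (real n * b n) * kde_ratio M K b X c n (x j) w =
    normalized n w $ j * sqrt (f (x j) / kde K b X n (x j) w)"
proof -
  have nb: "0 < real n * b n" using b_pos n by simp
  have "sqrt (real n * b n) * kde_ratio M K b X c n (x j) w =
      sqrt (real n * b n) * (1 / (real n * b n) * (\<Sum>k=1..n. Kc j n (X (int k) w)) / sqrt (kde K b X n (x j) w * \<kappa>))"
    using pos unfolding kde_ratio_def kde_centred(1)[OF n] \<kappa>_def by simp
  also have "\<dots> = (sqrt (real n * b n) / (real n * b n)) * (\<Sum>k=1..n. Kc j n (X (int k) w)) / sqrt (kde K b X n (x j) w * \<kappa>)"
    by simp
  also have "sqrt (real n * b n) / (real n * b n) = 1 / sqrt (real n * b n)"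
    using nb by (simp add: real_div_sqrt divide_simps)
  also have "1 / sqrt (real n * b n) * (\<Sum>k=1..n. Kc j n (X (int k) w)) / sqrt (kde K b X n (x j) w * \<kappa>) =
      normalized n w $ j * sqrt (f (x j) / kde K b X n (x j) w)"
    using f_pos[of j] \<kappa>_pos pos by (simp add: normalized_def real_sqrt_mult real_sqrt_divide)
  finally show ?thesis .
qed

text \<open>The values \<open>c\<close> may vary with n and with the coordinate. They are taken only
  where the estimator vanishes, and there it misses f (x j) by the fixed amount f (x j) > 0, so
  \<open>kde_consistent\<close> makes that event negligible.\<close>

theorem kde_clt:
  fixes c :: "nat \<Rightarrow> 'm \<Rightarrow> real"
  shows "converges_in_distribution M
    (\<lambda>n w. sqrt (real n * b n) *\<^sub>R (\<chi> j. kde_ratio M K b X (c n j) n (x j) w))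
    (multivariate_normal 0 (mat 1 :: real ^ 'm ^ 'm))"
  unfolding converges_in_distribution_def
proof (intro conjI allI impI)
  define S where "S n w = sqrt (real n * b n) *\<^sub>R (\<chi> j. kde_ratio M K b X (c n j) n (x j) w)" for n w
  have "(\<lambda>w. kde_ratio M K b X (c n j) n (x j) w) \<in> borel_measurable M" for n j
    unfolding kde_ratio_def by measurable
  then have Sm: "S n \<in> borel_measurable M" for n
    unfolding S_def by (intro borel_measurable_scaleR borel_measurable_const measurable_vec_lambda)
  then show "(\<lambda>w. sqrt (real n * b n) *\<^sub>R (\<chi> j. kde_ratio M K b X (c n j) n (x j) w)) \<in> borel_measurable M" for n
    by (simp add: S_def[abs_def])
  fix g :: "real ^ 'm \<Rightarrow> real" assume "continuous_on UNIV g \<and> bounded (range g)"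
  then obtain B where g: "continuous_on UNIV g" "\<And>z. \<bar>g z\<bar> \<le> B"
    by (auto simp: bounded_iff)
  let ?N = "multivariate_normal 0 (mat 1 :: real ^ 'm ^ 'm)"
  have "(\<lambda>n. expectation (\<lambda>w. g (normalized n w))) \<longlonglongrightarrow> (\<integral>z. g z \<partial>?N)"
  proof (rule multivariate_levy_continuity[OF prob_space_multivariate_normal_std _ normalized_measurable normalized_second_moment _ g])
    show "sets ?N = sets borel" by (simp add: multivariate_normal_def)
    show "(\<lambda>n. expectation (\<lambda>w. iexp (u \<bullet> normalized n w))) \<longlonglongrightarrow> (\<integral>z. iexp (u \<bullet> z) \<partial>?N)" for u
      unfolding char_multivariate_normal_std by (rule normalized_char)
  qed
  moreover have "\<forall>\<^sub>F n in sequentially. \<forall>w j. 0 < kde K b X n (x j) w \<longrightarrow>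
      S n w $ j = normalized n w $ j * sqrt (f (x j) / kde K b X n (x j) w)"
    using eventually_ge_at_top[of 1]
    by eventually_elim (auto simp: S_def ratio_eq_normalized)
  ultimately have "(\<lambda>n. expectation (\<lambda>w. g (S n w))) \<longlonglongrightarrow> (\<integral>z. g z \<partial>?N)"
    by (intro slutsky_ratio[where T = normalized and S = S and D = "\<lambda>n j w. kde K b X n (x j) w" and c = "\<lambda>j. f (x j)",
          OF normalized_measurable Sm f_pos normalized_second_moment integrable_kde_error kde_consistent _ g])
  then show "(\<lambda>n. expectation (\<lambda>w. g (sqrt (real n * b n) *\<^sub>R (\<chi> j. kde_ratio M K b X (c n j) n (x j) w)))) \<longlonglongrightarrow> (\<integral>z. g z \<partial>?N)"
    by (simp add: S_def)
qed

end

theorem mainTheorem4: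
  fixes M :: "'w measure"
    and X :: "int \<Rightarrow> 'w \<Rightarrow> real"
    and f :: "real \<Rightarrow> real"
    and f2 :: "real \<times> real \<Rightarrow> real"
    and b :: "nat \<Rightarrow> real"
    and K :: "real \<Rightarrow> real"
    and x :: "'m::finite \<Rightarrow> real"
    and c :: "nat \<Rightarrow> 'm \<Rightarrow> real"
  assumes "prob_space M"
    and "markov_chain M X" and "strictly_stationary M X" and "reversible M X"
    and f_nonneg: "\<forall>t. f t \<ge> 0"
    and f_density: "distributed M lborel (X 0) f"
    and mixing: "summable (\<lambda>k. real (Suc k) * alpha_mixing M X (Suc k))"
    and b_pos: "\<forall>n\<ge>1. b n > 0"
    and b_lim: "b \<longlonglongrightarrow> 0"
    and nb4: "filterlim (\<lambda>n. real n * b n ^ 4) at_top sequentially"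
    and K_nonneg: "\<forall>u. K u \<ge> 0"
    and C1_sym: "\<forall>u. K (- u) = K u"
    and C1_decr: "antimono_on {0<..} K"
    and C1_int: "has_bochner_integral lborel K 1"
    and C2: "((\<lambda>u. u\<^sup>2 * K u) \<longlongrightarrow> 0) at_top"
    and C3_diff: "\<forall>u. K differentiable (at u)"
    and C3_bounded: "bounded (range (deriv K))"
    and x_distinct: "inj x"
    and f_cont: "\<forall>j. isCont f (x j)"
    and f_nonzero: "\<forall>j. f (x j) \<noteq> 0"
    and f2_nonneg: "\<forall>p. f2 p \<ge> 0"
    and f2_density: "distributed M (lborel \<Otimes>\<^sub>M lborel) (\<lambda>\<omega>. (X 0 \<omega>, X 2 \<omega>)) f2"
    and f2_bounded: "\<forall>i j. \<exists>r>0. \<exists>C. \<forall>s t. \<bar>s\<bar> < r \<and> \<bar>t\<bar> < r \<longrightarrow> \<bar>f2 (x i + s, x j + t)\<bar> < C"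
  shows "converges_in_distribution M
    (\<lambda>n \<omega>. sqrt (real n * b n) *\<^sub>R (\<chi> j. kde_ratio M K b X (c n j) n (x j) \<omega>))
    (multivariate_normal 0 (mat 1 :: real ^ 'm ^ 'm))"
proof -
  interpret reversible_chain M X
    by (intro reversible_chain.intro reversible_chain_axioms.intro assms(1-4))
  have "continuous_on UNIV K"
    using C3_diff by (simp add: continuous_on_eq_continuous_at differentiable_imp_continuous_within)
  then interpret kernel K
    using K_nonneg C1_sym C1_decr C1_int C2 by (intro kernel.intro) auto
  interpret kernel_estimation M X K f f2 b x
    by unfold_locales (use assms in \<open>auto simp only:\<close>)
  show ?thesis by (rule kde_clt)
qed

end
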